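(* Let $\mathcal{A}$ be a (complex) $C^*$-algebra satisfying property $(\ddagger)$. Then $\mathcal{A}$ is isometrically $*$-isomorphic to a $c_0$-direct sum $\bigoplus_{c_0}\mathcal{L}(H_\alpha)$, for a family of finite-dimensional Hilbert spaces $\{H_\alpha\}_{\alpha\in J}$, for some index set $J$, where $\mathcal{L}(H_\alpha)$ is the space of bounded operators on $H_\alpha$.
   Context: All Banach spaces are complex. For a Banach space $X$, $B(X)$ denotes its closed unit ball and $X^*$ its dual. A functional $\phi\in X^*$ is norm-attaining if there is $x\in B(X)$ with $|\phi(x)|=\|\phi\|$. $X$ has property $(\ddagger)$ if for any $0<\varepsilon<2$, whenever $\{\phi_\alpha\}$ is a net of norm-attaining functionals in $B(X^* )$ with $\|\phi_\alpha-\phi_\beta\|\ge\varepsilon$ for all $\alpha\ne\beta$, and $\phi\in B(X^* )$ is norm-attaining with $\phi_\alpha\to\phi$ in the weak* topology, then $\|\phi\|\le 1-\varepsilon/2$. The $c_0$-direct sum of Banach spaces $\{X_\gamma\}$ is the space of families $(x_\gamma)$, $x_\gamma\in X_\gamma$, such that $\{\gamma:\|x_\gamma\|\ge\delta\}$ is finite for every $\delta>0$, with norm $\sup_\gamma\|x_\gamma\|$ (for $C^*$-algebras, with coordinatewise operations). *)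

theory Defs
  imports "HOL-Analysis.Analysis" "HOL-Library.Function_Algebras"
begin

subsection \<open>Complex Banach spaces and C*-algebras\<close>

class complex_vector = real_vector +
  fixes scaleC :: "complex \<Rightarrow> 'a \<Rightarrow> 'a" (infixr "*\<^sub>C" 75)
  assumes scaleC_add_right: "a *\<^sub>C (x + y) = a *\<^sub>C x + a *\<^sub>C y"
    and scaleC_add_left: "(a + b) *\<^sub>C x = a *\<^sub>C x + b *\<^sub>C x"
    and scaleC_scaleC: "a *\<^sub>C (b *\<^sub>C x) = (a * b) *\<^sub>C x"
    and scaleC_one: "1 *\<^sub>C x = x"
    and scaleR_scaleC: "r *\<^sub>R x = complex_of_real r *\<^sub>C x"

global_interpretation complex_vector: vector_space "scaleC :: complex \<Rightarrow> 'a \<Rightarrow> 'a::complex_vector"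
  defines csubspace = complex_vector.subspace
    and cspan = complex_vector.span
  by unfold_locales (simp_all add: scaleC_add_right scaleC_add_left scaleC_scaleC scaleC_one)

class complex_banach = complex_vector + banach +
  assumes norm_scaleC: "norm (a *\<^sub>C x) = cmod a * norm x"

(* Not assumed unital: real_normed_algebra only asks for a submultiplicative norm. *)
class cstar_algebra = complex_banach + real_normed_algebra +
  fixes star :: "'a \<Rightarrow> 'a"
  assumes mult_scaleC_left: "(a *\<^sub>C x) * y = a *\<^sub>C (x * y)"
    and mult_scaleC_right: "x * (a *\<^sub>C y) = a *\<^sub>C (x * y)"
    and star_add: "star (x + y) = star x + star y"
    and star_scaleC: "star (a *\<^sub>C x) = cnj a *\<^sub>C star x"
    and star_mult: "star (x * y) = star y * star x"
    and star_star: "star (star x) = x"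
    and cstar_identity: "norm (star x * x) = (norm x)\<^sup>2"

instantiation "fun" :: (type, complex_vector) complex_vector
begin

definition scaleR_fun :: "real \<Rightarrow> ('a \<Rightarrow> 'b) \<Rightarrow> 'a \<Rightarrow> 'b"
  where "scaleR_fun r f = (\<lambda>i. r *\<^sub>R f i)"

definition scaleC_fun :: "complex \<Rightarrow> ('a \<Rightarrow> 'b) \<Rightarrow> 'a \<Rightarrow> 'b"
  where "scaleC_fun a f = (\<lambda>i. a *\<^sub>C f i)"

instance
  by intro_classes
    (simp_all add: scaleR_fun_def scaleC_fun_def fun_eq_iff scaleR_add_right scaleR_add_left
      scaleC_add_right scaleC_add_left scaleC_scaleC scaleC_one scaleR_scaleC)

end

instantiation complex :: cstar_algebra
begin

definition scaleC_complex :: "complex \<Rightarrow> complex \<Rightarrow> complex"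
  where "scaleC_complex = (*)"

definition star_complex :: "complex \<Rightarrow> complex"
  where "star_complex = cnj"

instance
  by intro_classes
    (simp_all add: scaleC_complex_def star_complex_def algebra_simps norm_mult power2_eq_square
      scaleR_conv_of_real)

end


subsection \<open>The dual space, nets and the weak* topology\<close>

(* The dual of a complex Banach space: the complex-linear members of the type of bounded
   real-linear maps into complex; the norm of that type is the usual dual norm. *)
definition cdual :: "('a::complex_banach \<Rightarrow>\<^sub>L complex) set"
  where "cdual = {\<phi>. \<forall>a x. blinfun_apply \<phi> (a *\<^sub>C x) = a * blinfun_apply \<phi> x}"

definition dual_ball :: "('a::complex_banach \<Rightarrow>\<^sub>L complex) set"
  where "dual_ball = {\<phi> \<in> cdual. norm \<phi> \<le> 1}"

definition norm_attaining :: "('a::complex_banach \<Rightarrow>\<^sub>L complex) \<Rightarrow> bool"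
  where "norm_attaining \<phi> \<longleftrightarrow> (\<exists>x. norm x \<le> 1 \<and> cmod (blinfun_apply \<phi> x) = norm \<phi>)"

definition weak_star :: "('a::complex_banach \<Rightarrow>\<^sub>L complex) topology"
  where "weak_star = pullback_topology cdual blinfun_apply (product_topology (\<lambda>_. euclidean) UNIV)"

definition directed_set :: "'i set \<Rightarrow> ('i \<times> 'i) set \<Rightarrow> bool"
  where "directed_set D r \<longleftrightarrow> D \<noteq> {} \<and> (\<forall>i\<in>D. (i, i) \<in> r) \<and>
    (\<forall>i\<in>D. \<forall>j\<in>D. \<forall>k\<in>D. (i, j) \<in> r \<longrightarrow> (j, k) \<in> r \<longrightarrow> (i, k) \<in> r) \<and>
    (\<forall>i\<in>D. \<forall>j\<in>D. \<exists>k\<in>D. (i, k) \<in> r \<and> (j, k) \<in> r)"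

definition tail_filter :: "'i set \<Rightarrow> ('i \<times> 'i) set \<Rightarrow> 'i filter"
  where "tail_filter D r = (INF i\<in>D. principal {j\<in>D. (i, j) \<in> r})"

lemma eventually_tail_filter:
  assumes "directed_set D r"
  shows "eventually P (tail_filter D r) \<longleftrightarrow> (\<exists>i\<in>D. \<forall>j\<in>D. (i, j) \<in> r \<longrightarrow> P j)"
proof -
  have "eventually P (tail_filter D r) \<longleftrightarrow>
      (\<exists>i\<in>D. eventually P (principal {j \<in> D. (i, j) \<in> r}))"
    unfolding tail_filter_def
  proof (rule eventually_INF_base)
    show "D \<noteq> {}"
      using assms unfolding directed_set_def by blast
  next
    fix i j assume ij: "i \<in> D" "j \<in> D"
    then obtain k where k: "k \<in> D" "(i, k) \<in> r" "(j, k) \<in> r"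
      using assms unfolding directed_set_def by blast
    have "{l \<in> D. (k, l) \<in> r} \<subseteq> {l \<in> D. (i, l) \<in> r} \<inter> {l \<in> D. (j, l) \<in> r}"
      using assms k ij unfolding directed_set_def by blast
    then have "principal {l \<in> D. (k, l) \<in> r}
        \<le> inf (principal {l \<in> D. (i, l) \<in> r}) (principal {l \<in> D. (j, l) \<in> r})"
      unfolding inf_principal principal_le_iff .
    with k(1) show "\<exists>k\<in>D. principal {l \<in> D. (k, l) \<in> r}
        \<le> inf (principal {l \<in> D. (i, l) \<in> r}) (principal {l \<in> D. (j, l) \<in> r})"
      by blast
  qed
  then show ?thesis
    unfolding eventually_principal by blast
qed

lemma limitin_weak_star:
  assumes "\<phi> \<in> cdual" and "\<forall>\<^sub>F i in F. f i \<in> cdual"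
  shows "limitin weak_star f \<phi> F \<longleftrightarrow>
    (\<forall>x. ((\<lambda>i. blinfun_apply (f i) x) \<longlongrightarrow> blinfun_apply \<phi> x) F)"
proof -
  have "limitin weak_star f \<phi> F \<longleftrightarrow>
      limitin (product_topology (\<lambda>_. euclidean) UNIV)
        (\<lambda>i. blinfun_apply (f i)) (blinfun_apply \<phi>) F"
  proof
    assume L: "limitin weak_star f \<phi> F"
    show "limitin (product_topology (\<lambda>_. euclidean) UNIV)
        (\<lambda>i. blinfun_apply (f i)) (blinfun_apply \<phi>) F"
      unfolding limitin_def
    proof (intro conjI allI impI)
      fix U assume U: "openin (product_topology (\<lambda>_. euclidean) UNIV) U \<and> blinfun_apply \<phi> \<in> U"
      then have "openin weak_star (blinfun_apply -` U \<inter> cdual)"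
        by (auto simp: weak_star_def openin_pullback_topology)
      then have "\<forall>\<^sub>F i in F. f i \<in> blinfun_apply -` U \<inter> cdual"
        using L U assms(1) unfolding limitin_def by blast
      then show "\<forall>\<^sub>F i in F. blinfun_apply (f i) \<in> U"
        by eventually_elim auto
    qed auto
  next
    assume R: "limitin (product_topology (\<lambda>_. euclidean) UNIV)
        (\<lambda>i. blinfun_apply (f i)) (blinfun_apply \<phi>) F"
    show "limitin weak_star f \<phi> F"
      unfolding limitin_def
    proof (intro conjI allI impI)
      show "\<phi> \<in> topspace weak_star"
        using assms(1) by (simp add: weak_star_def topspace_pullback_topology)
      fix V assume V: "openin weak_star V \<and> \<phi> \<in> V"
      then obtain U where U: "openin (product_topology (\<lambda>_. euclidean) UNIV) U"
        "V = blinfun_apply -` U \<inter> cdual"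
        by (auto simp: weak_star_def openin_pullback_topology)
      then have "\<forall>\<^sub>F i in F. blinfun_apply (f i) \<in> U"
        using R V unfolding limitin_def by auto
      with assms(2) show "\<forall>\<^sub>F i in F. f i \<in> V"
        by eventually_elim (use U in auto)
    qed
  qed
  then show ?thesis
    by (simp add: limitin_componentwise)
qed


subsection \<open>Property (double dagger)\<close>

(* The directed set must have no last element.  Otherwise a net with a single index, which is
   vacuously separated and converges to its only value, would refute the property in every
   nonzero space. *)
definition separated_net_limit ::
    "real \<Rightarrow> 'i set \<Rightarrow> ('i \<times> 'i) set \<Rightarrow> ('i \<Rightarrow> ('a::complex_banach \<Rightarrow>\<^sub>L complex))
      \<Rightarrow> ('a \<Rightarrow>\<^sub>L complex) \<Rightarrow> bool"
  where "separated_net_limit \<epsilon> D r f \<phi> \<longleftrightarrow>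
    directed_set D r \<and> \<not> (\<exists>m\<in>D. \<forall>i\<in>D. (i, m) \<in> r) \<and>
    (\<forall>i\<in>D. f i \<in> dual_ball \<and> norm_attaining (f i)) \<and>
    (\<forall>i\<in>D. \<forall>j\<in>D. i \<noteq> j \<longrightarrow> norm (f i - f j) \<ge> \<epsilon>) \<and>
    \<phi> \<in> dual_ball \<and> norm_attaining \<phi> \<and>
    limitin weak_star f \<phi> (tail_filter D r)"

(* The index type is the dual itself.  This loses no generality, since a separated net is
   injective; see double_dagger_any_index below. *)
definition double_dagger :: "'a::complex_banach itself \<Rightarrow> bool"
  where "double_dagger (_ :: 'a itself) \<longleftrightarrow>
    (\<forall>\<epsilon>. 0 < \<epsilon> \<and> \<epsilon> < 2 \<longrightarrow>
      (\<forall>(D :: ('a \<Rightarrow>\<^sub>L complex) set) r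
          (f :: ('a \<Rightarrow>\<^sub>L complex) \<Rightarrow> ('a \<Rightarrow>\<^sub>L complex)) \<phi>.
        separated_net_limit \<epsilon> D r f \<phi> \<longrightarrow> norm \<phi> \<le> 1 - \<epsilon> / 2))"

lemma double_dagger_any_index:
  fixes D :: "'i set" and f :: "'i \<Rightarrow> ('a::complex_banach \<Rightarrow>\<^sub>L complex)"
  assumes dd: "double_dagger TYPE('a)" and \<epsilon>: "0 < \<epsilon>" "\<epsilon> < 2"
    and net: "separated_net_limit \<epsilon> D r f \<phi>"
  shows "norm \<phi> \<le> 1 - \<epsilon> / 2"
proof -
  have inj: "inj_on f D"
  proof (rule inj_onI, rule ccontr)
    fix i j assume "i \<in> D" "j \<in> D" "f i = f j" "i \<noteq> j"
    then have "\<epsilon> \<le> norm (f i - f j)"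
      using net unfolding separated_net_limit_def by blast
    with \<open>f i = f j\<close> \<epsilon>(1) show False
      by simp
  qed
  define g where "g = inv_into D f"
  have g: "g (f i) = i" if "i \<in> D" for i
    using inj that by (simp add: g_def)
  define s where "s = {(a, b). (g a, g b) \<in> r}"
  have D: "directed_set D r"
    using net by (simp add: separated_net_limit_def)
  have s: "(f i, f j) \<in> s \<longleftrightarrow> (i, j) \<in> r" if "i \<in> D" "j \<in> D" for i j
    using that by (simp add: s_def g)
  have D': "directed_set (f ` D) s"
    unfolding directed_set_def
  proof (intro conjI)
    show "f ` D \<noteq> {}"
      using D unfolding directed_set_def by blast
    have "\<forall>i\<in>D. (i, i) \<in> r"
      using D unfolding directed_set_def by blast
    then show "\<forall>a\<in>f ` D. (a, a) \<in> s"
      by (simp add: s)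
    have "(i, k) \<in> r" if "i \<in> D" "j \<in> D" "k \<in> D" "(i, j) \<in> r" "(j, k) \<in> r" for i j k
      using D that unfolding directed_set_def by blast
    then show "\<forall>a\<in>f ` D. \<forall>b\<in>f ` D. \<forall>c\<in>f ` D. (a, b) \<in> s \<longrightarrow> (b, c) \<in> s \<longrightarrow> (a, c) \<in> s"
      unfolding ball_simps by (intro ballI impI) (metis s)
    have "\<forall>i\<in>D. \<forall>j\<in>D. \<exists>k\<in>D. (i, k) \<in> r \<and> (j, k) \<in> r"
      using D unfolding directed_set_def by blast
    then show "\<forall>a\<in>f ` D. \<forall>b\<in>f ` D. \<exists>c\<in>f ` D. (a, c) \<in> s \<and> (b, c) \<in> s"
      by (simp add: s cong: ball_cong bex_cong)
  qed
  note net' = net[unfolded separated_net_limit_def, THEN conjunct2]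
  note sep = net'[THEN conjunct1] net'[THEN conjunct2, THEN conjunct1]
    net'[THEN conjunct2, THEN conjunct2, THEN conjunct1]
  note lim = net'[THEN conjunct2, THEN conjunct2, THEN conjunct2]
  have tails: "(\<exists>a\<in>f ` D. \<forall>b\<in>f ` D. (a, b) \<in> s \<longrightarrow> b \<in> U) \<longleftrightarrow>
      (\<exists>i\<in>D. \<forall>j\<in>D. (i, j) \<in> r \<longrightarrow> f j \<in> U)" for U
    by (simp add: s cong: ball_cong bex_cong)
  have last: "(\<exists>m\<in>f ` D. \<forall>a\<in>f ` D. (a, m) \<in> s) \<longleftrightarrow> (\<exists>m\<in>D. \<forall>i\<in>D. (i, m) \<in> r)"
    by (simp add: s cong: ball_cong bex_cong)
  have "limitin weak_star (\<lambda>a. a) \<phi> (tail_filter (f ` D) s)"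
    using lim[THEN conjunct2, THEN conjunct2] unfolding limitin_def eventually_tail_filter[OF D] eventually_tail_filter[OF D']
      tails .
  moreover have "\<not> (\<exists>m\<in>f ` D. \<forall>a\<in>f ` D. (a, m) \<in> s)"
    unfolding last by (rule sep(1))
  moreover have "\<forall>a\<in>f ` D. a \<in> dual_ball \<and> norm_attaining a"
    unfolding ball_simps by (rule sep(2))
  moreover have "\<forall>a\<in>f ` D. \<forall>b\<in>f ` D. a \<noteq> b \<longrightarrow> norm (a - b) \<ge> \<epsilon>"
  proof (intro ballI impI)
    fix a b assume "a \<in> f ` D" "b \<in> f ` D" "a \<noteq> b"
    then obtain i j where "i \<in> D" "j \<in> D" "a = f i" "b = f j" "i \<noteq> j"
      by blast
    then show "norm (a - b) \<ge> \<epsilon>"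
      using sep(3) by simp
  qed
  ultimately have "separated_net_limit \<epsilon> (f ` D) s (\<lambda>a. a) \<phi>"
    unfolding separated_net_limit_def using D' lim by (intro conjI) simp_all
  then show ?thesis
    by (rule dd[unfolded double_dagger_def, rule_format, OF conjI[OF \<epsilon>]])
qed


subsection \<open>Finite-dimensional Hilbert spaces and their operators\<close>

definition inner_norm :: "('h \<Rightarrow> 'h \<Rightarrow> complex) \<Rightarrow> 'h \<Rightarrow> real"
  where "inner_norm ip x = sqrt (Re (ip x x))"

(* A complex Hilbert space is a linear subspace H of an ambient complex vector space, with an
   inner product on H that has nothing to do with the ambient type. *)
locale hilbert_space =
  fixes H :: "'h::complex_vector set" and ip :: "'h \<Rightarrow> 'h \<Rightarrow> complex"
  assumes subspace: "csubspace H"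
    and ip_add: "\<lbrakk>x \<in> H; y \<in> H; z \<in> H\<rbrakk> \<Longrightarrow> ip (x + y) z = ip x z + ip y z"
    and ip_scale: "\<lbrakk>x \<in> H; z \<in> H\<rbrakk> \<Longrightarrow> ip (a *\<^sub>C x) z = a * ip x z"
    and ip_cnj: "\<lbrakk>x \<in> H; y \<in> H\<rbrakk> \<Longrightarrow> ip y x = cnj (ip x y)"
    and ip_pos: "\<lbrakk>x \<in> H; x \<noteq> 0\<rbrakk> \<Longrightarrow> Re (ip x x) > 0"
    and complete: "\<lbrakk>\<And>n. X n \<in> H;
        \<And>e. e > 0 \<Longrightarrow> \<exists>N. \<forall>m\<ge>N. \<forall>n\<ge>N. inner_norm ip (X m - X n) < e\<rbrakk>
      \<Longrightarrow> \<exists>x\<in>H. (\<lambda>n. inner_norm ip (X n - x)) \<longlonglongrightarrow> 0"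

locale fd_hilbert_space = hilbert_space +
  assumes finite_dim: "\<exists>B. finite B \<and> cspan B = H"

record 'b star_algebra =
  sa_carrier :: "'b set"
  sa_add :: "'b \<Rightarrow> 'b \<Rightarrow> 'b"
  sa_scale :: "complex \<Rightarrow> 'b \<Rightarrow> 'b"
  sa_mult :: "'b \<Rightarrow> 'b \<Rightarrow> 'b"
  sa_star :: "'b \<Rightarrow> 'b"
  sa_norm :: "'b \<Rightarrow> real"

(* Operators are functions on H, extended by undefined outside H. *)
definition bounded_ops :: "'h::complex_vector set \<Rightarrow> ('h \<Rightarrow> 'h \<Rightarrow> complex) \<Rightarrow> ('h \<Rightarrow> 'h) set"
  where "bounded_ops H ip = {T \<in> H \<rightarrow>\<^sub>E H.
    (\<forall>x\<in>H. \<forall>y\<in>H. T (x + y) = T x + T y) \<and> (\<forall>a. \<forall>x\<in>H. T (a *\<^sub>C x) = a *\<^sub>C T x) \<and>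
    (\<exists>K. \<forall>x\<in>H. inner_norm ip (T x) \<le> K * inner_norm ip x)}"

definition op_algebra ::
    "'h::complex_vector set \<Rightarrow> ('h \<Rightarrow> 'h \<Rightarrow> complex) \<Rightarrow> ('h \<Rightarrow> 'h) star_algebra"
  where "op_algebra H ip = \<lparr>
    sa_carrier = bounded_ops H ip,
    sa_add = (\<lambda>S T. \<lambda>x\<in>H. S x + T x),
    sa_scale = (\<lambda>a T. \<lambda>x\<in>H. a *\<^sub>C T x),
    sa_mult = (\<lambda>S T. \<lambda>x\<in>H. S (T x)),
    sa_star = (\<lambda>T. THE S. S \<in> bounded_ops H ip \<and> (\<forall>x\<in>H. \<forall>y\<in>H. ip (T x) y = ip x (S y))),
    sa_norm = (\<lambda>T. SUP x\<in>{x \<in> H. inner_norm ip x \<le> 1}. inner_norm ip (T x))\<rparr>"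


subsection \<open>Direct sums and isomorphisms\<close>

(* The inserted 0 only matters for the empty family, whose sum is the zero algebra. *)
definition c0_sum :: "'i set \<Rightarrow> ('i \<Rightarrow> 'b star_algebra) \<Rightarrow> ('i \<Rightarrow> 'b) star_algebra"
  where "c0_sum J X = \<lparr>
    sa_carrier = {x \<in> (\<Pi>\<^sub>E j\<in>J. sa_carrier (X j)).
      \<forall>\<delta>>0. finite {j \<in> J. sa_norm (X j) (x j) \<ge> \<delta>}},
    sa_add = (\<lambda>x y. \<lambda>j\<in>J. sa_add (X j) (x j) (y j)),
    sa_scale = (\<lambda>a x. \<lambda>j\<in>J. sa_scale (X j) a (x j)),
    sa_mult = (\<lambda>x y. \<lambda>j\<in>J. sa_mult (X j) (x j) (y j)),
    sa_star = (\<lambda>x. \<lambda>j\<in>J. sa_star (X j) (x j)),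
    sa_norm = (\<lambda>x. Sup (insert 0 ((\<lambda>j. sa_norm (X j) (x j)) ` J)))\<rparr>"

definition isometric_star_iso :: "('a::cstar_algebra \<Rightarrow> 'b) \<Rightarrow> 'b star_algebra \<Rightarrow> bool"
  where "isometric_star_iso \<Psi> B \<longleftrightarrow>
    bij_betw \<Psi> UNIV (sa_carrier B) \<and>
    (\<forall>x y. \<Psi> (x + y) = sa_add B (\<Psi> x) (\<Psi> y)) \<and>
    (\<forall>a x. \<Psi> (a *\<^sub>C x) = sa_scale B a (\<Psi> x)) \<and>
    (\<forall>x y. \<Psi> (x * y) = sa_mult B (\<Psi> x) (\<Psi> y)) \<and>
    (\<forall>x. \<Psi> (star x) = sa_star B (\<Psi> x)) \<and>
    (\<forall>x. sa_norm B (\<Psi> x) = norm x)"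

end

theory Submission
  imports Defs "HOL-Computational_Algebra.Fundamental_Theorem_Algebra"
begin

text \<open>
  The property excludes separated sequences of norm-attaining functionals whose weak* limit is too
  large, and this is applied to three explicit sequences.

  Let p be a minimal projection, that is, p A p consists of the multiples of p. Then the left ideal
  Ap is a Hilbert space. If it had an infinite orthonormal sequence e(n), the vector functionals
  given by (p + e(n)) / sqrt 2 would converge to a functional of norm 1 / sqrt 2, which is too large
  (\<open>finite_orthonormal_basis_exists\<close>). So Ap is finite-dimensional, and p generates a
  finite-dimensional ideal whose unit is a central projection, called a block. The algebra acts on
  Ap, and the block is the full matrix algebra of Ap. Distinct blocks are orthogonal, so the closed
  ideal that they generate is a c0-sum of matrix algebras. What remains is to show that this ideal
  is everything (\<open>block_ideal_eq_UNIV\<close>).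

  Suppose it is not, and consider elements of A that act as units on parts of A outside the ideal. If
  each such part could be split into two orthogonal ones, there would be an infinite dyadic tree of
  local units. Such a tree carries a functional that is diffuse along it, and its perturbations by
  Rademacher functions form a separated sequence converging to it (\<open>no_dyadic_tree\<close>). Hence some
  part is indecomposable. Spectral calculus shows that modulo the ideal it is one-dimensional, and
  it contains a projection e outside the ideal such that e x e = \<open>\<phi>\<close>(x) e modulo the ideal
  (\<open>minimal_projection_modulo_ideal\<close>). This e cannot be minimal, even after finitely many blocks
  are removed, so it meets infinitely many blocks; and vector functionals of unit vectors below e in
  distinct blocks form a separated sequence converging to \<open>\<phi>\<close>.

  The analytic tool is the continuous functional calculus of a self-adjoint element h in an algebra
  without unit, which rests on the bound of p(h) by the maximum of |p| on the interval of radius |h|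
  (\<open>poly_norm_le_Sup\<close>). It is obtained from the C*-identity and the factorization of polynomials
  over the complex numbers, without Gelfand theory.
\<close>

section \<open>Algebra and norm in a C*-algebra\<close>

lemma star_zero [simp]: "star (0::'a::cstar_algebra) = 0"
  by (metis add_cancel_right_right star_add)

lemma star_uminus: "star (- x) = - star (x::'a::cstar_algebra)"
  by (metis add.right_inverse add_eq_0_iff star_add star_zero)

lemma star_diff: "star (x - y) = star x - star (y::'a::cstar_algebra)"
  by (metis diff_conv_add_uminus star_add star_uminus)

lemma star_scaleR: "star (r *\<^sub>R x) = r *\<^sub>R star (x::'a::cstar_algebra)"
  by (simp add: scaleR_scaleC star_scaleC)

lemma star_sum: "star (\<Sum>i\<in>F. f i) = (\<Sum>i\<in>F. star (f i :: 'a::cstar_algebra))"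
  by (induction F rule: infinite_finite_induct) (simp_all add: star_add)

lemma norm_star [simp]: "norm (star x) = norm (x::'a::cstar_algebra)"
proof -
  have le: "norm x \<le> norm (star x)" for x :: 'a
  proof (cases "x = 0")
    case False
    have "(norm x)\<^sup>2 \<le> norm (star x) * norm x"
      using cstar_identity[of x] norm_mult_ineq[of "star x" x] by simp
    with False show ?thesis by (simp add: power2_eq_square)
  qed simp
  show ?thesis
    using le[of x] le[of "star x"] by (simp add: star_star)
qed

lemma star_mult_self_eq_0: "star x * x = 0 \<longleftrightarrow> x = (0::'a::cstar_algebra)"
  using cstar_identity[of x] by auto

lemma bounded_linear_star: "bounded_linear (star :: 'a::cstar_algebra \<Rightarrow> 'a)"
  by (rule bounded_linear_intro[of _ 1]) (simp_all add: star_add star_scaleR)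

lemma bounded_linear_scaleC: "bounded_linear (\<lambda>x::'a::complex_banach. c *\<^sub>C x)"
proof (rule bounded_linear_intro[of _ "cmod c"])
  show "c *\<^sub>C (r *\<^sub>R x) = r *\<^sub>R (c *\<^sub>C x)" for r and x :: 'a
    by (simp add: scaleR_scaleC mult.commute)
qed (simp_all add: norm_scaleC scaleC_add_right)

lemmas tendsto_star = bounded_linear.tendsto[OF bounded_linear_star]

lemma norm_square_selfadjoint:
  fixes x :: "'a::cstar_algebra"
  assumes "star x = x"
  shows "norm (x * x) = (norm x)\<^sup>2"
  using cstar_identity[of x] assms by simp

lemma norm_le_of_mult_bound:
  fixes x :: "'a::cstar_algebra"
  assumes "0 \<le> M" "\<And>y. norm (x * y) \<le> M * norm y"
  shows "norm x \<le> M"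
proof (cases "x = 0")
  case False
  have "(norm x)\<^sup>2 \<le> M * norm x"
    using assms(2)[of "star x"] cstar_identity[of "star x"] by (simp add: star_star)
  with False show ?thesis by (simp add: power2_eq_square)
qed (use assms(1) in simp)

text \<open>
  As u* u = u* (u + v), dropping an orthogonal summand does not increase the norm.
\<close>

lemma norm_le_norm_add_orthogonal:
  fixes u v :: "'a::cstar_algebra"
  assumes "star u * v = 0"
  shows "norm u \<le> norm (u + v)"
proof (cases "u = 0")
  case False
  have "(norm u)\<^sup>2 = norm (star u * (u + v))"
    using assms by (simp add: distrib_left cstar_identity)
  also have "\<dots> \<le> norm u * norm (u + v)"
    using norm_mult_ineq[of "star u" "u + v"] by simp
  finally show ?thesis using False by (simp add: power2_eq_square)
qed simp

lemma sum_mult_sum_orthogonal: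
  fixes f g :: "'i \<Rightarrow> 'a::semiring_0"
  assumes "finite F" "\<And>i j. i \<in> F \<Longrightarrow> j \<in> F \<Longrightarrow> i \<noteq> j \<Longrightarrow> f i * g j = 0"
  shows "(\<Sum>i\<in>F. f i) * (\<Sum>j\<in>F. g j) = (\<Sum>i\<in>F. f i * g i)"
proof -
  have "(\<Sum>i\<in>F. f i) * (\<Sum>j\<in>F. g j) = (\<Sum>i\<in>F. \<Sum>j\<in>F. f i * g j)"
    by (simp add: sum_product)
  also have "\<dots> = (\<Sum>i\<in>F. f i * g i)"
  proof (rule sum.cong[OF refl])
    fix i assume i: "i \<in> F"
    have "(\<Sum>j\<in>F. f i * g j) = (\<Sum>j\<in>F. if j = i then f i * g i else 0)"
      by (rule sum.cong) (use assms(2) i in auto)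
    with assms(1) i show "(\<Sum>j\<in>F. f i * g j) = f i * g i" by simp
  qed
  finally show ?thesis .
qed

lemma le_of_power_le_mult:
  fixes x M C :: real
  assumes "M \<ge> 0" and le: "\<And>k. x ^ (2 ^ k) \<le> C * M ^ (2 ^ k)"
  shows "x \<le> M"
proof (rule ccontr)
  assume "\<not> x \<le> M"
  then have x: "x > M" "x > 0" using assms(1) by auto
  show False
  proof (cases "M = 0")
    case True
    then show False using le[of 0] x by simp
  next
    case False
    define q where "q = x / M"
    have M: "M > 0" and q: "q > 1" using False assms(1) x by (auto simp: q_def)
    have qC: "q ^ (2 ^ k) \<le> C" for k
      using le[of k] M by (simp add: q_def power_divide field_simps)
    obtain n where "C < q ^ n" using q real_arch_pow by blast
    also have "n \<le> 2 ^ n" by (rule self_le_ge2_pow) simp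
    then have "q ^ n \<le> q ^ (2 ^ n)" using q by (intro power_increasing) auto
    finally show False using qC[of n] by simp
  qed
qed

definition iter_square :: "nat \<Rightarrow> 'a::cstar_algebra \<Rightarrow> 'a"
  where "iter_square k = (\<lambda>x. x * x) ^^ k"

lemma iter_square_simps [simp]:
  "iter_square 0 x = x" "iter_square (Suc k) x = iter_square k x * iter_square k x"
  by (simp_all add: iter_square_def)

lemma star_iter_square: "star x = x \<Longrightarrow> star (iter_square k x) = iter_square k x"
  by (induction k) (simp_all add: star_mult)

lemma norm_iter_square:
  assumes "star x = x"
  shows "norm (iter_square k x) = norm x ^ 2 ^ k"
proof (induction k)
  case (Suc k)
  have "norm (iter_square (Suc k) x) = (norm (iter_square k x))\<^sup>2"
    using norm_square_selfadjoint[OF star_iter_square[OF assms]] by simp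
  then show ?case using Suc by (simp add: power_mult[symmetric] mult.commute)
qed simp

text \<open>
  Repeated squaring turns a sum of N mutually orthogonal self-adjoint elements of norm at most M
  into one whose norm is at most N M^(2^k); taking roots of order 2^k removes the factor N.
\<close>

lemma norm_sum_orthogonal_selfadjoint:
  fixes f :: "'i \<Rightarrow> 'a::cstar_algebra"
  assumes "finite F" "M \<ge> 0"
    and sa: "\<And>i. i \<in> F \<Longrightarrow> star (f i) = f i"
    and orth: "\<And>i j. i \<in> F \<Longrightarrow> j \<in> F \<Longrightarrow> i \<noteq> j \<Longrightarrow> f i * f j = 0"
    and le: "\<And>i. i \<in> F \<Longrightarrow> norm (f i) \<le> M"
  shows "norm (\<Sum>i\<in>F. f i) \<le> M"
proof -
  have orth_sq: "iter_square k (f i) * iter_square k (f j) = 0" if "i \<in> F" "j \<in> F" "i \<noteq> j" for i j k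
  proof (induction k)
    case (Suc k)
    have "iter_square (Suc k) (f i) * iter_square (Suc k) (f j)
        = iter_square k (f i) * (iter_square k (f i) * iter_square k (f j)) * iter_square k (f j)"
      by (simp add: mult.assoc)
    then show ?case using Suc by simp
  qed (use orth that in simp)
  have sum_sq: "iter_square k (\<Sum>i\<in>F. f i) = (\<Sum>i\<in>F. iter_square k (f i))" for k
  proof (induction k)
    case (Suc k)
    then have "iter_square (Suc k) (\<Sum>i\<in>F. f i) = (\<Sum>i\<in>F. iter_square k (f i)) * (\<Sum>i\<in>F. iter_square k (f i))"
      by simp
    also have "\<dots> = (\<Sum>i\<in>F. iter_square k (f i) * iter_square k (f i))"
      by (rule sum_mult_sum_orthogonal) (use assms(1) orth_sq in auto)
    finally show ?case by simp
  qed simp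
  have sa_sum: "star (\<Sum>i\<in>F. f i) = (\<Sum>i\<in>F. f i)"
    by (simp add: star_sum sa)
  show ?thesis
  proof (rule le_of_power_le_mult[OF assms(2)])
    fix k
    have "norm (\<Sum>i\<in>F. f i) ^ 2 ^ k = norm (\<Sum>i\<in>F. iter_square k (f i))"
      by (simp add: norm_iter_square[OF sa_sum, symmetric] sum_sq)
    also have "\<dots> \<le> (\<Sum>i\<in>F. M ^ 2 ^ k)"
      by (rule order.trans[OF norm_sum sum_mono])
         (simp add: norm_iter_square sa power_mono le)
    finally show "norm (\<Sum>i\<in>F. f i) ^ 2 ^ k \<le> real (card F) * M ^ 2 ^ k" by simp
  qed
qed

lemma norm_sum_orthogonal:
  fixes f :: "'i \<Rightarrow> 'a::cstar_algebra"
  assumes "finite F" "M \<ge> 0"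
    and orth1: "\<And>i j. i \<in> F \<Longrightarrow> j \<in> F \<Longrightarrow> i \<noteq> j \<Longrightarrow> star (f i) * f j = 0"
    and orth2: "\<And>i j. i \<in> F \<Longrightarrow> j \<in> F \<Longrightarrow> i \<noteq> j \<Longrightarrow> f i * star (f j) = 0"
    and le: "\<And>i. i \<in> F \<Longrightarrow> norm (f i) \<le> M"
  shows "norm (\<Sum>i\<in>F. f i) \<le> M"
proof -
  have "star (\<Sum>i\<in>F. f i) * (\<Sum>i\<in>F. f i) = (\<Sum>i\<in>F. star (f i) * f i)"
    unfolding star_sum by (rule sum_mult_sum_orthogonal) (use assms in auto)
  moreover have "norm (\<Sum>i\<in>F. star (f i) * f i) \<le> M\<^sup>2"
  proof (rule norm_sum_orthogonal_selfadjoint[OF assms(1)])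
    show "star (f i) * f i * (star (f j) * f j) = 0" if "i \<in> F" "j \<in> F" "i \<noteq> j" for i j
      using orth2[OF that] by (metis mult.assoc mult_zero_left mult_zero_right)
  qed (use le in \<open>auto simp: star_mult star_star cstar_identity power_mono\<close>)
  ultimately have "(norm (\<Sum>i\<in>F. f i))\<^sup>2 \<le> M\<^sup>2"
    by (metis cstar_identity)
  then show ?thesis using assms(2) by (simp add: power2_le_iff_abs_le)
qed

section \<open>Polynomial calculus for a self-adjoint element\<close>

text \<open>
  The algebra has no unit, so a polynomial with constant term cannot be evaluated at h inside it.
  It is evaluated as an operator on the algebra instead: here q(h) y, by Horner's scheme.
\<close>

definition poly_act :: "'a::cstar_algebra \<Rightarrow> complex poly \<Rightarrow> 'a \<Rightarrow> 'a"
  where "poly_act h q = fold_coeffs (\<lambda>c g y. c *\<^sub>C y + h * g y) q (\<lambda>y. 0)"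

lemma poly_act_0 [simp]: "poly_act h 0 y = 0"
  by (simp add: poly_act_def)

lemma poly_act_pCons [simp]: "poly_act h (pCons c q) y = c *\<^sub>C y + h * poly_act h q y"
  by (cases "c = 0 \<and> q = 0") (auto simp: poly_act_def)

lemma poly_act_1 [simp]: "poly_act h 1 y = y"
  by (simp add: one_pCons)

lemma poly_act_add: "poly_act h (p + q) y = poly_act h p y + poly_act h q y"
  by (induction p q rule: poly_induct2) (simp_all add: scaleC_add_left distrib_left add_ac)

lemma poly_act_smult: "poly_act h (smult c q) y = c *\<^sub>C poly_act h q y"
  by (induction q) (simp_all add: scaleC_add_right mult_scaleC_right)

lemma poly_act_mult: "poly_act h (p * q) y = poly_act h p (poly_act h q y)"
  by (induction p) (simp_all add: poly_act_add poly_act_smult)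

lemma poly_act_commute: "poly_act h q (h * y) = h * poly_act h q y"
  by (induction q) (simp_all add: distrib_left mult_scaleC_right)

lemma poly_act_mult_right: "poly_act h q y * x = poly_act h q (y * x)"
  by (induction q) (simp_all add: distrib_right mult_scaleC_left mult.assoc)

lemma bounded_linear_poly_act: "bounded_linear (poly_act h q)"
proof (induction q)
  case 0
  have "poly_act h 0 = (\<lambda>y. 0)" by auto
  then show ?case by (simp add: bounded_linear_zero)
next
  case (pCons c q)
  have "poly_act h (pCons c q) = (\<lambda>y. c *\<^sub>C y + h * poly_act h q y)" by auto
  moreover have "bounded_linear (\<lambda>y. c *\<^sub>C y + h * poly_act h q y)"
    by (intro bounded_linear_add bounded_linear_scaleC
        bounded_linear_compose[OF bounded_linear_mult_right] pCons)
  ultimately show ?case by simp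
qed

definition cnj_poly :: "complex poly \<Rightarrow> complex poly"
  where "cnj_poly = map_poly cnj"

lemma coeff_cnj_poly [simp]: "coeff (cnj_poly p) n = cnj (coeff p n)"
  by (simp add: cnj_poly_def coeff_map_poly)

lemma cnj_poly_simps [simp]:
  "cnj_poly 0 = 0" "cnj_poly 1 = 1" "cnj_poly (pCons c p) = pCons (cnj c) (cnj_poly p)"
  "cnj_poly (p + q) = cnj_poly p + cnj_poly q" "cnj_poly (p - q) = cnj_poly p - cnj_poly q"
  "cnj_poly (smult c p) = smult (cnj c) (cnj_poly p)"
  "cnj_poly (p * q) = cnj_poly p * cnj_poly q" "cnj_poly (cnj_poly p) = p"
  by (auto simp: poly_eq_iff coeff_mult coeff_pCons split: nat.splits)

lemma cnj_poly_power [simp]: "cnj_poly (p ^ n) = cnj_poly p ^ n"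
  by (induction n) simp_all

text \<open>
  The operator q(h) has the adjoint \<open>cnj_poly q\<close> at h with respect to the algebra-valued inner
  product a* b. Thus the C*-identity passes to these operators.
\<close>

lemma star_poly_act_mult:
  assumes "star h = h"
  shows "star (poly_act h q a) * b = star a * poly_act h (cnj_poly q) b"
proof (induction q arbitrary: b)
  case (pCons c q)
  have "star (poly_act h (pCons c q) a) * b
      = cnj c *\<^sub>C (star a * b) + star (poly_act h q a) * (h * b)"
    by (simp add: star_add star_scaleC star_mult assms distrib_right mult_scaleC_left mult.assoc)
  also have "star (poly_act h q a) * (h * b) = star a * poly_act h (cnj_poly q) (h * b)"
    by (rule pCons.IH)
  finally show ?case
    by (simp add: poly_act_commute distrib_left mult_scaleC_right)
qed simp

lemma norm_poly_act_square:
  assumes "star h = h"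
  shows "(norm (poly_act h q y))\<^sup>2 = norm (star y * poly_act h (cnj_poly q * q) y)"
  by (simp add: cstar_identity[symmetric] star_poly_act_mult[OF assms] poly_act_mult)

lemma norm_poly_act_cnj:
  assumes "star h = h"
  shows "norm (poly_act h (cnj_poly q) y) = norm (poly_act h q y)"
proof -
  have "(norm (poly_act h (cnj_poly q) y))\<^sup>2 = (norm (poly_act h q y))\<^sup>2"
    by (simp add: norm_poly_act_square[OF assms] mult.commute)
  then show ?thesis by (simp add: power2_eq_iff_nonneg)
qed

definition poly_norm :: "'a::cstar_algebra \<Rightarrow> complex poly \<Rightarrow> real"
  where "poly_norm h q = onorm (poly_act h q)"

lemma poly_norm_nonneg: "0 \<le> poly_norm h q"
  unfolding poly_norm_def by (rule onorm_pos_le[OF bounded_linear_poly_act])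

lemma norm_poly_act_le: "norm (poly_act h q y) \<le> poly_norm h q * norm y"
  unfolding poly_norm_def by (rule onorm[OF bounded_linear_poly_act])

lemma poly_norm_leI: "0 \<le> b \<Longrightarrow> (\<And>y. norm (poly_act h q y) \<le> b * norm y) \<Longrightarrow> poly_norm h q \<le> b"
  unfolding poly_norm_def by (rule onorm_bound)

lemma poly_norm_mult_le: "poly_norm h (p * q) \<le> poly_norm h p * poly_norm h q"
proof (rule poly_norm_leI)
  show "norm (poly_act h (p * q) y) \<le> poly_norm h p * poly_norm h q * norm y" for y
    unfolding poly_act_mult
    by (rule order.trans[OF norm_poly_act_le])
       (simp add: mult.assoc mult_left_mono norm_poly_act_le poly_norm_nonneg)
qed (simp add: poly_norm_nonneg)

lemma poly_norm_add_le: "poly_norm h (p + q) \<le> poly_norm h p + poly_norm h q"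
proof (rule poly_norm_leI)
  show "norm (poly_act h (p + q) y) \<le> (poly_norm h p + poly_norm h q) * norm y" for y
    unfolding poly_act_add distrib_right
    by (rule norm_triangle_mono) (rule norm_poly_act_le)+
qed (simp add: poly_norm_nonneg)

lemma poly_norm_smult: "poly_norm h (smult c p) = cmod c * poly_norm h p"
proof -
  have le: "poly_norm h (smult c p) \<le> cmod c * poly_norm h p" for c p
  proof (rule poly_norm_leI)
    show "norm (poly_act h (smult c p) y) \<le> cmod c * poly_norm h p * norm y" for y
      by (simp add: poly_act_smult norm_scaleC mult.assoc mult_left_mono norm_poly_act_le)
  qed (simp add: poly_norm_nonneg)
  show ?thesis
  proof (cases "c = 0")
    case True
    then show ?thesis using le[of 0 p] poly_norm_nonneg[of h 0] by simp
  next
    case False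
    have "poly_norm h p = poly_norm h (smult (1 / c) (smult c p))" using False by simp
    also have "\<dots> \<le> poly_norm h (smult c p) / cmod c"
      using le[of "1 / c" "smult c p"] by (simp add: norm_divide)
    finally show ?thesis using le[of c p] False by (simp add: field_simps)
  qed
qed

lemma poly_norm_1: "poly_norm h 1 \<le> 1"
  by (rule poly_norm_leI) simp_all

lemma poly_norm_power_le: "poly_norm h p \<le> 1 \<Longrightarrow> poly_norm h (p ^ n) \<le> 1"
proof (induction n)
  case (Suc n)
  then show ?case
    using poly_norm_mult_le[of h p "p ^ n"] mult_le_one[of "poly_norm h p" "poly_norm h (p ^ n)"]
      poly_norm_nonneg[of h "p ^ n"] by simp
qed (simp add: poly_norm_1)

lemma poly_norm_square_le:
  assumes "star h = h"
  shows "(poly_norm h q)\<^sup>2 \<le> poly_norm h (cnj_poly q * q)"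
proof -
  define s where "s = poly_norm h (cnj_poly q * q)"
  have s: "0 \<le> s" by (simp add: s_def poly_norm_nonneg)
  have "poly_norm h q \<le> sqrt s"
  proof (rule poly_norm_leI)
    fix y
    have "(norm (poly_act h q y))\<^sup>2 \<le> norm y * norm (poly_act h (cnj_poly q * q) y)"
      by (simp only: norm_poly_act_square[OF assms]) (rule order.trans[OF norm_mult_ineq], simp)
    also have "\<dots> \<le> norm y * (s * norm y)"
      unfolding s_def by (intro mult_left_mono norm_poly_act_le) simp
    also have "\<dots> = (sqrt s * norm y)\<^sup>2" 
      using s by (simp only: power_mult_distrib real_sqrt_pow2) (simp only: power2_eq_square mult_ac)
    finally show "norm (poly_act h q y) \<le> sqrt s * norm y"
      by (rule power2_le_imp_le) (simp add: s)
  qed (use s in simp)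
  then have "(poly_norm h q)\<^sup>2 \<le> (sqrt s)\<^sup>2" by (intro power_mono poly_norm_nonneg)
  with s show ?thesis by (simp add: s_def)
qed

lemma poly_norm_cnj:
  assumes "star h = h"
  shows "poly_norm h (cnj_poly q) = poly_norm h q"
  unfolding poly_norm_def onorm_def norm_poly_act_cnj[OF assms] ..

lemma poly_norm_square:
  assumes "star h = h" "cnj_poly p = p"
  shows "poly_norm h (p * p) = (poly_norm h p)\<^sup>2"
  using poly_norm_square_le[of h p] poly_norm_mult_le[of h p p] assms
  by (simp add: power2_eq_square)

text \<open>
  For real x and y put w = x + i y. Then x^2 + y^2 is the product of w with its conjugate and has
  norm at least |w|^2, while x is the mean of w and its conjugate, which have equal norms. This
  inequality is used in place of the order on self-adjoint elements.
\<close>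

lemma poly_norm_le_sum_squares:
  assumes h: "star h = h" and x: "cnj_poly x = x" and y: "cnj_poly y = y"
  shows "(poly_norm h x)\<^sup>2 \<le> poly_norm h (x * x + y * y)"
proof -
  define w where "w = x + smult \<i> y"
  have w: "cnj_poly w = x - smult \<i> y" by (simp add: w_def x y)
  have ww: "cnj_poly w * w = x * x + y * y"
    unfolding w by (simp add: w_def algebra_simps)
  have "x = smult (1/2) (cnj_poly w + w)"
    unfolding w by (rule poly_eqI) (simp only: w_def coeff_smult coeff_add coeff_diff, simp)
  then have "poly_norm h x = poly_norm h (smult (1/2) (cnj_poly w + w))"
    by (rule arg_cong)
  also have "\<dots> = 1/2 * poly_norm h (cnj_poly w + w)"
    by (simp only: poly_norm_smult) simp
  also have "\<dots> \<le> poly_norm h w"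
    using poly_norm_add_le[of h "cnj_poly w" w] poly_norm_cnj[OF h, of w] by simp
  finally have "(poly_norm h x)\<^sup>2 \<le> (poly_norm h w)\<^sup>2"
    by (intro power_mono poly_norm_nonneg)
  also have "\<dots> \<le> poly_norm h (x * x + y * y)"
    using poly_norm_square_le[OF h, of w] ww by simp
  finally show ?thesis .
qed

lemma poly_norm_1_minus_le: "poly_norm h p \<le> 1 \<Longrightarrow> poly_norm h (1 - p) \<le> 2"
  using poly_norm_add_le[of h 1 "smult (-1) p"] poly_norm_1[of h] poly_norm_smult[of h "-1" p]
  by simp

text \<open>
  Since (1 + X^2)^2 = (1 - X^2)^2 + (2 X)^2, each factor 1 + X^2 may be replaced by 2 X without
  increasing the norm. For X, X^2, X^4, ... of norm one this bounds the norm of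
  1 + X^2 + ... + X^(2 (2^m - 1)), which is the product of the factors 1 + X^(2^(j+1)), from below
  by 2^m.
\<close>

lemma poly_norm_prod_squares_ge:
  fixes m :: nat
  assumes h: "star h = h" and X: "\<And>j. cnj_poly (X j) = X j" and Y: "cnj_poly Y = Y"
  shows "(poly_norm h (Y * (\<Prod>j<m. smult 2 (X j))))\<^sup>2
    \<le> poly_norm h (Y\<^sup>2 * (\<Prod>j<m. (1 + (X j)\<^sup>2)\<^sup>2))"
  using Y
proof (induction m arbitrary: Y)
  case 0
  then show ?case using poly_norm_square[OF h, of Y] by (simp add: power2_eq_square)
next
  case (Suc m)
  define Z where "Z = Y * (\<Prod>j<m. smult 2 (X j))"
  have cP: "cnj_poly (\<Prod>j<m. smult 2 (X j)) = (\<Prod>j<m. smult 2 (X j))" for m :: nat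
    by (induction m) (simp_all add: X)
  have Z: "cnj_poly Z = Z" using Suc.prems cP by (simp add: Z_def)
  have "(poly_norm h (Y * (\<Prod>j<Suc m. smult 2 (X j))))\<^sup>2 = (poly_norm h (Z * smult 2 (X m)))\<^sup>2"
    by (simp add: Z_def mult_ac)
  also have "\<dots> \<le> poly_norm h ((Z * smult 2 (X m)) * (Z * smult 2 (X m))
      + (Z * (1 - (X m)\<^sup>2)) * (Z * (1 - (X m)\<^sup>2)))"
    by (rule poly_norm_le_sum_squares) (simp_all add: h Z X)
  also have "(Z * smult 2 (X m)) * (Z * smult 2 (X m)) + (Z * (1 - (X m)\<^sup>2)) * (Z * (1 - (X m)\<^sup>2))
      = (Y * (1 + (X m)\<^sup>2) * (\<Prod>j<m. smult 2 (X j))) * (Y * (1 + (X m)\<^sup>2) * (\<Prod>j<m. smult 2 (X j)))"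
  proof -
    have s: "smult 2 (X m) = 2 * X m"
      by (simp add: numeral_poly)
    show ?thesis unfolding s Z_def by (simp add: power2_eq_square algebra_simps)
  qed
  also have "poly_norm h \<dots> = (poly_norm h (Y * (1 + (X m)\<^sup>2) * (\<Prod>j<m. smult 2 (X j))))\<^sup>2"
    by (rule poly_norm_square) (simp_all add: h X Suc.prems cP)
  also have "\<dots> \<le> poly_norm h ((Y * (1 + (X m)\<^sup>2))\<^sup>2 * (\<Prod>j<m. (1 + (X j)\<^sup>2)\<^sup>2))"
    by (rule Suc.IH) (simp add: X Suc.prems)
  also have "(Y * (1 + (X m)\<^sup>2))\<^sup>2 * (\<Prod>j<m. (1 + (X j)\<^sup>2)\<^sup>2)
      = Y\<^sup>2 * (\<Prod>j<Suc m. (1 + (X j)\<^sup>2)\<^sup>2)"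
    by (simp add: power_mult_distrib mult_ac)
  finally show ?case .
qed

text \<open>
  Up to sign, the norm of a self-adjoint element belongs to its approximate point spectrum.
  Otherwise 1 - X^2 would be bounded below by c > 0; but its product with the sum of the even powers
  of X below 2^(m+1) is 1 - X^(2^(m+1)), of norm at most 2, although that sum has norm at least 2^m.
\<close>

lemma one_minus_square_not_bounded_below:
  assumes h: "star h = h" and X: "cnj_poly X = X" and norm1: "poly_norm h X = 1" and "c > 0"
  shows "\<exists>y. norm (poly_act h (1 - X\<^sup>2) y) < c * norm y"
proof (rule ccontr)
  assume "\<not> ?thesis"
  then have below: "c * norm y \<le> norm (poly_act h (1 - X\<^sup>2) y)" for y
    by (simp add: not_less)
  have cX: "cnj_poly (X ^ k) = X ^ k" for k by (simp add: X)
  have le1: "poly_norm h (X ^ k) \<le> 1" for k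
    by (rule poly_norm_power_le) (simp add: norm1)
  have pow2: "poly_norm h (X ^ (2 ^ k)) = 1" for k
  proof (induction k)
    case (Suc k)
    then show ?case using poly_norm_square[OF h cX, of "2 ^ k"]
      by (simp add: power_add[symmetric] mult_2)
  qed (simp add: norm1)
  have eq1: "poly_norm h (X ^ k) = 1" for k
  proof (rule order.antisym[OF le1])
    have k: "k \<le> 2 ^ k" by (rule self_le_ge2_pow) simp
    have "1 = poly_norm h (X ^ k * X ^ (2 ^ k - k))"
      using pow2[of k] k by (simp add: power_add[symmetric])
    also have "\<dots> \<le> poly_norm h (X ^ k) * poly_norm h (X ^ (2 ^ k - k))"
      by (rule poly_norm_mult_le)
    also have "\<dots> \<le> poly_norm h (X ^ k) * 1"
      by (intro mult_left_mono le1 poly_norm_nonneg)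
    finally show "1 \<le> poly_norm h (X ^ k)" by simp
  qed
  define G where "G m = (\<Prod>j<m. 1 + (X ^ (2 ^ j))\<^sup>2)" for m :: nat
  have G_mult: "(1 - X\<^sup>2) * G m = 1 - X ^ (2 ^ Suc m)" for m
  proof (induction m)
    case (Suc m)
    have "(1 - X\<^sup>2) * G (Suc m) = (1 - X\<^sup>2) * G m * (1 + (X ^ (2 ^ m))\<^sup>2)"
      by (simp add: G_def mult_ac)
    also have "\<dots> = 1 - X ^ (2 ^ Suc (Suc m))"
      unfolding Suc by (simp add: algebra_simps flip: power_mult power_add)
    finally show ?case .
  qed (simp add: G_def power2_eq_square)
  have prod_X: "(\<Prod>j<m. smult 2 (X ^ (2 ^ j))) = smult (2 ^ m) (X ^ (2 ^ m - 1))" for m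
  proof (induction m)
    case (Suc m)
    have "2 ^ m - 1 + 2 ^ m = (2 ^ Suc m - 1 :: nat)" by simp
    then show ?case using Suc by (simp flip: power_add)
  qed simp
  have G_ge: "2 ^ m \<le> poly_norm h (G m)" for m
  proof -
    have "(poly_norm h (1 * (\<Prod>j<m. smult 2 (X ^ (2 ^ j)))))\<^sup>2
        \<le> poly_norm h (1\<^sup>2 * (\<Prod>j<m. (1 + (X ^ (2 ^ j))\<^sup>2)\<^sup>2))"
      by (rule poly_norm_prod_squares_ge) (simp_all add: h X)
    also have "\<dots> = poly_norm h (G m * G m)"
      by (simp add: G_def power2_eq_square prod.distrib)
    also have "\<dots> \<le> (poly_norm h (G m))\<^sup>2"
      using poly_norm_mult_le[of h "G m" "G m"] by (simp add: power2_eq_square)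
    finally have "(2 ^ m)\<^sup>2 \<le> (poly_norm h (G m))\<^sup>2"
      by (simp add: prod_X poly_norm_smult eq1 norm_power)
    then show ?thesis by (rule power2_le_imp_le) (rule poly_norm_nonneg)
  qed
  have "poly_norm h (G m) \<le> 2 / c" for m
  proof (rule poly_norm_leI)
    fix y
    have "c * norm (poly_act h (G m) y) \<le> norm (poly_act h (1 - X ^ (2 ^ Suc m)) y)"
      using below[of "poly_act h (G m) y"] by (simp add: poly_act_mult[symmetric] G_mult)
    also have "\<dots> \<le> poly_norm h (1 - X ^ (2 ^ Suc m)) * norm y"
      by (rule norm_poly_act_le)
    also have "\<dots> \<le> 2 * norm y"
      by (intro mult_right_mono poly_norm_1_minus_le le1) simp
    finally show "norm (poly_act h (G m) y) \<le> 2 / c * norm y"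
      using \<open>c > 0\<close> by (simp add: field_simps)
  qed (use \<open>c > 0\<close> in simp)
  then have "(2::real) ^ m \<le> 2 / c" for m
    using G_ge[of m] by (meson order.trans)
  moreover obtain m where "2 / c < (2::real) ^ m"
    using real_arch_pow[of 2 "2 / c"] by auto
  ultimately show False by (meson not_less)
qed

text \<open>
  For z not real, compare h - z with its conjugate: both have the same norm on each y, and their
  difference is a multiple of y.
\<close>

lemma linear_factor_bounded_below:
  assumes h: "star h = h" and le: "norm h \<le> c" and z: "\<not> (Im z = 0 \<and> \<bar>Re z\<bar> \<le> c)"
  shows "\<exists>b>0. \<forall>y. b * norm y \<le> norm (poly_act h [:- z, 1:] y)"
proof (cases "Im z = 0")
  case False
  have "\<bar>Im z\<bar> * norm y \<le> norm (poly_act h [:- z, 1:] y)" for y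
  proof -
    have "2 * \<bar>Im z\<bar> * norm y = norm ((2 * \<i> * Im z) *\<^sub>C y)"
      by (simp add: norm_scaleC norm_mult)
    also have "(2 * \<i> * Im z) *\<^sub>C y
        = poly_act h (cnj_poly [:- z, 1:]) y - poly_act h [:- z, 1:] y"
    proof -
      have "(2 * \<i> * Im z) = - cnj z - - z" by (simp add: complex_eq_iff)
      then show ?thesis by (simp add: complex_vector.scale_left_diff_distrib)
    qed
    also have "norm \<dots> \<le> norm (poly_act h (cnj_poly [:- z, 1:]) y) + norm (poly_act h [:- z, 1:] y)"
      by (rule norm_triangle_ineq4)
    also have "\<dots> = 2 * norm (poly_act h [:- z, 1:] y)"
      unfolding norm_poly_act_cnj[OF h] by simp
    finally show ?thesis by simp
  qed
  with False show ?thesis by (intro exI[of _ "\<bar>Im z\<bar>"]) simp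
next
  case True
  then have gt: "\<bar>Re z\<bar> > c" using z by simp
  have cz: "cmod z = \<bar>Re z\<bar>" using True by (simp add: cmod_def)
  have "(\<bar>Re z\<bar> - c) * norm y \<le> norm (poly_act h [:- z, 1:] y)" for y
  proof -
    have "norm (h * y) \<le> c * norm y"
      by (rule order.trans[OF norm_mult_ineq mult_right_mono[OF le]]) simp
    moreover have "norm (z *\<^sub>C y) = \<bar>Re z\<bar> * norm y" by (simp add: norm_scaleC cz)
    moreover have "norm (z *\<^sub>C y) - norm (h * y) \<le> norm (h * y - z *\<^sub>C y)"
      using norm_triangle_ineq2[of "z *\<^sub>C y" "h * y"] by (simp add: norm_minus_commute)
    ultimately show ?thesis by (simp add: left_diff_distrib scaleC_one)
  qed
  with gt show ?thesis by (intro exI[of _ "\<bar>Re z\<bar> - c"]) simp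
qed

lemma poly_act_bounded_below:
  assumes h: "star h = h" and le: "norm h \<le> c"
    and nz: "\<And>t. \<bar>t\<bar> \<le> c \<Longrightarrow> poly r (complex_of_real t) \<noteq> 0"
  shows "\<exists>b>0. \<forall>y. b * norm y \<le> norm (poly_act h r y)"
  using nz
proof (induction "degree r" arbitrary: r)
  case 0
  then obtain a where r: "r = [:a:]" by (metis degree_eq_zeroE)
  have "0 \<le> c" using le norm_ge_zero order.trans by blast
  with 0(2)[of 0] r have "a \<noteq> 0" by auto
  then show ?case by (intro exI[of _ "cmod a"]) (simp add: r norm_scaleC)
next
  case (Suc n)
  then have "\<not> constant (poly r)" by (simp add: constant_degree)
  then obtain z where "poly r z = 0" using fundamental_theorem_of_algebra by blast
  then obtain q where r: "r = [:- z, 1:] * q" by (metis poly_eq_0_iff_dvd dvd_def)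
  with Suc(2) have "q \<noteq> 0" by auto
  then have deg: "degree q = n"
    using Suc(2) unfolding r by (subst (asm) degree_mult_eq) auto
  have "\<not> (Im z = 0 \<and> \<bar>Re z\<bar> \<le> c)"
  proof
    assume a: "Im z = 0 \<and> \<bar>Re z\<bar> \<le> c"
    then have "complex_of_real (Re z) = z" by (simp add: complex_eq_iff)
    with Suc(3)[of "Re z"] a \<open>poly r z = 0\<close> show False by simp
  qed
  from linear_factor_bounded_below[OF h le this] obtain b1
    where b1: "b1 > 0" "\<And>y. b1 * norm y \<le> norm (poly_act h [:- z, 1:] y)" by blast
  have "\<And>t. \<bar>t\<bar> \<le> c \<Longrightarrow> poly q (complex_of_real t) \<noteq> 0"
    using Suc(3) unfolding r by auto
  from Suc(1)[OF deg[symmetric] this] obtain b2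
    where b2: "b2 > 0" "\<And>y. b2 * norm y \<le> norm (poly_act h q y)" by blast
  have "b1 * b2 * norm y \<le> norm (poly_act h r y)" for y
  proof -
    have "b1 * b2 * norm y \<le> b1 * norm (poly_act h q y)"
      using b2(2)[of y] b1(1) by (simp add: mult.assoc)
    also have "\<dots> \<le> norm (poly_act h r y)"
      unfolding r poly_act_mult by (rule b1(2))
    finally show ?thesis .
  qed
  with b1(1) b2(1) show ?case by (intro exI[of _ "b1 * b2"]) simp
qed

lemma poly_map_poly_of_real: "poly (map_poly complex_of_real p) (complex_of_real t) = complex_of_real (poly p t)"
  by (induction p) (simp_all add: map_poly_pCons)

lemma cnj_poly_map_poly_of_real [simp]: "cnj_poly (map_poly complex_of_real p) = map_poly complex_of_real p"
  by (simp add: poly_eq_iff coeff_map_poly)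

text \<open>
  The spectral bound. If |p| were smaller than the norm \<open>\<nu>\<close> of p(h) on the whole interval, then
  1 - (p/\<open>\<nu>\<close>)^2 would have no zero there, and hence be bounded below: factor it over the complex
  numbers and use the bounds for linear factors.
\<close>

lemma poly_norm_le_Sup:
  fixes p :: "real poly"
  assumes h: "star h = h" and "0 \<le> M" and le: "\<And>t. \<bar>t\<bar> \<le> norm h \<Longrightarrow> \<bar>poly p t\<bar> \<le> M"
  shows "poly_norm h (map_poly complex_of_real p) \<le> M"
proof (rule ccontr)
  define \<nu> where "\<nu> = poly_norm h (map_poly complex_of_real p)"
  assume "\<not> ?thesis"
  then have \<nu>: "\<nu> > M" "\<nu> > 0" using \<open>0 \<le> M\<close> by (simp_all add: \<nu>_def)
  define X where "X = smult (complex_of_real (1 / \<nu>)) (map_poly complex_of_real p)"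
  have X: "cnj_poly X = X" by (simp add: X_def)
  have X1: "poly_norm h X = 1"
    using \<nu>(2) unfolding X_def poly_norm_smult \<nu>_def[symmetric] norm_of_real by simp
  have "poly (1 - X\<^sup>2) (complex_of_real t) \<noteq> 0" if "\<bar>t\<bar> \<le> norm h" for t
  proof -
    have "\<bar>poly p t / \<nu>\<bar> < 1" using le[OF that] \<nu> by (simp add: field_simps)
    then have "(poly p t / \<nu>)\<^sup>2 \<noteq> 1" by (metis abs_square_eq_1 less_irrefl)
    moreover have "poly (1 - X\<^sup>2) (complex_of_real t) = complex_of_real (1 - (poly p t / \<nu>)\<^sup>2)"
      by (simp add: X_def poly_map_poly_of_real power_divide)
    ultimately show ?thesis by (simp only: of_real_eq_0_iff right_minus_eq not_False_eq_True)
  qed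
  from poly_act_bounded_below[OF h order.refl this] obtain b
    where "b > 0" "\<And>y. b * norm y \<le> norm (poly_act h (1 - X\<^sup>2) y)" by blast
  with one_minus_square_not_bounded_below[OF h X X1] show False
    by (meson not_less)
qed

section \<open>Continuous functional calculus\<close>

text \<open>
  Functions vanishing at 0 are approximated by polynomials t p(t), whose value p(h) h lies in the
  algebra.
\<close>

definition poly_val :: "'a::cstar_algebra \<Rightarrow> real poly \<Rightarrow> 'a"
  where "poly_val h p = poly_act h (map_poly complex_of_real p) h"

lemma map_poly_of_real_simps:
  "map_poly complex_of_real (p + q) = map_poly of_real p + map_poly of_real q"
  "map_poly complex_of_real (smult r p) = smult (of_real r) (map_poly of_real p)"
  "map_poly complex_of_real (p * q) = map_poly of_real p * map_poly of_real q"
  "map_poly complex_of_real (pCons a p) = pCons (of_real a) (map_poly of_real p)"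
  by (auto simp: poly_eq_iff coeff_map_poly coeff_mult coeff_pCons split: nat.splits)

lemma poly_val_pCons: "poly_val h (pCons a p) = a *\<^sub>R h + h * poly_val h p"
  by (simp add: poly_val_def map_poly_of_real_simps scaleR_scaleC)

lemma poly_val_add: "poly_val h (p + q) = poly_val h p + poly_val h q"
  by (simp add: poly_val_def map_poly_of_real_simps poly_act_add)

lemma poly_val_smult: "poly_val h (smult r p) = r *\<^sub>R poly_val h p"
  by (simp add: poly_val_def map_poly_of_real_simps poly_act_smult scaleR_scaleC)

lemma poly_val_mult_eq: "poly_val h p * y = poly_act h (map_poly complex_of_real (pCons 0 p)) y"
  by (simp add: poly_val_def map_poly_of_real_simps poly_act_mult_right poly_act_commute)

lemma poly_val_mult: "poly_val h p * poly_val h q = poly_val h (pCons 0 (p * q))"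
  unfolding poly_val_mult_eq by (simp add: poly_val_def map_poly_of_real_simps poly_act_mult)

lemma poly_val_in:
  assumes "h \<in> S" "\<And>x y. x \<in> S \<Longrightarrow> y \<in> S \<Longrightarrow> x + y \<in> S" "\<And>r x. x \<in> S \<Longrightarrow> r *\<^sub>R x \<in> S"
    "\<And>x y. x \<in> S \<Longrightarrow> y \<in> S \<Longrightarrow> x * y \<in> S"
  shows "poly_val h p \<in> S"
proof (induction p)
  case 0
  have "poly_val h 0 = 0 *\<^sub>R h" by (simp add: poly_val_def)
  then show ?case using assms(3)[OF assms(1), of 0] by simp
next
  case (pCons a p)
  then show ?case unfolding poly_val_pCons using assms by blast
qed

lemma star_poly_val: "star h = h \<Longrightarrow> star (poly_val h p) = poly_val h p"
proof (induction p)
  case (pCons a p)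
  have comm: "poly_val h p * h = h * poly_val h p"
    by (simp add: poly_val_def poly_act_mult_right poly_act_commute)
  show ?case
    using pCons by (simp add: poly_val_pCons star_add star_scaleR star_mult comm)
qed (simp add: poly_val_def)

lemma norm_poly_val_le:
  assumes h: "star h = h" and "0 \<le> M" and "\<And>t. \<bar>t\<bar> \<le> norm h \<Longrightarrow> \<bar>t * poly p t\<bar> \<le> M"
  shows "norm (poly_val h p) \<le> M"
proof (rule norm_le_of_mult_bound[OF \<open>0 \<le> M\<close>])
  fix y
  have "poly_norm h (map_poly complex_of_real (pCons 0 p)) \<le> M"
    by (rule poly_norm_le_Sup[OF h]) (use assms in auto)
  then show "norm (poly_val h p * y) \<le> M * norm y"
    unfolding poly_val_mult_eq
    by (rule order.trans[OF norm_poly_act_le mult_right_mono]) simp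
qed

definition cont0 :: "(real \<Rightarrow> real) \<Rightarrow> bool"
  where "cont0 f \<longleftrightarrow> continuous_on UNIV f \<and> f 0 = 0"

text \<open>
  The value f(h) is characterized by approximating sequences, so that sums and products of functions
  are handled by the limit theorems for uniform convergence.
\<close>

definition fc_rel :: "'a::cstar_algebra \<Rightarrow> (real \<Rightarrow> real) \<Rightarrow> 'a \<Rightarrow> bool"
  where "fc_rel h f x \<longleftrightarrow> (\<exists>P. uniform_limit {- norm h..norm h} (\<lambda>n t. t * poly (P n) t) f sequentially
      \<and> (\<lambda>n::nat. poly_val h (P n)) \<longlonglongrightarrow> x)"

definition fc :: "'a::cstar_algebra \<Rightarrow> (real \<Rightarrow> real) \<Rightarrow> 'a"
  where "fc h f = (SOME x. fc_rel h f x)"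

lemma fc_rel_norm_le:
  assumes h: "star h = h" and "0 \<le> M" and rel: "fc_rel h f x"
    and le: "\<And>t. \<bar>t\<bar> \<le> norm h \<Longrightarrow> \<bar>f t\<bar> \<le> M"
  shows "norm x \<le> M"
proof (rule field_le_epsilon)
  fix e :: real assume "e > 0"
  from rel obtain P where P: "uniform_limit {- norm h..norm h} (\<lambda>n t. t * poly (P n) t) f sequentially"
    and lim: "(\<lambda>n. poly_val h (P n)) \<longlonglongrightarrow> x"
    unfolding fc_rel_def by blast
  have "\<forall>\<^sub>F n in sequentially. \<forall>t\<in>{- norm h..norm h}. dist (t * poly (P n) t) (f t) < e"
    using P \<open>e > 0\<close> by (rule uniform_limitD)
  then have "\<forall>\<^sub>F n in sequentially. norm (poly_val h (P n)) \<le> M + e"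
  proof eventually_elim
    case (elim n)
    show ?case
    proof (rule norm_poly_val_le[OF h])
      fix t assume t: "\<bar>t\<bar> \<le> norm h"
      then have "\<bar>t * poly (P n) t - f t\<bar> < e"
        using elim by (auto simp: dist_real_def abs_le_iff)
      with le[OF t] show "\<bar>t * poly (P n) t\<bar> \<le> M + e" by linarith
    qed (use \<open>0 \<le> M\<close> \<open>e > 0\<close> in simp)
  qed
  then show "norm x \<le> M + e"
    by (rule tendsto_upperbound[OF tendsto_norm[OF lim]]) simp
qed

lemma fc_rel_add:
  assumes "fc_rel h f x" "fc_rel h g y"
  shows "fc_rel h (\<lambda>t. f t + g t) (x + y)"
proof -
  from assms obtain P Q where
    PQ: "uniform_limit {- norm h..norm h} (\<lambda>n t. t * poly (P n) t) f sequentially"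
      "(\<lambda>n. poly_val h (P n)) \<longlonglongrightarrow> x"
      "uniform_limit {- norm h..norm h} (\<lambda>n t. t * poly (Q n) t) g sequentially"
      "(\<lambda>n. poly_val h (Q n)) \<longlonglongrightarrow> y"
    unfolding fc_rel_def by blast
  show ?thesis
    unfolding fc_rel_def
    by (rule exI[of _ "\<lambda>n. P n + Q n"])
       (use uniform_limit_add[OF PQ(1,3)] tendsto_add[OF PQ(2,4)] in \<open>simp add: poly_val_add distrib_left\<close>)
qed

lemma fc_rel_scaleR:
  assumes "fc_rel h f x"
  shows "fc_rel h (\<lambda>t. r * f t) (r *\<^sub>R x)"
proof -
  from assms obtain P where
    P: "uniform_limit {- norm h..norm h} (\<lambda>n t. t * poly (P n) t) f sequentially"
      "(\<lambda>n. poly_val h (P n)) \<longlonglongrightarrow> x"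
    unfolding fc_rel_def by blast
  have "uniform_limit {- norm h..norm h} (\<lambda>n t. r * (t * poly (P n) t)) (\<lambda>t. r * f t) sequentially"
    using bounded_linear.uniform_limit[OF bounded_linear_mult_right P(1)] .
  then show ?thesis
    unfolding fc_rel_def
    by (intro exI[of _ "\<lambda>n. smult r (P n)"])
       (use tendsto_scaleR[OF tendsto_const P(2)] in \<open>simp add: poly_val_smult mult_ac\<close>)
qed

lemma cont0_bounded:
  assumes "cont0 f"
  shows "bounded (f ` {- c..c})"
proof -
  have "continuous_on {- c..c} f" using assms continuous_on_subset by (auto simp: cont0_def)
  then show ?thesis by (intro compact_imp_bounded compact_continuous_image) auto
qed

lemma fc_rel_mult:
  assumes "fc_rel h f x" "fc_rel h g y" "cont0 f" "cont0 g"
  shows "fc_rel h (\<lambda>t. f t * g t) (x * y)"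
proof -
  from assms obtain P Q where
    PQ: "uniform_limit {- norm h..norm h} (\<lambda>n t. t * poly (P n) t) f sequentially"
      "(\<lambda>n. poly_val h (P n)) \<longlonglongrightarrow> x"
      "uniform_limit {- norm h..norm h} (\<lambda>n t. t * poly (Q n) t) g sequentially"
      "(\<lambda>n. poly_val h (Q n)) \<longlonglongrightarrow> y"
    unfolding fc_rel_def by blast
  have "uniform_limit {- norm h..norm h} (\<lambda>n t. (t * poly (P n) t) * (t * poly (Q n) t))
      (\<lambda>t. f t * g t) sequentially"
    by (rule uniform_lim_mult[OF PQ(1,3)]) (rule cont0_bounded, fact assms)+
  then show ?thesis
    unfolding fc_rel_def
    by (intro exI[of _ "\<lambda>n. pCons 0 (P n * Q n)"])
       (use tendsto_mult[OF PQ(2,4)] in \<open>simp add: poly_val_mult mult_ac\<close>)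
qed

lemma fc_rel_poly: "fc_rel h (\<lambda>t. t * poly p t) (poly_val h p)"
  unfolding fc_rel_def
  by (rule exI[of _ "\<lambda>n. p"]) (simp add: uniform_limit_const)

lemma fc_rel_exists:
  assumes h: "star h = h" and f: "cont0 f"
  shows "\<exists>x. fc_rel h f x"
proof -
  have "\<exists>p. \<forall>t\<in>{- norm h..norm h}. \<bar>t * poly p t - f t\<bar> < e" if "e > 0" for e :: real
  proof -
    have "continuous_on {- norm h..norm h} f"
      using f continuous_on_subset by (auto simp: cont0_def)
    from Stone_Weierstrass_real_polynomial_function[OF compact_Icc this, of "e / 2"] \<open>e > 0\<close>
    obtain g where g: "real_polynomial_function g" "\<And>t. t \<in> {- norm h..norm h} \<Longrightarrow> \<bar>f t - g t\<bar> < e / 2"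
      by auto
    then obtain a n where gs: "g = (\<lambda>x. \<Sum>i\<le>n. a i * x ^ i)"
      unfolding real_polynomial_function_iff_sum by blast
    define q where "q = (\<Sum>i\<le>n. monom (a i) i)"
    have q: "poly q = g" by (simp add: q_def gs poly_sum poly_monom fun_eq_iff)
    obtain b p where bp: "q = pCons b p" by (rule pCons_cases)
    have gt: "g t = b + t * poly p t" for t using q bp by (metis poly_pCons)
    have b: "\<bar>b\<bar> < e / 2" using g(2)[of 0] gt[of 0] f by (simp add: cont0_def)
    have "\<bar>t * poly p t - f t\<bar> < e" if "t \<in> {- norm h..norm h}" for t
      using g(2)[OF that] gt[of t] b by linarith
    then show ?thesis by blast
  qed
  then have "\<exists>p. \<forall>t\<in>{- norm h..norm h}. \<bar>t * poly p t - f t\<bar> < inverse (real (Suc n))" for n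
    by (meson inverse_positive_iff_positive of_nat_0_less_iff zero_less_Suc)
  then obtain P where P: "\<And>n t. t \<in> {- norm h..norm h} \<Longrightarrow> \<bar>t * poly (P n) t - f t\<bar> < inverse (real (Suc n))"
    by metis
  have small: "\<exists>N. \<forall>n\<ge>N. inverse (real (Suc n)) < e" if "e > 0" for e
  proof -
    have "\<forall>\<^sub>F n in sequentially. inverse (real (Suc n)) < e"
      using LIMSEQ_inverse_real_of_nat that by (rule order_tendstoD)
    then show ?thesis by (simp add: eventually_sequentially)
  qed
  have ul: "uniform_limit {- norm h..norm h} (\<lambda>n t. t * poly (P n) t) f sequentially"
    unfolding uniform_limit_sequentially_iff dist_real_def
    using P small by (meson order.strict_trans)
  have "Cauchy (\<lambda>n. poly_val h (P n))"
  proof (rule metric_CauchyI)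
    fix e :: real assume "e > 0"
    then obtain N where N: "\<And>n. n \<ge> N \<Longrightarrow> inverse (real (Suc n)) < e / 4" using small[of "e / 4"] by auto
    have "dist (poly_val h (P m)) (poly_val h (P n)) < e" if "m \<ge> N" "n \<ge> N" for m n
    proof -
      have "poly_val h (P m) - poly_val h (P n) = poly_val h (P m + smult (- 1) (P n))"
        unfolding poly_val_add poly_val_smult by simp
      also have "norm \<dots> \<le> e / 2"
      proof (rule norm_poly_val_le[OF h])
        fix t assume "\<bar>t\<bar> \<le> norm h"
        then have t: "t \<in> {- norm h..norm h}" by auto
        have "t * poly (P m + smult (- 1) (P n)) t = t * poly (P m) t - t * poly (P n) t"
          by (simp add: algebra_simps)
        then show "\<bar>t * poly (P m + smult (- 1) (P n)) t\<bar> \<le> e / 2"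
          using P[OF t, of m] P[OF t, of n] N[OF that(1)] N[OF that(2)] by linarith
      qed (use \<open>e > 0\<close> in simp)
      finally show ?thesis using \<open>e > 0\<close> by (simp add: dist_norm)
    qed
    then show "\<exists>M. \<forall>m\<ge>M. \<forall>n\<ge>M. dist (poly_val h (P m)) (poly_val h (P n)) < e" by blast
  qed
  then obtain x where "(\<lambda>n. poly_val h (P n)) \<longlonglongrightarrow> x"
    using Cauchy_convergent convergent_def by blast
  with ul show ?thesis unfolding fc_rel_def by blast
qed

lemma fc_rel_fc: "star h = h \<Longrightarrow> cont0 f \<Longrightarrow> fc_rel h f (fc h f)"
  unfolding fc_def using fc_rel_exists by (rule someI_ex)

lemma fc_eqI:
  assumes h: "star h = h" and f: "cont0 f" and rel: "fc_rel h f x"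
  shows "fc h f = x"
proof -
  have "fc_rel h (\<lambda>t. f t + - 1 * f t) (fc h f + (- 1) *\<^sub>R x)"
    by (intro fc_rel_add fc_rel_scaleR fc_rel_fc assms)
  then have "norm (fc h f + (- 1) *\<^sub>R x) \<le> 0"
    by (rule fc_rel_norm_le[OF h order.refl]) simp
  then show ?thesis by simp
qed

lemma cont0_simps [simp, intro]:
  "cont0 (\<lambda>t. t)" "cont0 f \<Longrightarrow> cont0 g \<Longrightarrow> cont0 (\<lambda>t. f t + g t)"
  "cont0 f \<Longrightarrow> cont0 g \<Longrightarrow> cont0 (\<lambda>t. f t - g t)"
  "cont0 f \<Longrightarrow> cont0 (\<lambda>t. r * f t)"
  "cont0 f \<Longrightarrow> cont0 g \<Longrightarrow> cont0 (\<lambda>t. f t * g t)"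
  by (auto simp: cont0_def intro!: continuous_intros)

context
  fixes h :: "'a::cstar_algebra"
  assumes h: "star h = h"
begin

lemma fc_id: "fc h (\<lambda>t. t) = h"
  using fc_eqI[OF h _ fc_rel_poly, of 1] by (simp add: poly_val_def)

lemma fc_add: "cont0 f \<Longrightarrow> cont0 g \<Longrightarrow> fc h (\<lambda>t. f t + g t) = fc h f + fc h g"
  by (intro fc_eqI h fc_rel_add fc_rel_fc cont0_simps)

lemma fc_scaleR: "cont0 f \<Longrightarrow> fc h (\<lambda>t. r * f t) = r *\<^sub>R fc h f"
  by (intro fc_eqI h fc_rel_scaleR fc_rel_fc cont0_simps)

lemma fc_diff: "cont0 f \<Longrightarrow> cont0 g \<Longrightarrow> fc h (\<lambda>t. f t - g t) = fc h f - fc h g"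
  using fc_add[of f "\<lambda>t. - 1 * g t"] fc_scaleR[of g "-1"] by (simp add: cont0_def continuous_on_minus)

lemma fc_mult: "cont0 f \<Longrightarrow> cont0 g \<Longrightarrow> fc h (\<lambda>t. f t * g t) = fc h f * fc h g"
  by (intro fc_eqI h fc_rel_mult fc_rel_fc cont0_simps)

lemma norm_fc_le: "cont0 f \<Longrightarrow> 0 \<le> M \<Longrightarrow> (\<And>t. \<bar>t\<bar> \<le> norm h \<Longrightarrow> \<bar>f t\<bar> \<le> M) \<Longrightarrow> norm (fc h f) \<le> M"
  using fc_rel_norm_le[OF h _ fc_rel_fc[OF h]] by blast

lemma fc_in:
  assumes f: "cont0 f" and cl: "closed S" and S: "h \<in> S"
    "\<And>x y. x \<in> S \<Longrightarrow> y \<in> S \<Longrightarrow> x + y \<in> S" "\<And>r x. x \<in> S \<Longrightarrow> r *\<^sub>R x \<in> S"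
    "\<And>x y. x \<in> S \<Longrightarrow> y \<in> S \<Longrightarrow> x * y \<in> S"
  shows "fc h f \<in> S"
proof -
  from fc_rel_fc[OF h f] obtain P where "(\<lambda>n. poly_val h (P n)) \<longlonglongrightarrow> fc h f"
    unfolding fc_rel_def by blast
  then show ?thesis
    by (rule closed_sequentially[OF cl, rotated]) (rule poly_val_in[OF S])
qed

lemma star_fc: 
  assumes "cont0 f" shows "star (fc h f) = fc h f"
proof -
  from fc_rel_fc[OF h assms] obtain P where P: "(\<lambda>n. poly_val h (P n)) \<longlonglongrightarrow> fc h f"
    unfolding fc_rel_def by blast
  show ?thesis
    using tendsto_star[OF P] P by (simp add: star_poly_val[OF h] LIMSEQ_unique)
qed

end

section \<open>Separated sequences of functionals\<close>

definition clinear_functional :: "('a::complex_banach \<Rightarrow> complex) \<Rightarrow> bool"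
  where "clinear_functional g \<longleftrightarrow> (\<forall>x y. g (x + y) = g x + g y) \<and> (\<forall>c x. g (c *\<^sub>C x) = c * g x)"

lemma clinear_functionalD:
  assumes "clinear_functional g"
  shows "g (x + y) = g x + g y" "g (c *\<^sub>C x) = c * g x" "g (x - y) = g x - g y" "g 0 = 0"
    "g (r *\<^sub>R x) = of_real r * g x" "g (- x) = - g x"
proof -
  show add: "g (x + y) = g x + g y" for x y using assms by (simp add: clinear_functional_def)
  show sc: "g (c *\<^sub>C x) = c * g x" for c x using assms by (simp add: clinear_functional_def)
  show "g (r *\<^sub>R x) = of_real r * g x" for r x by (simp add: scaleR_scaleC sc)
  show "g 0 = 0" using sc[of 0 0] by simp
  show "g (x - y) = g x - g y" using add[of "x - y" y] by simp
  show "g (- x) = - g x" using sc[of "- 1" x] by simp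
qed

lemma clinear_functional_bounded:
  assumes "clinear_functional g" "\<And>x. cmod (g x) \<le> N * norm x"
  shows "bounded_linear g"
  by (rule bounded_linear_intro[of _ N])
     (use assms(2) in \<open>auto simp: clinear_functionalD[OF assms(1)] scaleR_conv_of_real mult.commute\<close>)

text \<open>
  The net property is applied only to sequences of functionals that attain norm one and have mutual
  distances at least 1, so \<open>\<epsilon> = 1\<close> throughout: their weak* limit cannot attain a norm larger
  than 1/2.
\<close>

lemma double_dagger_sequence:
  fixes g :: "nat \<Rightarrow> 'a::complex_banach \<Rightarrow> complex"
  assumes dd: "double_dagger TYPE('a)"
    and g: "\<And>n. clinear_functional (g n)" "\<And>n x. cmod (g n x) \<le> norm x"
    and attain: "\<And>n. \<exists>u. norm u \<le> 1 \<and> cmod (g n u) = 1"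
    and sep: "\<And>m n. m \<noteq> n \<Longrightarrow> \<exists>x. norm x \<le> 1 \<and> cmod (g m x - g n x) \<ge> 1"
    and l: "clinear_functional l" "\<And>x. cmod (l x) \<le> N * norm x" "norm u \<le> 1" "cmod (l u) = N"
    and lim: "\<And>x. (\<lambda>n. g n x) \<longlonglongrightarrow> l x"
    and "N \<le> 1"
  shows "N \<le> 1 / 2"
proof -
  define G where "G n = Blinfun (g n)" for n
  define L where "L = Blinfun l"
  have G: "blinfun_apply (G n) = g n" for n
    unfolding G_def by (rule bounded_linear_Blinfun_apply clinear_functional_bounded[of _ 1])+ (use g in auto)
  have L: "blinfun_apply L = l"
    unfolding L_def by (rule bounded_linear_Blinfun_apply clinear_functional_bounded)+ (fact l)+
  have "0 \<le> N" using l(4) norm_ge_zero by metis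
  have nG: "norm (G n) = 1" for n
  proof (rule antisym)
    show "norm (G n) \<le> 1" by (rule norm_blinfun_bound) (use g G in auto)
    obtain u where "norm u \<le> 1" "cmod (g n u) = 1" using attain by blast
    moreover have "cmod (g n u) \<le> norm (G n) * norm u" using norm_blinfun[of "G n" u] G by simp
    moreover have "norm (G n) * norm u \<le> norm (G n) * 1" using \<open>norm u \<le> 1\<close> by (intro mult_left_mono) auto
    ultimately show "1 \<le> norm (G n)" by linarith
  qed
  have nL: "norm L = N"
  proof (rule antisym)
    show "norm L \<le> N" by (rule norm_blinfun_bound[OF \<open>0 \<le> N\<close>]) (use l L in auto)
    have "cmod (l u) \<le> norm L * norm u" using norm_blinfun[of L u] L by simp
    moreover have "norm L * norm u \<le> norm L * 1" using \<open>norm u \<le> 1\<close> by (intro mult_left_mono) auto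
    ultimately show "N \<le> norm L" using l(4) by linarith
  qed
  have Gc: "G n \<in> cdual" for n
    using g(1) by (simp add: cdual_def G clinear_functional_def)
  have Lc: "L \<in> cdual" using l(1) by (simp add: cdual_def L clinear_functional_def)
  define r where "r = {(i, j::nat). i \<le> j}"
  have D: "directed_set UNIV r"
    by (auto simp: directed_set_def r_def intro: max.cobounded1 max.cobounded2)
  have tail: "tail_filter UNIV r = sequentially"
    unfolding filter_eq_iff eventually_tail_filter[OF D] eventually_sequentially
    by (simp add: r_def)
  have "separated_net_limit 1 UNIV r G L"
    unfolding separated_net_limit_def
  proof (intro conjI ballI impI)
    show "directed_set UNIV r" by (rule D)
    show "\<not> (\<exists>m\<in>UNIV. \<forall>i\<in>UNIV. (i, m) \<in> r)"
      by (auto simp: r_def not_le intro: lessI)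
    show "G n \<in> dual_ball" for n using Gc nG by (simp add: dual_ball_def)
    show "norm_attaining (G n)" for n using attain[of n] by (simp add: norm_attaining_def nG G)
    show "L \<in> dual_ball" using Lc nL \<open>N \<le> 1\<close> by (simp add: dual_ball_def)
    show "norm_attaining L" using l by (auto simp: norm_attaining_def nL L)
    show "limitin weak_star G L (tail_filter UNIV r)"
      unfolding tail by (subst limitin_weak_star) (use Gc Lc lim in \<open>auto simp: G L\<close>)
    show "1 \<le> norm (G i - G j)" if ij: "i \<noteq> j" for i j
    proof -
      obtain x where x: "norm x \<le> 1" "cmod (g i x - g j x) \<ge> 1" using sep[OF ij] by blast
      have "1 \<le> cmod (blinfun_apply (G i - G j) x)" using x by (simp add: blinfun.diff_left G)
      also have "\<dots> \<le> norm (G i - G j) * norm x" by (rule norm_blinfun)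
      also have "\<dots> \<le> norm (G i - G j) * 1" using x by (intro mult_left_mono) auto
      finally show ?thesis by simp
    qed
  qed
  from double_dagger_any_index[OF dd _ _ this] nL show ?thesis by simp
qed

section \<open>Linear functionals dominated by a seminorm\<close>

definition sublinear :: "('a::real_vector \<Rightarrow> real) \<Rightarrow> bool"
  where "sublinear q \<longleftrightarrow> (\<forall>x y. q (x + y) \<le> q x + q y) \<and> (\<forall>r x. r > 0 \<longrightarrow> q (r *\<^sub>R x) \<le> r * q x)"

lemma sublinear_0:
  assumes "sublinear q"
  shows "q 0 = 0"
proof -
  have "q (0 + 0) \<le> q 0 + q 0"
    using assms unfolding sublinear_def by blast
  moreover have "q ((1/2) *\<^sub>R 0) \<le> 1/2 * q 0"
    using assms unfolding sublinear_def by (meson half_gt_zero zero_less_one)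
  ultimately show ?thesis by simp
qed

lemma sublinear_uminus_le:
  assumes "sublinear q"
  shows "- q (- x) \<le> q x"
proof -
  have "q (x + - x) \<le> q x + q (- x)"
    using assms unfolding sublinear_def by blast
  then show ?thesis using sublinear_0[OF assms] by simp
qed

text \<open>
  The largest sublinear functional below q with the value - q y at - y. A minimal sublinear
  functional coincides with all of these and is therefore linear, which yields the Hahn-Banach
  theorem without extending a functional from a subspace.
\<close>

definition lower :: "('a::real_vector \<Rightarrow> real) \<Rightarrow> 'a \<Rightarrow> 'a \<Rightarrow> real"
  where "lower q y x = (INF t\<in>{0..}. q (x + t *\<^sub>R y) - t * q y)"

lemma lower_bdd:
  assumes q: "sublinear q"
  shows "bdd_below ((\<lambda>t. q (x + t *\<^sub>R y) - t * q y) ` {0..})"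
proof (rule bdd_belowI2[of _ "- q (- x)"])
  fix t :: real assume "t \<in> {0..}"
  have "q (t *\<^sub>R y) \<le> q (x + t *\<^sub>R y) + q (- x)"
    using q unfolding sublinear_def by (metis add.commute add_minus_cancel)
  moreover have "t * q y \<le> q (t *\<^sub>R y)"
  proof (cases "t = 0")
    case False
    then have "t > 0" using \<open>t \<in> {0..}\<close> by simp
    then have "q ((1 / t) *\<^sub>R (t *\<^sub>R y)) \<le> 1 / t * q (t *\<^sub>R y)"
      using q unfolding sublinear_def by (meson zero_less_divide_1_iff)
    then show ?thesis using \<open>t > 0\<close> by (simp add: field_simps)
  qed (simp add: sublinear_0[OF q])
  ultimately show "- q (- x) \<le> q (x + t *\<^sub>R y) - t * q y" by linarith
qed

lemma lower_le: "sublinear q \<Longrightarrow> 0 \<le> t \<Longrightarrow> lower q y x \<le> q (x + t *\<^sub>R y) - t * q y"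
  unfolding lower_def by (rule cINF_lower[OF lower_bdd]) auto

lemma sublinear_lower:
  assumes q: "sublinear q"
  shows "sublinear (lower q y)"
  unfolding sublinear_def
proof (intro conjI allI impI)
  fix x x' :: 'a
  have "lower q y (x + x') - (q (x' + t *\<^sub>R y) - t * q y) \<le> lower q y x" if "0 \<le> t" for t
  proof (subst (2) lower_def, rule cINF_greatest)
    fix s :: real assume "s \<in> {0..}"
    then have "lower q y (x + x') \<le> q (x + x' + (s + t) *\<^sub>R y) - (s + t) * q y"
      using that by (intro lower_le[OF q]) auto
    also have "x + x' + (s + t) *\<^sub>R y = (x + s *\<^sub>R y) + (x' + t *\<^sub>R y)"
      by (simp add: algebra_simps)
    also have "q \<dots> \<le> q (x + s *\<^sub>R y) + q (x' + t *\<^sub>R y)" using q by (simp add: sublinear_def)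
    finally show "lower q y (x + x') - (q (x' + t *\<^sub>R y) - t * q y) \<le> q (x + s *\<^sub>R y) - s * q y"
      by (simp add: algebra_simps)
  qed auto
  then have "lower q y (x + x') - lower q y x \<le> q (x' + t *\<^sub>R y) - t * q y" if "0 \<le> t" for t
    using that by (simp add: algebra_simps)
  then have "lower q y (x + x') - lower q y x \<le> lower q y x'"
    by (subst (3) lower_def, intro cINF_greatest) auto
  then show "lower q y (x + x') \<le> lower q y x + lower q y x'" by simp
next
  fix r :: real and x :: 'a assume "r > 0"
  have "lower q y (r *\<^sub>R x) / r \<le> lower q y x"
  proof (subst (2) lower_def, rule cINF_greatest)
    fix s :: real assume "s \<in> {0..}"
    then have "lower q y (r *\<^sub>R x) \<le> q (r *\<^sub>R x + (r * s) *\<^sub>R y) - (r * s) * q y"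
      using \<open>r > 0\<close> by (intro lower_le[OF q]) auto
    also have "r *\<^sub>R x + (r * s) *\<^sub>R y = r *\<^sub>R (x + s *\<^sub>R y)" by (simp add: algebra_simps)
    also have "q \<dots> \<le> r * q (x + s *\<^sub>R y)" using q \<open>r > 0\<close> by (simp add: sublinear_def)
    finally show "lower q y (r *\<^sub>R x) / r \<le> q (x + s *\<^sub>R y) - s * q y"
      using \<open>r > 0\<close> by (simp add: field_simps)
  qed auto
  then show "lower q y (r *\<^sub>R x) \<le> r * lower q y x"
    using \<open>r > 0\<close> by (simp add: field_simps)
qed

lemma minimal_sublinear_exists:
  assumes p: "sublinear p"
  shows "\<exists>m. sublinear m \<and> m \<le> p \<and> (\<forall>q. sublinear q \<longrightarrow> q \<le> m \<longrightarrow> q = m)"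
proof -
  define A where "A = {q. sublinear q \<and> q \<le> p}"
  define R where "R = {(a, b). a \<in> A \<and> b \<in> A \<and> b \<le> a}"
  have FR: "Field R = A" by (auto simp: R_def Field_def)
  have "Partial_order R"
    unfolding partial_order_on_def preorder_on_def FR
    by (auto simp: R_def refl_on_def trans_def antisym_def)
  moreover have "\<exists>u\<in>Field R. \<forall>a\<in>C. (a, u) \<in> R" if C: "C \<in> Chains R" for C
  proof (cases "C = {}")
    case True
    with p show ?thesis unfolding FR by (auto simp: A_def)
  next
    case False
    have CA: "C \<subseteq> A" using C by (auto simp: Chains_def R_def)
    have ch: "a \<le> b \<or> b \<le> a" if "a \<in> C" "b \<in> C" for a b
      using C that by (auto simp: Chains_def R_def)
    have bdd: "bdd_below ((\<lambda>q. q x) ` C)" for x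
    proof (rule bdd_belowI2[of _ "- p (- x)"])
      fix q assume "q \<in> C"
      then have q: "sublinear q" "q (- x) \<le> p (- x)" using CA by (auto simp: A_def le_fun_def)
      then show "- p (- x) \<le> q x" using sublinear_uminus_le[OF q(1), of x] by linarith
    qed
    define u where "u x = (INF q\<in>C. q x)" for x
    have u_le: "u x \<le> q x" if "q \<in> C" for q x
      unfolding u_def by (rule cINF_lower[OF bdd that])
    have "sublinear u"
      unfolding sublinear_def
    proof (intro conjI allI impI)
      fix x y
      have le: "u (x + y) \<le> q x + q' y" if qs: "q \<in> C" "q' \<in> C" for q q'
      proof -
        obtain q0 where q0: "q0 \<in> C" "q0 \<le> q" "q0 \<le> q'" using ch[OF qs] qs by auto
        have "u (x + y) \<le> q0 (x + y)" by (rule u_le[OF q0(1)])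
        also have "\<dots> \<le> q0 x + q0 y" using q0(1) CA by (auto simp: A_def sublinear_def)
        also have "\<dots> \<le> q x + q' y" using q0 by (intro add_mono) (auto simp: le_fun_def)
        finally show ?thesis .
      qed
      have "u (x + y) - q' y \<le> u x" if "q' \<in> C" for q'
        unfolding u_def[of x] by (rule cINF_greatest[OF False]) (use le that in \<open>simp add: diff_le_eq\<close>)
      then have "u (x + y) - u x \<le> u y"
        unfolding u_def[of y] by (intro cINF_greatest[OF False]) (simp add: algebra_simps)
      then show "u (x + y) \<le> u x + u y" by simp
    next
      fix r :: real and x assume "r > 0"
      have "u (r *\<^sub>R x) / r \<le> u x"
        unfolding u_def[of x]
      proof (rule cINF_greatest[OF False])
        fix q assume "q \<in> C"
        then have "q (r *\<^sub>R x) \<le> r * q x"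
          using CA \<open>r > 0\<close> by (auto simp: A_def sublinear_def)
        then have "u (r *\<^sub>R x) \<le> r * q x"
          using u_le[OF \<open>q \<in> C\<close>, of "r *\<^sub>R x"] by linarith
        then show "u (r *\<^sub>R x) / r \<le> q x" using \<open>r > 0\<close> by (simp add: field_simps)
      qed
      then show "u (r *\<^sub>R x) \<le> r * u x" using \<open>r > 0\<close> by (simp add: field_simps)
    qed
    moreover have "u \<le> p"
    proof -
      obtain q where "q \<in> C" using False by blast
      then show ?thesis using u_le[of q] CA by (auto simp: A_def le_fun_def intro: order.trans)
    qed
    ultimately have "u \<in> A" by (simp add: A_def)
    then show ?thesis unfolding FR
      by (intro bexI[of _ u]) (use CA u_le in \<open>auto simp: R_def le_fun_def\<close>)
  qed
  ultimately obtain m where m: "m \<in> Field R" "\<And>a. a \<in> Field R \<Longrightarrow> (m, a) \<in> R \<Longrightarrow> a = m"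
    using Zorns_po_lemma[of R] by blast
  have "q = m" if "sublinear q" "q \<le> m" for q
    using m that unfolding FR by (auto simp: R_def A_def)
  with m(1) show ?thesis unfolding FR by (auto simp: A_def)
qed

text \<open>
  A minimal functional below \<open>lower p a\<close> is linear, and its value at - a is at most - p a.
\<close>

lemma hahn_banach_sublinear:
  assumes p: "sublinear p"
  shows "\<exists>f. (\<forall>x y. f (x + y) = f x + f y) \<and> (\<forall>r x. f (r *\<^sub>R x) = r * f x) \<and> (\<forall>x. f x \<le> p x) \<and> f a = p a"
proof -
  obtain f where f: "sublinear f" "f \<le> lower p a" "\<And>q. sublinear q \<Longrightarrow> q \<le> f \<Longrightarrow> q = f"
    using minimal_sublinear_exists[OF sublinear_lower[OF p]] by blast
  have add: "f (x + y) = f x + f y" for x y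
  proof -
    have "lower f y \<le> f"
      using lower_le[OF f(1), of 0 y] by (simp add: le_fun_def)
    then have "lower f y = f" using f(3) sublinear_lower[OF f(1)] by blast
    then have "f x \<le> f (x + y) - f y" using lower_le[OF f(1), of 1 y x] by simp
    moreover have "f (x + y) \<le> f x + f y" using f(1) by (simp add: sublinear_def)
    ultimately show ?thesis by simp
  qed
  have f0: "f 0 = 0" by (rule sublinear_0[OF f(1)])
  have um: "f (- x) = - f x" for x using add[of x "- x"] f0 by simp
  have pos: "f (r *\<^sub>R x) = r * f x" if "r > 0" for r x
  proof (rule antisym)
    show "f (r *\<^sub>R x) \<le> r * f x" using f(1) that by (simp add: sublinear_def)
    have "f (r *\<^sub>R (- x)) \<le> r * f (- x)" using f(1) that unfolding sublinear_def by blast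
    then show "r * f x \<le> f (r *\<^sub>R x)" by (simp add: um)
  qed
  have scale: "f (r *\<^sub>R x) = r * f x" for r x
  proof (cases r "0::real" rule: linorder_cases)
    case less
    then show ?thesis using pos[of "- r" x] by (simp add: um)
  qed (use pos f0 in auto)
  have le: "f x \<le> p x" for x
    using f(2) lower_le[OF p, of 0 a x] by (auto simp: le_fun_def intro: order.trans)
  have "f (- a) \<le> lower p a (- a)" using f(2) by (simp add: le_fun_def)
  also have "\<dots> \<le> - p a" using lower_le[OF p, of 1 a "- a"] sublinear_0[OF p] by simp
  finally have "f a = p a" using le[of a] um by simp
  with add scale le show ?thesis by blast
qed

text \<open>
  A real functional f below p is the real part of the complex functional f(x) - i f(i x); rotating
  x shows that the modulus of the latter is below p.
\<close>

lemma hahn_banach_seminorm: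
  fixes p :: "'a::complex_banach \<Rightarrow> real"
  assumes add: "\<And>x y. p (x + y) \<le> p x + p y" and scale: "\<And>c x. p (c *\<^sub>C x) = cmod c * p x"
    and a: "p a = 1"
  shows "\<exists>g. clinear_functional g \<and> (\<forall>x. cmod (g x) \<le> p x) \<and> g a = 1"
proof -
  have "sublinear p" using add scale by (simp add: sublinear_def scaleR_scaleC)
  from hahn_banach_sublinear[OF this, of a] obtain f where
    f: "\<And>x y. f (x + y) = f x + f y" "\<And>r x. f (r *\<^sub>R x) = r * f x" "\<And>x. f x \<le> p x" "f a = 1"
    using a by auto
  define g where "g x = Complex (f x) (- f (\<i> *\<^sub>C x))" for x
  define k where "k x = f (\<i> *\<^sub>C x)" for x
  have g_def: "g x = Complex (f x) (- k x)" for x by (simp add: g_def k_def)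
  have f_scaleC: "f (c *\<^sub>C x) = Re c * f x + Im c * k x" for c x
  proof -
    have "c = of_real (Re c) + of_real (Im c) * \<i>" by (simp add: complex_eq_iff)
    then have "c *\<^sub>C x = Re c *\<^sub>R x + Im c *\<^sub>R (\<i> *\<^sub>C x)"
      unfolding scaleR_scaleC scaleC_scaleC scaleC_add_left[symmetric] by (rule arg_cong)
    then show ?thesis by (simp only: f k_def)
  qed
  have k_add: "k (x + y) = k x + k y" for x y
    by (simp add: k_def scaleC_add_right f(1))
  have k_scaleC: "k (c *\<^sub>C x) = Re c * k x - Im c * f x" for c x
    using f_scaleC[of "\<i> * c" x] by (simp add: k_def scaleC_scaleC)
  have g: "clinear_functional g"
    unfolding clinear_functional_def
    by (auto simp: g_def f(1) f_scaleC k_add k_scaleC complex_eq_iff algebra_simps)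
  have le: "cmod (g x) \<le> p x" for x
  proof (cases "g x = 0")
    case True
    have "0 \<le> p x" using add[of x "(- 1) *\<^sub>C x"] scale[of "- 1" x] scale[of 0 x] by simp
    with True show ?thesis by simp
  next
    case False
    define c where "c = cnj (g x) / cmod (g x)"
    have c: "cmod c = 1" using False by (simp add: c_def norm_divide)
    have "g (c *\<^sub>C x) = c * g x" by (rule clinear_functionalD[OF g])
    also have "\<dots> = cmod (g x)"
      using False by (simp add: c_def complex_norm_square[symmetric] power2_eq_square mult.commute[of "cnj _"])
    finally have "cmod (g x) = f (c *\<^sub>C x)" by (simp add: g_def complex_eq_iff)
    also have "\<dots> \<le> p x" using f(3)[of "c *\<^sub>C x"] by (simp add: scale c)
    finally show ?thesis .
  qed
  have "g a = 1"
  proof -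
    have "1 + (k a)\<^sup>2 \<le> 1"
      using power_mono[OF le[of a] norm_ge_zero, of 2] a by (simp add: g_def cmod_power2 f(4))
    then have "k a = 0" by simp
    then show ?thesis by (simp add: g_def f(4) complex_eq_iff)
  qed
  with g le show ?thesis by blast
qed

section \<open>No dyadic trees\<close>

text \<open>
  The nodes of the dyadic tree are words; a new letter is put in front, so the parent of
  \<open>b # s\<close> is s.
\<close>

definition level :: "nat \<Rightarrow> bool list set"
  where "level n = {s. length s = n}"

lemma finite_level [simp]: "finite (level n)"
  using finite_lists_length_eq[of "UNIV :: bool set" n] by (simp add: level_def)

lemma level_0 [simp]: "level 0 = {[]}"
  by (auto simp: level_def)

lemma sum_level_Suc: "sum f (level (Suc n)) = (\<Sum>s\<in>level n. f (True # s) + f (False # s))"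
proof -
  have "level (Suc n) = (#) True ` level n \<union> (#) False ` level n"
    by (auto simp: level_def length_Suc_conv image_iff)
  then have "sum f (level (Suc n)) = sum f ((#) True ` level n) + sum f ((#) False ` level n)"
    by (simp only:) (subst sum.union_disjoint, auto)
  then show ?thesis by (simp add: sum.reindex sum.distrib)
qed

lemma card_level: "card (level n) = 2 ^ n"
  using card_lists_length_eq[of "UNIV :: bool set" n] by (simp add: level_def)

text \<open>
  The scalar by which the combination of the Rademacher elements with coefficients c acts on the
  children of s.
\<close>

fun sign_sum :: "(nat \<Rightarrow> complex) \<Rightarrow> bool list \<Rightarrow> complex"
  where "sign_sum c [] = 0"
  | "sign_sum c (b # s) = sign_sum c s + (if b then c (length s) else - c (length s))"

text \<open>
  The Rademacher functions are orthonormal for the uniform measure on a level; the parallelogram law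
  gives the induction step.
\<close>

lemma sum_cmod_sign_sum_square:
  "(\<Sum>s\<in>level n. (cmod (sign_sum c s))\<^sup>2) = 2 ^ n * (\<Sum>k<n. (cmod (c k))\<^sup>2)"
proof (induction n)
  case (Suc n)
  have par: "(cmod (u + v))\<^sup>2 + (cmod (u + - v))\<^sup>2 = 2 * (cmod u)\<^sup>2 + 2 * (cmod v)\<^sup>2" for u v
    unfolding cmod_power2 by (simp add: power2_eq_square algebra_simps)
  have "(\<Sum>s\<in>level (Suc n). (cmod (sign_sum c s))\<^sup>2)
      = (\<Sum>s\<in>level n. 2 * (cmod (sign_sum c s))\<^sup>2 + 2 * (cmod (c n))\<^sup>2)"
    unfolding sum_level_Suc by (rule sum.cong[OF refl]) (simp only: sign_sum.simps if_True if_False par, simp add: level_def)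
  also have "\<dots> = 2 * (2 ^ n * (\<Sum>k<n. (cmod (c k))\<^sup>2)) + 2 ^ n * (2 * (cmod (c n))\<^sup>2)"
    by (simp add: sum.distrib card_level Suc.IH flip: sum_distrib_left)
  finally show ?case by (simp add: algebra_simps)
qed simp

lemma sum_cmod_sign_sum_le:
  "(\<Sum>s\<in>level n. cmod (sign_sum c s)) \<le> 2 ^ n * sqrt (\<Sum>k<n. (cmod (c k))\<^sup>2)"
proof -
  define B where "B = (\<Sum>k<n. (cmod (c k))\<^sup>2)"
  have "0 \<le> B" by (simp add: B_def sum_nonneg)
  have "(\<Sum>s\<in>level n. cmod (sign_sum c s))\<^sup>2 \<le> (\<Sum>s\<in>level n. (cmod (sign_sum c s))\<^sup>2) * card (level n)"
    by (rule sum_squared_le_sum_of_squares)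
  also have "\<dots> = (2 ^ n * sqrt B)\<^sup>2"
    unfolding sum_cmod_sign_sum_square card_level B_def[symmetric]
    using \<open>0 \<le> B\<close> by (simp add: power_mult_distrib power2_eq_square[of "2 ^ n"])
  finally show ?thesis
    unfolding B_def[symmetric] by (rule power2_le_imp_le) (simp add: \<open>0 \<le> B\<close>)
qed

text \<open>
  Every a(s) acts as a unit on its two orthogonal children. Averaging |x a(s)| over the words s of
  length n and letting n tend to infinity gives a seminorm p, and a functional \<open>\<phi>\<close> below p with
  \<open>\<phi>\<close>(a []) = 1 is diffuse along the tree. The Rademacher elements r(n), differences of the sums over
  the words of length n + 1 with first letter True and False, are orthonormal for \<open>\<phi>\<close>. By Bessel's
  inequality \<open>\<phi>\<close>(x r(n)) tends to 0, so the functionals \<open>\<phi>\<close>(x + x r(n)), which attain norm one at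
  a [] and are separated by the r(n), converge to \<open>\<phi>\<close>. This contradicts the property.
\<close>

lemma no_dyadic_tree:
  fixes a :: "bool list \<Rightarrow> 'a::cstar_algebra"
  assumes dd: "double_dagger TYPE('a)"
    and sa: "\<And>s. star (a s) = a s" and norm1: "\<And>s. norm (a s) = 1"
    and unit: "\<And>b s. a s * a (b # s) = a (b # s)"
    and orth: "\<And>s. a (True # s) * a (False # s) = 0"
  shows False
proof -
  have unit': "a (b # s) * a s = a (b # s)" for b s
    using arg_cong[OF unit[of s b], of star] by (simp add: star_mult sa)
  have orth': "a (b # s) * a (c # s) = 0" if "b \<noteq> c" for b c s
  proof (cases b)
    case True
    then show ?thesis using that orth[of s] by simp
  next
    case False
    have "star (a (True # s) * a (False # s)) = 0" using orth[of s] by simp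
    then show ?thesis using that False by (simp add: star_mult sa)
  qed
  have a_orth: "a s * a t = 0" if "length s = length t" "s \<noteq> t" for s t
    using that
  proof (induction s t rule: list_induct2)
    case (Cons b s c t)
    show ?case
    proof (cases "s = t")
      case True
      with Cons.prems show ?thesis by (simp add: orth')
    next
      case False
      have "a (b # s) * a (c # t) = (a (b # s) * a s) * (a t * a (c # t))"
        by (simp only: unit unit')
      also have "\<dots> = a (b # s) * (a s * a t) * a (c # t)" by (simp only: mult.assoc)
      finally show ?thesis using Cons.IH[OF False] by simp
    qed
  qed simp
  have root: "a [] * a (b # s) = a (b # s)" for b s
  proof (induction s arbitrary: b)
    case (Cons c s)
    have "a [] * a (b # c # s) = a [] * a (c # s) * a (b # c # s)" by (simp add: mult.assoc unit)
    then show ?case by (simp add: Cons unit)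
  qed (simp add: unit)
  define sgnb :: "bool \<Rightarrow> real" where "sgnb b = (if b then 1 else - 1)" for b
  define r where "r n = (\<Sum>t\<in>level (Suc n). sgnb (hd t) *\<^sub>R a t)" for n
  \<comment> \<open>The node itself need not be idempotent; r acts as a scalar on the children of the nodes that occur in it.\<close>
  have r_mult: "r n * a (d # b # s) = sgnb b *\<^sub>R a (d # b # s)" if s: "length s = n" for n d b s
  proof -
    have "r n * a (d # b # s) = (\<Sum>t\<in>level (Suc n). sgnb (hd t) *\<^sub>R (a t * a (b # s) * a (d # b # s)))"
      by (simp add: r_def sum_distrib_right mult.assoc unit)
    also have "\<dots> = (\<Sum>t\<in>level (Suc n). if t = b # s then sgnb b *\<^sub>R a (d # b # s) else 0)"
    proof (rule sum.cong[OF refl])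
      fix t assume t: "t \<in> level (Suc n)"
      show "sgnb (hd t) *\<^sub>R (a t * a (b # s) * a (d # b # s)) = (if t = b # s then sgnb b *\<^sub>R a (d # b # s) else 0)"
      proof (cases "t = b # s")
        case True
        then show ?thesis by (simp add: mult.assoc unit)
      next
        case False
        with t s have "a t * a (b # s) = 0" by (intro a_orth) (auto simp: level_def)
        with False show ?thesis by simp
      qed
    qed
    also have "\<dots> = sgnb b *\<^sub>R a (d # b # s)"
    proof -
      have "b # s \<in> level (Suc n)" using s by (simp add: level_def)
      then show ?thesis by simp
    qed
    finally show ?thesis .
  qed
  have norm_r: "norm (r n) \<le> 1" for n
    unfolding r_def
  proof (rule norm_sum_orthogonal_selfadjoint)
    show "sgnb (hd i) *\<^sub>R a i * sgnb (hd j) *\<^sub>R a j = 0"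
      if "i \<in> level (Suc n)" "j \<in> level (Suc n)" "i \<noteq> j" for i j
      using that a_orth[of i j] by (simp add: level_def)
  qed (auto simp: star_scaleR sa norm1 sgnb_def)
  define M where "M n x = (\<Sum>t\<in>level n. norm (x * a t)) / 2 ^ n" for n and x :: 'a
  define p where "p x = (INF n. M n x)" for x
  have M_nonneg: "0 \<le> M n x" for n x by (simp add: M_def sum_nonneg)
  have bdd: "bdd_below (range (\<lambda>n. M n x))" for x
    by (rule bdd_belowI2[of _ 0]) (rule M_nonneg)
  have p_le: "p x \<le> M n x" for n x
    unfolding p_def by (rule cINF_lower[OF bdd]) simp
  have dec: "decseq (\<lambda>n. M n x)" for x
  proof (rule decseq_SucI)
    fix n
    have le: "norm (x * a (b # s)) \<le> norm (x * a s)" for b s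
      using norm_mult_ineq[of "x * a s" "a (b # s)"] by (simp add: mult.assoc unit norm1)
    have "(\<Sum>t\<in>level (Suc n). norm (x * a t)) \<le> (\<Sum>t\<in>level n. 2 * norm (x * a t))"
      unfolding sum_level_Suc
    proof (rule sum_mono)
      fix s
      show "norm (x * a (True # s)) + norm (x * a (False # s)) \<le> 2 * norm (x * a s)"
        using le[of True s] le[of False s] by linarith
    qed
    then show "M (Suc n) x \<le> M n x"
      unfolding M_def by (simp add: field_simps sum_distrib_left[symmetric])
  qed
  have M_lim: "(\<lambda>n. M n x) \<longlonglongrightarrow> p x" for x
    unfolding p_def by (rule LIMSEQ_decseq_INF[OF bdd dec])
  have p_add: "p (x + y) \<le> p x + p y" for x y
  proof (rule LIMSEQ_le[OF M_lim tendsto_add[OF M_lim M_lim]])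
    have "M n (x + y) \<le> M n x + M n y" for n
      unfolding M_def add_divide_distrib[symmetric] sum.distrib[symmetric] distrib_right
      by (intro divide_right_mono sum_mono norm_triangle_ineq) simp
    then show "\<exists>N. \<forall>n\<ge>N. M n (x + y) \<le> M n x + M n y" by blast
  qed
  have p_scale: "p (c *\<^sub>C x) = cmod c * p x" for c x
  proof -
    have "M n (c *\<^sub>C x) = cmod c * M n x" for n
      by (simp add: M_def mult_scaleC_left norm_scaleC sum_distrib_left)
    then have "(\<lambda>n. cmod c * M n x) \<longlonglongrightarrow> p (c *\<^sub>C x)" using M_lim[of "c *\<^sub>C x"] by simp
    then show ?thesis using tendsto_mult[OF tendsto_const M_lim[of x]] by (rule LIMSEQ_unique)
  qed
  have "norm (a [] * a t) = 1" for t
    using root norm_square_selfadjoint[OF sa] by (cases t) (simp_all add: norm1)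
  then have "M n (a []) = 1" for n
    by (simp add: M_def card_level)
  then have "p (a []) = 1" by (simp add: p_def)
  from hahn_banach_seminorm[of p, OF p_add p_scale this] obtain \<phi> where
    \<phi>: "clinear_functional \<phi>" "\<And>x. cmod (\<phi> x) \<le> p x" "\<phi> (a []) = 1" by blast
  note lin = clinear_functionalD[OF \<phi>(1)]
  have \<phi>_le: "cmod (\<phi> x) \<le> M n x" for x n
    using \<phi>(2) p_le by (rule order.trans)
  have \<phi>_norm: "cmod (\<phi> x) \<le> norm x" for x
  proof -
    have "M 0 x \<le> norm x" using norm_mult_ineq[of x "a []"] by (simp add: M_def norm1)
    then show ?thesis using \<phi>_le[of x 0] by linarith
  qed
  have \<phi>_r_norm: "cmod (\<phi> (x + e *\<^sub>R (x * r n))) \<le> norm x" if e: "\<bar>e\<bar> = 1" for x n e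
  proof -
    have *: "norm ((x + e *\<^sub>R (x * r n)) * a (d # b # s)) \<le> (1 + e * sgnb b) * norm x"
      if "s \<in> level n" for d b s
    proof -
      have "(x + e *\<^sub>R (x * r n)) * a (d # b # s) = (1 + e * sgnb b) *\<^sub>R (x * a (d # b # s))"
        using that by (simp add: distrib_right mult.assoc r_mult level_def scaleR_left_distrib)
      moreover have "0 \<le> 1 + e * sgnb b" using e by (auto simp: sgnb_def)
      moreover have "norm (x * a (d # b # s)) \<le> norm x"
        using norm_mult_ineq[of x "a (d # b # s)"] by (simp add: norm1)
      ultimately show ?thesis by (simp add: mult_left_mono)
    qed
    have "(\<Sum>t\<in>level (Suc (Suc n)). norm ((x + e *\<^sub>R (x * r n)) * a t)) \<le> (\<Sum>t\<in>level n. 4 * norm x)"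
      unfolding sum_level_Suc
    proof (rule sum_mono)
      fix s assume s: "s \<in> level n"
      show "norm ((x + e *\<^sub>R (x * r n)) * a (True # True # s)) + norm ((x + e *\<^sub>R (x * r n)) * a (False # True # s))
          + (norm ((x + e *\<^sub>R (x * r n)) * a (True # False # s)) + norm ((x + e *\<^sub>R (x * r n)) * a (False # False # s)))
          \<le> 4 * norm x"
        using *[OF s, of True True] *[OF s, of False True] *[OF s, of True False] *[OF s, of False False]
        by (simp add: sgnb_def algebra_simps)
    qed
    then have "M (Suc (Suc n)) (x + e *\<^sub>R (x * r n)) \<le> norm x"
      by (simp add: M_def card_level field_simps)
    with \<phi>_le show ?thesis by (rule order.trans)
  qed
  have comb: "(\<Sum>n<length t. c n *\<^sub>C r n) * a (d # t) = sign_sum c t *\<^sub>C a (d # t)" for c d t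
  proof (induction t arbitrary: d)
    case (Cons b t)
    have "(\<Sum>n<length (b # t). c n *\<^sub>C r n) * a (d # b # t)
        = (\<Sum>n<length t. c n *\<^sub>C r n) * a (b # t) * a (d # b # t) + c (length t) *\<^sub>C (r (length t) * a (d # b # t))"
      by (simp add: distrib_right mult_scaleC_left mult.assoc unit)
    also have "\<dots> = sign_sum c t *\<^sub>C a (d # b # t) + c (length t) *\<^sub>C (sgnb b *\<^sub>R a (d # b # t))"
      by (simp add: Cons.IH mult_scaleC_left unit r_mult)
    finally show ?case
      by (simp add: sgnb_def scaleR_scaleC scaleC_add_left[symmetric])
  qed simp
  have bessel: "(\<Sum>n<K. (cmod (\<phi> (x * r n)))\<^sup>2) \<le> (norm x)\<^sup>2" for x K
  proof -
    define c where "c n = cnj (\<phi> (x * r n))" for n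
    define R where "R = (\<Sum>n<K. c n *\<^sub>C r n)"
    define B where "B = (\<Sum>n<K. (cmod (c n))\<^sup>2)"
    have "0 \<le> B" by (simp add: B_def sum_nonneg)
    have \<phi>_sum: "\<phi> (\<Sum>n<K. f n) = (\<Sum>n<K. \<phi> (f n))" for f and K :: nat
      by (induction K) (simp_all add: lin)
    have "\<phi> (x * R) = (\<Sum>n<K. c n * \<phi> (x * r n))"
      by (simp add: R_def sum_distrib_left \<phi>_sum mult_scaleC_right lin)
    also have "\<dots> = of_real B"
      unfolding B_def of_real_sum
      by (rule sum.cong) (simp_all add: c_def complex_norm_square mult.commute del: of_real_power)
    finally have "B \<le> cmod (\<phi> (x * R))" by (simp add: \<open>0 \<le> B\<close>)
    also have "\<dots> \<le> M (Suc K) (x * R)" by (rule \<phi>_le)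
    also have "\<dots> \<le> norm x * sqrt B"
    proof -
      have *: "norm (x * R * a (d # t)) \<le> cmod (sign_sum c t) * norm x" if "t \<in> level K" for d t
      proof -
        have "x * R * a (d # t) = sign_sum c t *\<^sub>C (x * a (d # t))"
          using comb[where c = c and t = t and d = d] that by (simp add: R_def level_def mult.assoc mult_scaleC_right)
        moreover have "norm (x * a (d # t)) \<le> norm x"
          using norm_mult_ineq[of x "a (d # t)"] by (simp add: norm1)
        ultimately show ?thesis by (simp add: norm_scaleC mult_left_mono)
      qed
      have "(\<Sum>t\<in>level (Suc K). norm (x * R * a t)) \<le> (\<Sum>t\<in>level K. 2 * norm x * cmod (sign_sum c t))"
        unfolding sum_level_Suc
      proof (rule sum_mono)
        fix t assume "t \<in> level K"
        then show "norm (x * R * a (True # t)) + norm (x * R * a (False # t)) \<le> 2 * norm x * cmod (sign_sum c t)"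
          using *[of t True] *[of t False] by (simp add: mult_ac)
      qed
      also have "\<dots> = 2 * norm x * (\<Sum>t\<in>level K. cmod (sign_sum c t))"
        by (simp add: sum_distrib_left)
      also have "\<dots> \<le> 2 * norm x * (2 ^ K * sqrt B)"
        unfolding B_def by (intro mult_left_mono sum_cmod_sign_sum_le) simp
      finally show ?thesis by (simp add: M_def field_simps)
    qed
    finally have "B \<le> norm x * sqrt B" .
    then have "sqrt B * sqrt B \<le> norm x * sqrt B" using \<open>0 \<le> B\<close> by simp
    then have "sqrt B \<le> norm x"
    proof (cases "B = 0")
      case False
      with \<open>0 \<le> B\<close> have "0 < sqrt B" by simp
      with \<open>sqrt B * sqrt B \<le> norm x * sqrt B\<close> show ?thesis by (rule mult_right_le_imp_le)
    qed simp
    then have "(sqrt B)\<^sup>2 \<le> (norm x)\<^sup>2" by (intro power_mono) (use \<open>0 \<le> B\<close> in auto)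
    then show ?thesis using \<open>0 \<le> B\<close> by (simp add: B_def c_def)
  qed
  have lim0: "(\<lambda>n. \<phi> (x * r n)) \<longlonglongrightarrow> 0" for x
  proof -
    have "summable (\<lambda>n. (cmod (\<phi> (x * r n)))\<^sup>2)"
      using bessel by (intro summableI_nonneg_bounded) auto
    then have "(\<lambda>n. (cmod (\<phi> (x * r n)))\<^sup>2) \<longlonglongrightarrow> 0" by (rule summable_LIMSEQ_zero)
    then show ?thesis by (simp add: tendsto_norm_zero_iff)
  qed
  have \<phi>rr: "\<phi> (r n * r n) = 1" for n
  proof -
    have "(a [] - r n * r n) * a t = 0" if t: "t \<in> level (Suc (Suc n))" for t
    proof -
      obtain d b s where t: "t = d # b # s" "length s = n"
        using t by (auto simp: level_def length_Suc_conv)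
      then show ?thesis by (simp add: left_diff_distrib mult.assoc r_mult root sgnb_def)
    qed
    then have "M (Suc (Suc n)) (a [] - r n * r n) = 0" by (simp add: M_def)
    then have "\<phi> (a [] - r n * r n) = 0" using \<phi>_le[of "a [] - r n * r n" "Suc (Suc n)"] by simp
    then show ?thesis by (simp add: lin \<phi>)
  qed
  have \<phi>rm: "\<phi> (r n * r m) = 0" if "n \<noteq> m" for n m
  proof -
    have "(\<Sum>k\<in>{n, m}. (cmod (\<phi> (r n * r k)))\<^sup>2) \<le> (\<Sum>k<Suc (max n m). (cmod (\<phi> (r n * r k)))\<^sup>2)"
      by (rule sum_mono2) auto
    also have "\<dots> \<le> (norm (r n))\<^sup>2" by (rule bessel)
    also have "\<dots> \<le> 1" using norm_r[of n] by (simp add: power_le_one)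
    finally show ?thesis using that by (simp add: \<phi>rr)
  qed
  define g where "g n x = \<phi> (x + x * r n)" for n x
  have "(1::real) \<le> 1 / 2"
  proof (rule double_dagger_sequence[OF dd, of g \<phi> 1 "a []"])
    show "clinear_functional (g n)" for n
      by (simp add: clinear_functional_def g_def lin distrib_right mult_scaleC_left distrib_left
          flip: scaleC_add_right)
    show "cmod (g n x) \<le> norm x" for n x
      using \<phi>_r_norm[of 1 x n] by (simp add: g_def)
    show "\<exists>u. norm u \<le> 1 \<and> cmod (g n u) = 1" for n
    proof -
      define w where "w = \<phi> (a [] * r n)"
      \<comment> \<open>Both signs give functionals of norm at most one, so 1 + w and 1 - w lie in the unit disc.\<close>
      have le: "cmod (1 + w) \<le> 1" "cmod (1 - w) \<le> 1"
        using \<phi>_r_norm[of 1 "a []" n] \<phi>_r_norm[of "-1" "a []" n]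
        by (simp_all add: lin \<phi> norm1 w_def)
      have "(cmod (1 + w))\<^sup>2 + (cmod (1 - w))\<^sup>2 = 2 + 2 * (cmod w)\<^sup>2"
        unfolding cmod_power2 by (simp add: power2_eq_square algebra_simps)
      moreover have "(cmod (1 + w))\<^sup>2 \<le> 1" "(cmod (1 - w))\<^sup>2 \<le> 1"
        using le by (simp_all add: power_le_one)
      ultimately have "(cmod w)\<^sup>2 \<le> 0" by linarith
      then have "w = 0" by simp
      then show ?thesis by (intro exI[of _ "a []"]) (simp add: g_def lin \<phi> norm1 w_def)
    qed
    show "\<exists>x. norm x \<le> 1 \<and> 1 \<le> cmod (g m x - g n x)" if "m \<noteq> n" for m n
      by (rule exI[of _ "r m"]) (simp add: g_def lin \<phi>rr \<phi>rm[OF that] norm_r)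
    show "(\<lambda>n. g n x) \<longlonglongrightarrow> \<phi> x" for x
      using tendsto_add[OF tendsto_const lim0[of x], of "\<phi> x"] by (simp add: g_def lin)
  qed (use \<phi> \<phi>_norm norm1 in auto)
  then show False by simp
qed

section \<open>Minimal projections\<close>

definition min_proj :: "'a::cstar_algebra \<Rightarrow> bool"
  where "min_proj p \<longleftrightarrow> p \<noteq> 0 \<and> p * p = p \<and> star p = p \<and> (\<forall>x. \<exists>c. p * x * p = c *\<^sub>C p)"

text \<open>
  For a minimal projection p this is the vector state of p; at \<open>\<eta>\<close>* \<open>\<xi>\<close> it is the inner product of
  \<open>\<xi>\<close> and \<open>\<eta>\<close> in the Hilbert space Ap.
\<close>

definition vstate :: "'a::cstar_algebra \<Rightarrow> 'a \<Rightarrow> complex"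
  where "vstate p x = (SOME c. p * x * p = c *\<^sub>C p)"

definition orthonormal :: "'a::cstar_algebra \<Rightarrow> 'a set \<Rightarrow> bool"
  where "orthonormal p B \<longleftrightarrow> (\<forall>e\<in>B. e * p = e) \<and> (\<forall>e\<in>B. \<forall>f\<in>B. star e * f = (if e = f then p else 0))"

text \<open>
  For an orthonormal set of columns this is the orthogonal projection onto its span, acting from the
  left.
\<close>

definition range_proj :: "'a::cstar_algebra set \<Rightarrow> 'a"
  where "range_proj B = (\<Sum>e\<in>B. e * star e)"

lemma star_range_proj: "star (range_proj B) = range_proj B"
  by (simp add: range_proj_def star_sum star_mult star_star)

lemma norm_proj:
  fixes p :: "'a::cstar_algebra"
  assumes "p * p = p" "star p = p" "p \<noteq> 0"
  shows "norm p = 1"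
  using cstar_identity[of p] assms by (simp add: power2_eq_square)

context
  fixes p :: "'a::cstar_algebra"
  assumes p: "min_proj p"
begin

lemma min_projD: "p \<noteq> 0" "p * p = p" "star p = p" "norm p = 1"
  using p norm_proj unfolding min_proj_def by blast+

lemma p_p_left: "p * (p * x) = p * x"
  by (simp add: mult.assoc[symmetric] min_projD)

lemma corner_eq: "p * x * p = vstate p x *\<^sub>C p"
  unfolding vstate_def by (rule someI_ex) (use p in \<open>simp add: min_proj_def\<close>)

lemma vstate_eqI: "p * x * p = c *\<^sub>C p \<Longrightarrow> vstate p x = c"
  using corner_eq[of x] min_projD(1) by simp

lemma clinear_vstate: "clinear_functional (vstate p)"
  unfolding clinear_functional_def
  by (intro conjI allI vstate_eqI)
     (simp_all add: distrib_left distrib_right corner_eq scaleC_add_left mult_scaleC_left mult_scaleC_right scaleC_scaleC)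

lemmas vstate_linear = clinear_functionalD[OF clinear_vstate]

lemma vstate_star: "vstate p (star x) = cnj (vstate p x)"
  using arg_cong[OF corner_eq[of x], of star]
  by (intro vstate_eqI) (simp add: star_mult star_scaleC min_projD mult.assoc)

lemma vstate_self: "vstate p p = 1"
  by (rule vstate_eqI) (simp add: min_projD scaleC_one)

lemma vstate_p_left: "vstate p (p * x) = vstate p x"
  by (rule vstate_eqI) (use corner_eq[of x] in \<open>simp add: p_p_left mult.assoc\<close>)

lemma cmod_vstate_le: "cmod (vstate p x) \<le> norm x"
proof -
  have "cmod (vstate p x) = norm (p * x * p)"
    by (simp add: corner_eq norm_scaleC min_projD)
  also have "\<dots> \<le> norm p * norm x * norm p"
    by (rule order.trans[OF norm_mult_ineq mult_right_mono[OF norm_mult_ineq]]) simp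
  finally show ?thesis by (simp add: min_projD)
qed

lemma star_column: "\<xi> * p = \<xi> \<Longrightarrow> p * star \<xi> = star \<xi>"
  by (metis min_projD(3) star_mult)

lemma column_product:
  assumes "\<xi> * p = \<xi>" "\<eta> * p = \<eta>"
  shows "star \<eta> * \<xi> = vstate p (star \<eta> * \<xi>) *\<^sub>C p"
proof -
  have "p * (star \<eta> * \<xi>) * p = star \<eta> * \<xi>"
    using assms star_column[OF assms(2)] by (simp add: mult.assoc[symmetric]) (simp add: mult.assoc)
  then show ?thesis using corner_eq[of "star \<eta> * \<xi>"] by simp
qed

text \<open>
  The left ideal Ap is a Hilbert space with inner product given by the scalar c in \<open>\<eta>\<close>* \<open>\<xi>\<close> = c p.
  Only positivity needs an argument. Subtract from \<open>\<xi>\<close> its component along p; if the remainder \<open>\<xi>\<close>'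
  satisfied \<open>\<xi>\<close>'* \<open>\<xi>\<close>' = - m^2 p with m > 0, then y = \<open>\<xi>\<close>' + m p would satisfy y* y = 0, so that
  \<open>\<xi>\<close>' = - m p, which is not orthogonal to p.
\<close>

lemma vstate_column_square:
  assumes \<xi>: "\<xi> * p = \<xi>"
  shows "vstate p (star \<xi> * \<xi>) = of_real ((norm \<xi>)\<^sup>2)"
proof -
  define c where "c = vstate p (star \<xi> * \<xi>)"
  define d where "d = vstate p \<xi>"
  have c: "star \<xi> * \<xi> = c *\<^sub>C p" unfolding c_def by (rule column_product[OF \<xi> \<xi>])
  have "cnj c = c"
    unfolding c_def vstate_star[symmetric] by (simp add: star_mult star_star)
  then have re: "c = of_real (Re c)" by (simp add: complex_eq_iff)
  have abs: "\<bar>Re c\<bar> = (norm \<xi>)\<^sup>2"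
  proof -
    have "(norm \<xi>)\<^sup>2 = norm (c *\<^sub>C p)" by (simp add: c[symmetric] cstar_identity)
    also have "\<dots> = \<bar>Re c\<bar>" by (subst re) (simp add: norm_scaleC min_projD)
    finally show ?thesis by simp
  qed
  have "0 \<le> Re c"
  proof (rule ccontr)
    assume "\<not> 0 \<le> Re c"
    then have neg: "Re c < 0" by simp
    define m where "m = sqrt ((cmod d)\<^sup>2 - Re c)"
    have gt: "0 < (cmod d)\<^sup>2 - Re c" using neg zero_le_power2[of "cmod d"] by linarith
    then have "m > 0" unfolding m_def by simp
    have m2: "m\<^sup>2 = (cmod d)\<^sup>2 - Re c" unfolding m_def using gt by simp
    have p\<xi>: "p * \<xi> = d *\<^sub>C p" using corner_eq[of \<xi>] \<xi> by (simp add: d_def mult.assoc)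
    have \<xi>p: "star \<xi> * p = cnj d *\<^sub>C p"
      using arg_cong[OF p\<xi>, of star] by (simp add: star_mult star_scaleC min_projD)
    define k where "k = of_real m - d"
    define \<eta> where "\<eta> = \<xi> + k *\<^sub>C p"
    have "star \<eta> * \<eta> = (c + k * cnj d + cnj k * d + cnj k * k) *\<^sub>C p"
      by (simp add: \<eta>_def star_add star_scaleC distrib_left distrib_right mult_scaleC_left mult_scaleC_right
          min_projD c p\<xi> \<xi>p scaleC_add_left scaleC_add_right scaleC_scaleC add_ac mult_ac)
    also have "c + k * cnj d + cnj k * d + cnj k * k = of_real (Re c + m\<^sup>2 - (cmod d)\<^sup>2)"
    proof -
      have "c + k * cnj d + cnj k * d + cnj k * k = c + of_real m * of_real m - d * cnj d"
        by (simp add: k_def algebra_simps)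
      also have "d * cnj d = of_real ((cmod d)\<^sup>2)" by (rule complex_norm_square[symmetric])
      finally show ?thesis by (subst (asm) re) (simp add: power2_eq_square)
    qed
    also have "\<dots> = 0" by (simp add: m2)
    finally have "\<eta> = 0" using star_mult_self_eq_0[of \<eta>] by simp
    then have "0 = p * \<eta>" by simp
    also have "\<dots> = of_real m *\<^sub>C p"
      by (simp add: \<eta>_def distrib_left p\<xi> mult_scaleC_right min_projD k_def scaleC_add_left[symmetric])
    finally show False using \<open>m > 0\<close> min_projD(1) by simp
  qed
  with abs re show ?thesis by (simp add: c_def)
qed

lemma orthonormalD:
  assumes "orthonormal p B" "e \<in> B"
  shows "e * p = e" "star e * e = p" "f \<in> B \<Longrightarrow> e \<noteq> f \<Longrightarrow> star e * f = 0" "norm e = 1"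
proof -
  show "e * p = e" "f \<in> B \<Longrightarrow> e \<noteq> f \<Longrightarrow> star e * f = 0" and e: "star e * e = p"
    using assms by (auto simp: orthonormal_def)
  show "norm e = 1"
    using cstar_identity[of e] min_projD(4) unfolding e by (simp add: power2_eq_1_iff) (smt (verit) norm_ge_zero)
qed

lemma range_proj_mult_basis:
  assumes "orthonormal p B" "finite B" "e \<in> B"
  shows "range_proj B * e = e" "star e * range_proj B = star e"
proof -
  have "range_proj B * e = (\<Sum>f\<in>B. f * (star f * e))"
    by (simp add: range_proj_def sum_distrib_right mult.assoc)
  also have "\<dots> = (\<Sum>f\<in>B. if f = e then e else 0)"
    by (rule sum.cong[OF refl]) (use assms orthonormalD[OF assms(1)] in auto)
  finally show *: "range_proj B * e = e" using assms by simp
  show "star e * range_proj B = star e"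
    using arg_cong[OF *, of star] by (simp add: star_mult star_range_proj)
qed

lemma bessel_identity:
  assumes B: "orthonormal p B" "finite B" and \<eta>: "\<eta> * p = \<eta>"
  shows "(norm \<eta>)\<^sup>2 = (\<Sum>e\<in>B. (cmod (vstate p (star e * \<eta>)))\<^sup>2) + (norm (\<eta> - range_proj B * \<eta>))\<^sup>2"
proof -
  define P where "P = range_proj B"
  have PP: "P * P = P"
  proof -
    have "P * P = (\<Sum>e\<in>B. P * e * star e)"
      by (subst (2) P_def) (simp add: range_proj_def sum_distrib_left mult.assoc)
    also have "\<dots> = P"
      unfolding P_def using range_proj_mult_basis(1)[OF B] by (simp add: range_proj_def)
    finally show ?thesis .
  qed
  have sP: "star P = P" by (simp add: P_def star_range_proj)
  have col: "(\<eta> - P * \<eta>) * p = \<eta> - P * \<eta>" using \<eta> by (simp add: left_diff_distrib mult.assoc)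
  have "star (\<eta> - P * \<eta>) * (\<eta> - P * \<eta>) = star \<eta> * \<eta> - star \<eta> * P * \<eta> - star \<eta> * P * \<eta> + star \<eta> * (P * P) * \<eta>"
    by (simp add: star_diff star_mult sP algebra_simps mult.assoc)
  then have "star \<eta> * \<eta> = star \<eta> * P * \<eta> + star (\<eta> - P * \<eta>) * (\<eta> - P * \<eta>)"
    by (simp add: PP)
  then have "complex_of_real ((norm \<eta>)\<^sup>2) = vstate p (star \<eta> * P * \<eta>) + of_real ((norm (\<eta> - P * \<eta>))\<^sup>2)"
    using vstate_column_square[OF \<eta>] vstate_column_square[OF col] vstate_linear(1) by metis
  also have "vstate p (star \<eta> * P * \<eta>) = (\<Sum>e\<in>B. of_real ((cmod (vstate p (star e * \<eta>)))\<^sup>2))"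
  proof -
    have sum: "vstate p (\<Sum>e\<in>F. f e) = (\<Sum>e\<in>F. vstate p (f e))" for F and f :: "'a \<Rightarrow> 'a"
      by (induction F rule: infinite_finite_induct) (simp_all add: vstate_linear)
    have "vstate p (star \<eta> * (e * star e) * \<eta>) = of_real ((cmod (vstate p (star e * \<eta>)))\<^sup>2)" if "e \<in> B" for e
    proof -
      define c where "c = vstate p (star e * \<eta>)"
      have c: "star e * \<eta> = c *\<^sub>C p"
        unfolding c_def by (rule column_product[OF \<eta> orthonormalD(1)[OF B(1) that]])
      have "star \<eta> * (e * star e) * \<eta> = star (star e * \<eta>) * (star e * \<eta>)"
        by (simp add: star_mult star_star mult.assoc)
      also have "\<dots> = (cnj c * c) *\<^sub>C p"
        by (simp add: c star_scaleC min_projD mult_scaleC_left mult_scaleC_right scaleC_scaleC mult.commute)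
      finally show ?thesis
        by (simp add: vstate_linear vstate_self c_def complex_norm_square mult.commute del: of_real_power)
    qed
    then show ?thesis
      by (simp add: P_def range_proj_def sum_distrib_left sum_distrib_right sum del: of_real_power)
  qed
  finally have "complex_of_real ((norm \<eta>)\<^sup>2)
      = of_real ((\<Sum>e\<in>B. (cmod (vstate p (star e * \<eta>)))\<^sup>2) + (norm (\<eta> - P * \<eta>))\<^sup>2)"
    by (simp only: of_real_add of_real_sum)
  then show ?thesis unfolding P_def of_real_eq_iff .
qed

text \<open>
  Were Ap infinite-dimensional, it would contain an orthonormal sequence e(n) orthogonal to p. Let
  \<open>\<tau>\<close> be the vector state of p. The functionals \<open>\<tau>\<close>(x (p + e(n))) / sqrt 2 attain norm one and have
  mutual distances at least 1, and by Bessel's inequality they converge to \<open>\<tau>\<close> / sqrt 2, whose norm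
  1 / sqrt 2 exceeds 1/2.
\<close>

lemma finite_orthonormal_basis_exists:
  assumes dd: "double_dagger TYPE('a)"
  shows "\<exists>B. finite B \<and> orthonormal p B \<and> p \<in> B \<and> (\<forall>\<xi>. \<xi> * p = \<xi> \<longrightarrow> range_proj B * \<xi> = \<xi>)"
proof (rule ccontr)
  assume none: "\<not> ?thesis"
  have step: "\<exists>e. e \<notin> B \<and> orthonormal p (insert e B)" if B: "finite B" "orthonormal p B" "p \<in> B" for B
  proof -
    from none B obtain \<xi> where \<xi>: "\<xi> * p = \<xi>" "range_proj B * \<xi> \<noteq> \<xi>" by blast
    define \<eta> where "\<eta> = \<xi> - range_proj B * \<xi>"
    define e where "e = (1 / norm \<eta>) *\<^sub>R \<eta>"
    have n: "norm \<eta> \<noteq> 0" using \<xi> by (simp add: \<eta>_def)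
    have col: "e * p = e" using \<xi> by (simp add: e_def \<eta>_def left_diff_distrib mult.assoc)
    have ne: "norm e = 1" using n by (simp add: e_def)
    have ee: "star e * e = p"
      using column_product[OF col col] vstate_column_square[OF col] by (simp add: ne scaleC_one)
    have orth: "star f * e = 0" if "f \<in> B" for f
    proof -
      have "star f * range_proj B = star f" by (rule range_proj_mult_basis[OF B(2,1) that])
      then have "star f * (range_proj B * \<xi>) = star f * \<xi>" by (simp add: mult.assoc[symmetric])
      then show ?thesis by (simp add: e_def \<eta>_def right_diff_distrib)
    qed
    have orth': "star e * f = 0" if "f \<in> B" for f
      using arg_cong[OF orth[OF that], of star] by (simp add: star_mult star_star)
    have "e \<notin> B" using orth ee min_projD(1) by auto
    moreover have "orthonormal p (insert e B)"
      using B(2) col ee orth orth' by (auto simp: orthonormal_def)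
    ultimately show ?thesis by blast
  qed
  define nx where "nx B = (SOME e. e \<notin> B \<and> orthonormal p (insert e B))" for B
  define F where "F = rec_nat {p} (\<lambda>_ B. insert (nx B) B)"
  have F0: "F 0 = {p}" and FS: "F (Suc n) = insert (nx (F n)) (F n)" for n by (simp_all add: F_def)
  have F: "finite (F n) \<and> orthonormal p (F n) \<and> p \<in> F n" for n
  proof (induction n)
    case 0
    show ?case by (simp add: F0 orthonormal_def min_projD)
  next
    case (Suc n)
    have "orthonormal p (insert (nx (F n)) (F n))"
      unfolding nx_def using someI_ex[OF step[of "F n"]] Suc by blast
    with Suc show ?case by (simp add: FS)
  qed
  define e where "e n = nx (F n)" for n
  have new: "e n \<notin> F n" for n
    unfolding e_def nx_def using someI_ex[OF step[of "F n"]] F[of n] by blast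
  have mono: "F m \<subseteq> F n" if "m \<le> n" for m n
    by (rule lift_Suc_mono_le[of F, OF _ that]) (auto simp: FS)
  have eF: "e m \<in> F n" if "m < n" for m n
    using mono[of "Suc m" n] that by (auto simp: FS e_def)
  have col: "e n * p = e n" and ee: "star (e n) * e n = p" and pe: "p * e n = 0"
    and ep: "star (e n) * p = 0" for n
  proof -
    have o: "orthonormal p (F (Suc n))" and "e n \<in> F (Suc n)" "p \<in> F (Suc n)" "e n \<noteq> p"
      using F[of "Suc n"] eF[of n "Suc n"] F[of n] new[of n] by auto
    then show "e n * p = e n" "star (e n) * e n = p" "p * e n = 0" "star (e n) * p = 0"
      using orthonormalD[OF o, of "e n"] orthonormalD(3)[OF o, of p "e n"] min_projD(3) by auto
  qed
  have inj: "e m \<noteq> e n" if "m \<noteq> n" for m n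
    using that eF[of m n] eF[of n m] new[of m] new[of n] by (metis nat_neq_iff)
  have eorth: "star (e m) * e n = 0" if "m \<noteq> n" for m n
    using orthonormalD(3)[of "F (Suc (max m n))" "e m" "e n"] F eF inj[OF that] by auto
  define \<zeta> where "\<zeta> n = p + e n" for n
  have norm_sqrt2: "norm x = sqrt 2" if "star x * x = 2 *\<^sub>R p" for x :: 'a
  proof -
    have "(norm x)\<^sup>2 = 2" using cstar_identity[of x] that by (simp add: min_projD)
    then show ?thesis by (simp add: real_sqrt_unique)
  qed
  have zz: "star (\<zeta> n) * \<zeta> n = 2 *\<^sub>R p" for n
    by (simp add: \<zeta>_def star_add distrib_left distrib_right min_projD pe ep ee scaleR_2)
  have dd': "star (e m - e n) * (e m - e n) = 2 *\<^sub>R p" if "m \<noteq> n" for m n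
    using that by (simp add: star_diff left_diff_distrib right_diff_distrib ee eorth scaleR_2)
  define g where "g n x = vstate p (x * \<zeta> n) / of_real (sqrt 2)" for n x
  have s2: "complex_of_real (sqrt 2) * of_real (sqrt 2) = 2"
    by (simp flip: of_real_mult)
  have lim0: "(\<lambda>n. vstate p (x * e n)) \<longlonglongrightarrow> 0" for x
  proof -
    define \<eta> where "\<eta> = star x * p"
    have \<eta>: "\<eta> * p = \<eta>" by (simp add: \<eta>_def mult.assoc min_projD)
    have eq: "cmod (vstate p (x * e n)) = cmod (vstate p (star (e n) * \<eta>))" for n
    proof -
      have "vstate p (star (e n) * \<eta>) = cnj (vstate p (p * (x * e n)))"
        unfolding vstate_star[symmetric] by (simp add: \<eta>_def star_mult min_projD mult.assoc)
      then show ?thesis by (simp add: vstate_p_left)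
    qed
    have "(\<Sum>n<K. (cmod (vstate p (x * e n)))\<^sup>2) \<le> (norm \<eta>)\<^sup>2" for K
    proof -
      have "inj_on e {..<K}" using inj by (auto intro: inj_onI)
      then have "(\<Sum>n<K. (cmod (vstate p (x * e n)))\<^sup>2) = (\<Sum>f\<in>e ` {..<K}. (cmod (vstate p (star f * \<eta>)))\<^sup>2)"
        by (simp add: sum.reindex eq)
      moreover have "orthonormal p (e ` {..<K})"
        unfolding orthonormal_def using col ee eorth by (metis imageE)
      ultimately show ?thesis using bessel_identity[of "e ` {..<K}" \<eta>] \<eta> by simp
    qed
    then have "summable (\<lambda>n. (cmod (vstate p (x * e n)))\<^sup>2)"
      by (intro summableI_nonneg_bounded) auto
    then have "(\<lambda>n. (cmod (vstate p (x * e n)))\<^sup>2) \<longlonglongrightarrow> 0" by (rule summable_LIMSEQ_zero)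
    then show ?thesis by (simp add: tendsto_norm_zero_iff)
  qed
  have "1 / sqrt 2 \<le> 1 / 2"
  proof (rule double_dagger_sequence[OF dd, of g "\<lambda>x. vstate p x / of_real (sqrt 2)" _ p])
    show "clinear_functional (g n)" for n
      by (simp add: clinear_functional_def g_def distrib_right mult_scaleC_left vstate_linear add_divide_distrib)
    show "cmod (g n x) \<le> norm x" for n x
    proof -
      have "cmod (vstate p (x * \<zeta> n)) \<le> norm x * sqrt 2"
        using cmod_vstate_le[of "x * \<zeta> n"] norm_mult_ineq[of x "\<zeta> n"] norm_sqrt2[OF zz[of n]] by simp
      then show ?thesis by (simp add: g_def norm_divide field_simps)
    qed
    show "\<exists>u. norm u \<le> 1 \<and> cmod (g n u) = 1" for n
    proof (intro exI conjI)
      show "norm ((1 / sqrt 2) *\<^sub>R star (\<zeta> n)) \<le> 1" by (simp add: norm_sqrt2[OF zz])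
      show "cmod (g n ((1 / sqrt 2) *\<^sub>R star (\<zeta> n))) = 1"
        by (simp add: g_def zz vstate_linear vstate_self s2 norm_divide flip: of_real_mult)
    qed
    show "\<exists>x. norm x \<le> 1 \<and> cmod (g m x - g n x) \<ge> 1" if "m \<noteq> n" for m n
    proof (intro exI conjI)
      define x where "x = (1 / sqrt 2) *\<^sub>R star (e m - e n)"
      show "norm x \<le> 1" by (simp add: x_def norm_sqrt2[OF dd'[OF that]])
      have "g m x - g n x = vstate p (x * (e m - e n)) / of_real (sqrt 2)"
        by (simp add: g_def \<zeta>_def distrib_left right_diff_distrib vstate_linear diff_divide_distrib[symmetric])
      also have "x * (e m - e n) = (1 / sqrt 2) *\<^sub>R 2 *\<^sub>R p"
        by (simp only: x_def mult_scaleR_left dd'[OF that])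
      also have "vstate p \<dots> / of_real (sqrt 2) = 1"
        by (simp add: vstate_linear vstate_self s2 flip: of_real_mult)
      finally show "1 \<le> cmod (g m x - g n x)" by simp
    qed
    show "clinear_functional (\<lambda>x. vstate p x / of_real (sqrt 2))"
      by (simp add: clinear_functional_def vstate_linear add_divide_distrib)
    show "cmod (vstate p x / of_real (sqrt 2)) \<le> 1 / sqrt 2 * norm x" for x
      using cmod_vstate_le[of x] by (simp add: norm_divide divide_right_mono)
    show "(\<lambda>n. g n x) \<longlonglongrightarrow> vstate p x / of_real (sqrt 2)" for x
    proof -
      have "vstate p (x * p) = vstate p x"
        by (rule vstate_eqI) (use corner_eq[of x] in \<open>simp add: mult.assoc min_projD mult_scaleC_left\<close>)
      then show ?thesis
        unfolding g_def \<zeta>_def distrib_left vstate_linear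
        using tendsto_divide[OF tendsto_add[OF tendsto_const lim0[of x], of "vstate p x"] tendsto_const, of "of_real (sqrt 2)"]
        by simp
    qed
  qed (simp_all add: min_projD vstate_self norm_divide)
  then show False using sqrt2_less_2 by (simp add: field_simps)
qed

end

section \<open>Blocks\<close>

definition column_basis :: "'a::cstar_algebra \<Rightarrow> 'a set"
  where "column_basis p = (SOME B. finite B \<and> orthonormal p B \<and> p \<in> B \<and>
    (\<forall>\<xi>. \<xi> * p = \<xi> \<longrightarrow> range_proj B * \<xi> = \<xi>))"

text \<open>
  When Ap is finite-dimensional, this is the unit of the ideal generated by the minimal projection p.
\<close>

definition central_support :: "'a::cstar_algebra \<Rightarrow> 'a"
  where "central_support p = range_proj (column_basis p)"

definition blocks :: "'a::cstar_algebra set"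
  where "blocks = central_support ` {p. min_proj p}"

text \<open>
  The closed ideal generated by the minimal projections. A finite sum of blocks is a central
  projection, and multiplication by these approximates exactly the elements of the ideal.
\<close>

definition block_ideal :: "'a::cstar_algebra set"
  where "block_ideal = {x. \<forall>\<delta>>0. \<exists>F. finite F \<and> F \<subseteq> blocks \<and> norm (x - x * \<Sum>F) < \<delta>}"

context
  assumes dd: "double_dagger TYPE('a::cstar_algebra)"
begin

lemma column_basis:
  assumes "min_proj (p::'a)"
  shows "finite (column_basis p)" "orthonormal p (column_basis p)" "p \<in> column_basis p"
    "\<xi> * p = \<xi> \<Longrightarrow> central_support p * \<xi> = \<xi>"
  using someI_ex[OF finite_orthonormal_basis_exists[OF assms dd]]
  unfolding column_basis_def[symmetric] central_support_def by blast+

lemma mult_central_support: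
  "x * central_support p = (\<Sum>e\<in>column_basis p. x * e * star e)"
  by (simp add: central_support_def range_proj_def sum_distrib_left mult.assoc)

text \<open>
  Let z be the central support of p. As x z is a combination of x e with e in Ap, on which z acts as
  a unit, z x z = x z for all x; taking adjoints, z x z = z x. So z is central.
\<close>

lemma central_support_props:
  assumes p: "min_proj (p::'a)"
  shows "central_support p * x = x * central_support p" "star (central_support p) = central_support p"
    "central_support p * central_support p = central_support p" "central_support p * p = p"
    "central_support p \<noteq> 0"
proof -
  define z where "z = central_support p"
  show sz: "star (central_support p) = central_support p"
    by (simp add: central_support_def star_range_proj)
  have zxz: "z * x * z = x * z" for x
  proof -
    have "z * (x * e) = x * e" if "e \<in> column_basis p" for e
      unfolding z_def
      by (rule column_basis(4)[OF p]) (use orthonormalD(1)[OF p column_basis(2)[OF p] that] in \<open>simp add: mult.assoc\<close>)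
    then show ?thesis
      unfolding z_def mult.assoc mult_central_support
      by (simp add: sum_distrib_left mult_central_support mult.assoc[symmetric])
  qed
  have zxz': "z * x * z = z * x" for x
    using arg_cong[OF zxz[of "star x"], of star] sz by (simp add: star_mult star_star mult.assoc z_def)
  show "central_support p * x = x * central_support p"
    using zxz[of x] zxz'[of x] by (simp add: z_def)
  have zp: "z * p = p"
    unfolding z_def by (rule column_basis(4)[OF p]) (rule min_projD(2)[OF p])
  then show "central_support p * p = p" by (simp add: z_def)
  then show "central_support p \<noteq> 0" using min_projD(1)[OF p] by auto
  have "z * (e * star e) = e * star e" if "e \<in> column_basis p" for e
    using column_basis(4)[OF p orthonormalD(1)[OF p column_basis(2)[OF p] that]]
    by (simp add: z_def mult.assoc[symmetric])
  then show "central_support p * central_support p = central_support p"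
    unfolding z_def by (simp add: mult_central_support[of "central_support p"] mult.assoc)
      (simp add: central_support_def range_proj_def)
qed

text \<open>
  If y = p x q is nonzero, then y y* is a nonzero multiple of p, and the central support of q, which
  fixes y = y q, fixes p.
\<close>

lemma central_support_mult_eq:
  assumes p: "min_proj (p::'a)" and q: "min_proj q" and v: "p * x * q \<noteq> 0"
  shows "central_support q * central_support p = central_support p"
proof -
  define z' where "z' = central_support q"
  define y where "y = p * x * q"
  have yq: "y * q = y" by (simp add: y_def mult.assoc min_projD[OF q])
  have "y * star y = p * (x * q * star x) * p"
    by (simp add: y_def star_mult min_projD[OF p] min_projD[OF q] mult.assoc p_p_left[OF q])
  also have "\<dots> = vstate p (x * q * star x) *\<^sub>C p" by (rule corner_eq[OF p])
  finally obtain d where d: "y * star y = d *\<^sub>C p" by blast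
  have "d \<noteq> 0"
  proof
    assume "d = 0"
    then have "star (star y) * star y = 0" using d by (simp add: star_star)
    then have "star y = 0" using star_mult_self_eq_0 by blast
    then have "star (star y) = 0" by simp
    then show False using v by (simp add: star_star y_def)
  qed
  have "z' * y = y" unfolding z'_def by (rule column_basis(4)[OF q yq])
  then have "d *\<^sub>C (z' * p) = d *\<^sub>C p" unfolding mult_scaleC_right[symmetric] d[symmetric] by (simp add: mult.assoc[symmetric])
  with \<open>d \<noteq> 0\<close> have z'p: "z' * p = p" by simp
  have "z' * (e * star e) = e * star e" if "e \<in> column_basis p" for e
  proof -
    have ep: "e * p = e" by (rule orthonormalD(1)[OF p column_basis(2)[OF p] that])
    have "z' * e = e * (z' * p)"
      unfolding z'_def by (metis central_support_props(1)[OF q] ep mult.assoc)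
    then have "z' * e = e" by (simp add: z'p ep)
    then show ?thesis by (simp add: mult.assoc[symmetric])
  qed
  then show ?thesis
    unfolding z'_def[symmetric] by (simp add: central_support_def range_proj_def sum_distrib_left)
qed

lemma blocksE:
  assumes "(z::'a) \<in> blocks"
  obtains p where "min_proj p" "z = central_support p"
  using assms by (auto simp: blocks_def)

lemma block_props:
  assumes "(z::'a) \<in> blocks"
  shows "z * x = x * z" "star z = z" "z * z = z" "z \<noteq> 0" "norm z = 1"
proof -
  obtain p where p: "min_proj p" "z = central_support p" using assms by (rule blocksE)
  show *: "z * x = x * z" "star z = z" "z * z = z" "z \<noteq> 0"
    unfolding p(2) by (rule central_support_props[OF p(1)])+
  show "norm z = 1" by (rule norm_proj[OF *(3,2,4)])
qed

lemma blocks_orthogonal: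
  assumes "(z::'a) \<in> blocks" "w \<in> blocks" "z \<noteq> w"
  shows "z * w = 0"
proof -
  obtain p q where p: "min_proj p" "z = central_support p" and q: "min_proj q" "w = central_support q"
    using assms(1,2) by (metis blocksE)
  show ?thesis
  proof (cases "\<exists>x. p * x * q \<noteq> 0")
    case True
    then obtain x where x: "p * x * q \<noteq> 0" by blast
    have "star (p * x * q) \<noteq> 0" using x by (metis star_star star_zero)
    then have "q * star x * p \<noteq> 0" by (simp add: star_mult min_projD[OF p(1)] min_projD[OF q(1)] mult.assoc)
    from central_support_mult_eq[OF p(1) q(1) x] central_support_mult_eq[OF q(1) p(1) this]
      block_props(1)[OF assms(1), of w] assms(3)
    show ?thesis by (simp add: p q)
  next
    case False
    have "e * star e * (f * star f) = 0" if "e \<in> column_basis p" "f \<in> column_basis q" for e f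
    proof -
      have "star e = p * star e" "f = f * q"
        using orthonormalD(1)[OF p(1) column_basis(2)[OF p(1)] that(1)] star_column[OF p(1)]
          orthonormalD(1)[OF q(1) column_basis(2)[OF q(1)] that(2)] by metis+
      then have "star e * f = p * (star e * f) * q" by (metis mult.assoc)
      then have "star e * f = 0" using False by simp
      then show ?thesis by (metis mult.assoc mult_zero_left mult_zero_right)
    qed
    then show ?thesis
      unfolding p(2) q(2) central_support_def range_proj_def by (simp add: sum_product)
  qed
qed

lemma block_sum_props:
  assumes F: "finite F" "F \<subseteq> (blocks :: 'a set)"
  shows "\<Sum>F * x = x * \<Sum>F" "star (\<Sum>F) = \<Sum>F"
    "z \<in> blocks \<Longrightarrow> z * \<Sum>F = (if z \<in> F then z else 0)"
    "finite G \<Longrightarrow> G \<subseteq> blocks \<Longrightarrow> F \<subseteq> G \<Longrightarrow> \<Sum>F * \<Sum>G = \<Sum>F"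
proof -
  show "\<Sum>F * x = x * \<Sum>F"
    unfolding sum_distrib_left sum_distrib_right
    by (rule sum.cong) (use F block_props(1) in auto)
  show "star (\<Sum>F) = \<Sum>F"
    unfolding star_sum by (rule sum.cong) (use F block_props(2) in auto)
  have mem: "z * \<Sum>F = (if z \<in> F then z else 0)" if "finite F" "F \<subseteq> blocks" "z \<in> blocks" for z :: 'a and F
  proof -
    have "z * \<Sum>F = (\<Sum>w\<in>F. if w = z then z else 0)"
      unfolding sum_distrib_left
      by (rule sum.cong) (use that blocks_orthogonal block_props(3) in auto)
    then show ?thesis using that by simp
  qed
  show "z \<in> blocks \<Longrightarrow> z * \<Sum>F = (if z \<in> F then z else 0)" by (rule mem[OF F])
  show "\<Sum>F * \<Sum>G = \<Sum>F" if "finite G" "G \<subseteq> blocks" "F \<subseteq> G"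
    unfolding sum_distrib_right
  proof (rule sum.cong[OF refl])
    fix z assume "z \<in> F"
    then have "z \<in> blocks" "z \<in> G" using that F by auto
    then show "z * \<Sum>G = z" using mem[OF that(1,2), of z] by simp
  qed
qed

lemma norm_cut_mono:
  assumes F: "finite F" "F \<subseteq> (blocks :: 'a set)" and G: "finite G" "G \<subseteq> blocks" "F \<subseteq> G"
  shows "norm (x - x * \<Sum>G) \<le> norm (x - x * \<Sum>F)"
proof -
  have FG: "\<Sum>F * \<Sum>G = \<Sum>F" by (rule block_sum_props(4)[OF F G])
  have GG: "\<Sum>G * \<Sum>G = \<Sum>G" by (rule block_sum_props(4)[OF G(1,2) G(1,2)]) simp
  have "star (x - x * \<Sum>G) * (x * \<Sum>G - x * \<Sum>F) = 0"
  proof -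
    have GF: "\<Sum>G * \<Sum>F = \<Sum>F" using FG block_sum_props(1)[OF F] by metis
    have "star (x - x * \<Sum>G) = star x - star x * \<Sum>G"
      by (simp add: star_diff star_mult block_sum_props(2)[OF G(1,2)] block_sum_props(1)[OF G(1,2)])
    then have "star (x - x * \<Sum>G) * (x * \<Sum>G - x * \<Sum>F)
      = star x * x * \<Sum>G - star x * x * \<Sum>F - (star x * (\<Sum>G * x) * \<Sum>G - star x * (\<Sum>G * x) * \<Sum>F)"
      by (simp add: left_diff_distrib right_diff_distrib mult.assoc)
    also have "\<Sum>G * x = x * \<Sum>G" by (rule block_sum_props(1)[OF G(1,2)])
    finally show ?thesis by (simp add: mult.assoc GG GF)
  qed
  from norm_le_norm_add_orthogonal[OF this] show ?thesis by simp
qed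

lemma norm_cut_le:
  assumes "finite F" "F \<subseteq> (blocks :: 'a set)"
  shows "norm (x - x * \<Sum>F) \<le> norm x"
  using norm_cut_mono[OF finite.emptyI empty_subsetI assms empty_subsetI, of x] by simp

lemma block_ideal_closed_ideal:
  shows block_ideal_add: "(x::'a) \<in> block_ideal \<Longrightarrow> y \<in> block_ideal \<Longrightarrow> x + y \<in> block_ideal"
    and block_ideal_mult_left: "x \<in> block_ideal \<Longrightarrow> a * x \<in> block_ideal"
    and block_ideal_mult_right: "x \<in> block_ideal \<Longrightarrow> x * a \<in> block_ideal"
    and block_ideal_scaleC: "x \<in> block_ideal \<Longrightarrow> c *\<^sub>C x \<in> block_ideal"
    and block_ideal_limit: "(\<And>e. e > 0 \<Longrightarrow> \<exists>y\<in>block_ideal. norm (x - y) \<le> e) \<Longrightarrow> x \<in> block_ideal"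
proof -
  show "x + y \<in> block_ideal" if x: "x \<in> block_ideal" and y: "y \<in> block_ideal" for x y :: 'a
    unfolding block_ideal_def
  proof (intro CollectI allI impI)
    fix \<delta> :: real assume "\<delta> > 0"
    then have "\<delta> / 2 > 0" by simp
    with x y obtain F G where F: "finite F" "F \<subseteq> blocks" "norm (x - x * \<Sum>F) < \<delta> / 2"
      and G: "finite G" "G \<subseteq> blocks" "norm (y - y * \<Sum>G) < \<delta> / 2"
      unfolding block_ideal_def by blast
    have U: "finite (F \<union> G)" "F \<union> G \<subseteq> blocks" using F G by auto
    have "norm (x + y - (x + y) * \<Sum>(F \<union> G)) \<le> norm (x - x * \<Sum>(F \<union> G)) + norm (y - y * \<Sum>(F \<union> G))"
      using norm_triangle_ineq[of "x - x * \<Sum>(F \<union> G)" "y - y * \<Sum>(F \<union> G)"] by (simp add: algebra_simps)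
    also have "\<dots> < \<delta>"
      using norm_cut_mono[OF F(1,2) U, of x] norm_cut_mono[OF G(1,2) U, of y] F(3) G(3) by simp
    finally show "\<exists>F. finite F \<and> F \<subseteq> blocks \<and> norm (x + y - (x + y) * \<Sum>F) < \<delta>" using U by blast
  qed
  have bound: "b \<in> block_ideal"
    if x: "x \<in> block_ideal"
      and le: "\<And>F. finite F \<Longrightarrow> F \<subseteq> blocks \<Longrightarrow> norm (b - b * \<Sum>F) \<le> K * norm (x - x * \<Sum>F)" for x b :: 'a and K
    unfolding block_ideal_def
  proof (intro CollectI allI impI)
    fix \<delta> :: real assume "\<delta> > 0"
    define M where "M = max K 1"
    have M: "M > 0" "K \<le> M" by (auto simp: M_def)
    then have "\<delta> / M > 0" using \<open>\<delta> > 0\<close> by simp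
    with x obtain F where F: "finite F" "F \<subseteq> blocks" "norm (x - x * \<Sum>F) < \<delta> / M"
      unfolding block_ideal_def by blast
    have "norm (b - b * \<Sum>F) \<le> M * norm (x - x * \<Sum>F)"
      using le[OF F(1,2)] M(2) by (meson mult_right_mono norm_ge_zero order.trans)
    also have "\<dots> < \<delta>" using F(3) M by (simp add: field_simps)
    finally show "\<exists>F. finite F \<and> F \<subseteq> blocks \<and> norm (b - b * \<Sum>F) < \<delta>" using F by blast
  qed
  show "a * x \<in> block_ideal" if "x \<in> block_ideal" for a x :: 'a
  proof (rule bound[OF that, of _ "norm a"])
    fix F :: "'a set"
    have "a * x - a * x * \<Sum>F = a * (x - x * \<Sum>F)" by (simp add: right_diff_distrib mult.assoc)
    then show "norm (a * x - a * x * \<Sum>F) \<le> norm a * norm (x - x * \<Sum>F)" by (simp add: norm_mult_ineq)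
  qed
  show "x * a \<in> block_ideal" if "x \<in> block_ideal" for a x :: 'a
  proof (rule bound[OF that, of _ "norm a"])
    fix F :: "'a set" assume F: "finite F" "F \<subseteq> blocks"
    have "x * a - x * a * \<Sum>F = (x - x * \<Sum>F) * a"
      using block_sum_props(1)[OF F, of a] by (simp add: left_diff_distrib mult.assoc)
    then show "norm (x * a - x * a * \<Sum>F) \<le> norm a * norm (x - x * \<Sum>F)"
      using norm_mult_ineq[of "x - x * \<Sum>F" a] by (simp add: mult.commute)
  qed
  show "c *\<^sub>C x \<in> block_ideal" if "x \<in> block_ideal" for c and x :: 'a
  proof (rule bound[OF that, of _ "cmod c"])
    fix F :: "'a set"
    have "c *\<^sub>C x - c *\<^sub>C x * \<Sum>F = c *\<^sub>C (x - x * \<Sum>F)"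
      by (simp add: mult_scaleC_left complex_vector.scale_right_diff_distrib)
    then show "norm (c *\<^sub>C x - c *\<^sub>C x * \<Sum>F) \<le> cmod c * norm (x - x * \<Sum>F)" by (simp add: norm_scaleC)
  qed
  show "x \<in> block_ideal" if lim: "\<And>e. e > 0 \<Longrightarrow> \<exists>y\<in>block_ideal. norm (x - y) \<le> e" for x :: 'a
    unfolding block_ideal_def
  proof (intro CollectI allI impI)
    fix \<delta> :: real assume "\<delta> > 0"
    then obtain y where y: "y \<in> block_ideal" "norm (x - y) \<le> \<delta> / 2" using lim[of "\<delta> / 2"] by auto
    have "\<delta> / 2 > 0" using \<open>\<delta> > 0\<close> by simp
    with y(1) obtain F where F: "finite F" "F \<subseteq> blocks" "norm (y - y * \<Sum>F) < \<delta> / 2"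
      unfolding block_ideal_def by blast
    have "x - x * \<Sum>F = ((x - y) - (x - y) * \<Sum>F) + (y - y * \<Sum>F)" by (simp add: algebra_simps)
    then have "norm (x - x * \<Sum>F) \<le> norm ((x - y) - (x - y) * \<Sum>F) + norm (y - y * \<Sum>F)"
      by (metis norm_triangle_ineq)
    also have "\<dots> < \<delta>" using norm_cut_le[OF F(1,2), of "x - y"] y(2) F(3) by linarith
    finally show "\<exists>F. finite F \<and> F \<subseteq> blocks \<and> norm (x - x * \<Sum>F) < \<delta>" using F by blast
  qed
qed

lemma block_ideal_scaleR: "(x::'a) \<in> block_ideal \<Longrightarrow> r *\<^sub>R x \<in> block_ideal"
  by (simp add: scaleR_scaleC block_ideal_scaleC)

lemma block_ideal_diff: "(x::'a) \<in> block_ideal \<Longrightarrow> y \<in> block_ideal \<Longrightarrow> x - y \<in> block_ideal"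
  using block_ideal_add[of x "(- 1) *\<^sub>R y"] block_ideal_scaleR[of y "-1"] by simp

lemma block_ideal_0: "(0::'a) \<in> block_ideal"
  unfolding block_ideal_def by (auto intro!: exI[of _ "{}"])

lemma mult_block_sum_in_ideal:
  assumes "finite F" "F \<subseteq> (blocks :: 'a set)"
  shows "x * \<Sum>F \<in> block_ideal"
  unfolding block_ideal_def
  by (intro CollectI allI impI exI[of _ F]) (simp add: assms mult.assoc block_sum_props(4)[OF assms assms])

lemma min_proj_in_ideal:
  assumes p: "min_proj (p::'a)"
  shows "p \<in> block_ideal"
proof -
  have "central_support p \<in> blocks" using p by (simp add: blocks_def)
  then have "p * \<Sum>{central_support p} \<in> block_ideal" by (intro mult_block_sum_in_ideal) auto
  then show ?thesis using central_support_props(1,4)[OF p] by simp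
qed

end

section \<open>Spectral gaps and local units\<close>

text \<open>
  If k vanishes where |f| < d, then k = f^(2n) w(n) with |w(n)| \<open>\<le>\<close> K / d^(2n). So the norm of k(h) is
  at most K times a power of (|f(h)| / d)^2, which is less than one.
\<close>

lemma fc_eq_0_of_gap:
  fixes h :: "'a::cstar_algebra"
  assumes h: "star h = h" and f: "cont0 f" and k: "cont0 k"
    and small: "norm (fc h f) < d" and van: "\<And>t. \<bar>f t\<bar> < d \<Longrightarrow> k t = 0"
  shows "fc h k = 0"
proof -
  have d: "d > 0" using small norm_ge_zero[of "fc h f"] by linarith
  obtain K where K: "K > 0" "\<And>t. \<bar>t\<bar> \<le> norm h \<Longrightarrow> \<bar>k t\<bar> \<le> K"
  proof -
    obtain K where "K > 0" "\<forall>x\<in>k ` {- norm h..norm h}. norm x \<le> K"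
      using cont0_bounded[OF k] bounded_pos by blast
    then show thesis by (intro that[of K]) (auto simp: abs_le_iff)
  qed
  define w where "w n t = k t / (max ((f t)\<^sup>2) (d\<^sup>2)) ^ n" for n t
  have pos: "max ((f t)\<^sup>2) (d\<^sup>2) \<noteq> 0" for t
    using d zero_less_power[OF d, of 2] by (metis less_irrefl less_max_iff_disj)
  have w: "cont0 (w n)" for n
    using k f unfolding cont0_def w_def[abs_def]
    by (auto intro!: continuous_intros simp: pos)
  have f2: "cont0 (\<lambda>t. f t * f t)" by (intro cont0_simps f)
  have step: "fc h (w n) = fc h f * fc h f * fc h (w (Suc n))" for n
  proof -
    have "w n t = f t * f t * w (Suc n) t" for t
    proof (cases "\<bar>f t\<bar> < d")
      case True
      then show ?thesis by (simp add: w_def van)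
    next
      case False
      then have "d\<^sup>2 \<le> (f t)\<^sup>2" using d by (simp add: abs_le_square_iff[symmetric])
      moreover have "f t \<noteq> 0" using False d by auto
      ultimately show ?thesis by (simp add: w_def max_absorb1 power2_eq_square)
    qed
    then have "fc h (w n) = fc h (\<lambda>t. f t * f t * w (Suc n) t)" by (intro arg_cong[of _ _ "fc h"] ext)
    then show ?thesis by (simp add: fc_mult[OF h f2 w] fc_mult[OF h f f])
  qed
  define q where "q = (norm (fc h f) / d)\<^sup>2"
  have q: "0 \<le> q" "q < 1"
    using small d by (auto simp: q_def abs_square_less_1)
  have le: "norm (fc h k) \<le> K * q ^ n" for n
  proof -
    have "norm (fc h k) \<le> (norm (fc h f))\<^sup>2 ^ n * norm (fc h (w n))"
    proof (induction n)
      case 0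
      have "w 0 = k" by (simp add: w_def fun_eq_iff)
      then show ?case by simp
    next
      case (Suc n)
      have "norm (fc h (w n)) \<le> (norm (fc h f))\<^sup>2 * norm (fc h (w (Suc n)))"
        unfolding step[of n] power2_eq_square
        by (rule order.trans[OF norm_mult_ineq mult_right_mono[OF norm_mult_ineq]]) simp
      then have "(norm (fc h f))\<^sup>2 ^ n * norm (fc h (w n))
          \<le> (norm (fc h f))\<^sup>2 ^ n * ((norm (fc h f))\<^sup>2 * norm (fc h (w (Suc n))))"
        by (rule mult_left_mono) simp
      with Suc show ?case by (simp add: mult_ac)
    qed
    also have "norm (fc h (w n)) \<le> K / (d\<^sup>2) ^ n"
    proof (rule norm_fc_le[OF h w])
      fix t assume t: "\<bar>t\<bar> \<le> norm h"
      have "\<bar>k t\<bar> / (max ((f t)\<^sup>2) (d\<^sup>2)) ^ n \<le> K / (d\<^sup>2) ^ n"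
        using d K t by (intro frac_le power_mono) auto
      moreover have "\<bar>w n t\<bar> = \<bar>k t\<bar> / (max ((f t)\<^sup>2) (d\<^sup>2)) ^ n"
        by (simp add: w_def abs_divide power_abs max_def)
      ultimately show "\<bar>w n t\<bar> \<le> K / (d\<^sup>2) ^ n" by simp
    qed (use K d in simp)
    then have "(norm (fc h f))\<^sup>2 ^ n * norm (fc h (w n)) \<le> (norm (fc h f))\<^sup>2 ^ n * (K / (d\<^sup>2) ^ n)"
      by (rule mult_left_mono) simp
    also have "\<dots> = K * q ^ n" by (simp add: q_def power_divide)
    finally show ?thesis .
  qed
  have "(\<lambda>n. K * q ^ n) \<longlonglongrightarrow> K * 0"
    by (intro tendsto_mult tendsto_const LIMSEQ_realpow_zero q)
  then have "norm (fc h k) \<le> K * 0"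
    by (rule LIMSEQ_le_const) (use le in blast)
  then show ?thesis by simp
qed

text \<open>
  The function \<open>plateau \<delta>\<close> is constantly 1 where \<open>soft \<delta>\<close> does not vanish, so its value at h is a
  local unit for a small perturbation of h.
\<close>

definition soft :: "real \<Rightarrow> real \<Rightarrow> real"
  where "soft \<delta> t = t - max (- \<delta>) (min \<delta> t)"

definition plateau :: "real \<Rightarrow> real \<Rightarrow> real"
  where "plateau \<delta> t = min (\<bar>t\<bar> / \<delta>) 1"

lemma cont0_soft_plateau:
  assumes "\<delta> > 0"
  shows "cont0 (soft \<delta>)" "cont0 (plateau \<delta>)" "plateau \<delta> t * soft \<delta> t = soft \<delta> t"
proof -
  show "cont0 (soft \<delta>)" "cont0 (plateau \<delta>)"
    using assms unfolding cont0_def soft_def[abs_def] plateau_def[abs_def]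
    by (auto intro!: continuous_intros)
  show "plateau \<delta> t * soft \<delta> t = soft \<delta> t"
    using assms unfolding soft_def plateau_def
    by (auto simp: min_def max_def divide_simps abs_if split: if_splits)
qed

definition unit_domain :: "'a::cstar_algebra \<Rightarrow> 'a set"
  where "unit_domain g = {x. g * x = x \<and> x * g = x}"

lemma closed_unit_domain: "closed (unit_domain g)"
proof -
  have "closed {x. g * x = x}" "closed {x. x * g = x}"
    by (intro closed_Collect_eq continuous_intros)+
  then show ?thesis unfolding unit_domain_def by (rule closed_Collect_conj)
qed

lemma unit_domain_algebra:
  "x \<in> unit_domain g \<Longrightarrow> y \<in> unit_domain g \<Longrightarrow> x + y \<in> unit_domain g"
  "x \<in> unit_domain g \<Longrightarrow> r *\<^sub>R x \<in> unit_domain g"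
  "x \<in> unit_domain g \<Longrightarrow> y \<in> unit_domain g \<Longrightarrow> x * y \<in> unit_domain g"
  "x \<in> unit_domain g \<Longrightarrow> c *\<^sub>C x \<in> unit_domain g"
  by (simp_all add: unit_domain_def distrib_left distrib_right mult_scaleC_left mult_scaleC_right)
     (metis mult.assoc)

lemma unit_domain_diff: "x \<in> unit_domain g \<Longrightarrow> y \<in> unit_domain g \<Longrightarrow> x - y \<in> unit_domain g"
  by (simp add: unit_domain_def left_diff_distrib right_diff_distrib)

lemma unit_domain_star: "star g = g \<Longrightarrow> x \<in> unit_domain g \<Longrightarrow> star x \<in> unit_domain g"
  unfolding unit_domain_def by (metis (mono_tags, lifting) mem_Collect_eq star_mult)

lemma fc_unit_domain: "star x = x \<Longrightarrow> cont0 f \<Longrightarrow> x \<in> unit_domain g \<Longrightarrow> fc x f \<in> unit_domain g"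
  by (rule fc_in) (auto simp: closed_unit_domain unit_domain_algebra)

lemma fc_orthogonal:
  assumes x: "star x = x" "cont0 f" and y: "star y = y" "cont0 k" and xy: "x * y = 0"
  shows "fc x f * fc y k = 0"
proof -
  have yx: "y * x = 0" using arg_cong[OF xy, of star] by (simp add: star_mult x y)
  have cl: "closed {u. u * c = 0 \<and> c * u = 0}" for c :: 'a
    by (intro closed_Collect_conj closed_Collect_eq continuous_intros)
  have alg: "u * v \<in> {u. u * c = 0 \<and> c * u = 0}"
    if "u \<in> {u. u * c = 0 \<and> c * u = 0}" "v \<in> {u. u * c = 0 \<and> c * u = 0}" for u v c :: 'a
    using that by (simp add: mult.assoc[symmetric]) (simp add: mult.assoc)
  have "fc x f \<in> {u. u * y = 0 \<and> y * u = 0}"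
    by (rule fc_in[OF x cl _ _ _ alg]) (auto simp: xy yx distrib_left distrib_right)
  then have f: "y * fc x f = 0" "fc x f * y = 0" by auto
  have "fc y k \<in> {u. u * fc x f = 0 \<and> fc x f * u = 0}"
    by (rule fc_in[OF y cl _ _ _ alg]) (auto simp: f distrib_left distrib_right)
  then show ?thesis by simp
qed

section \<open>The blocks generate the algebra\<close>

text \<open>
  The substitute, modulo the ideal, for a corner that cannot be split.
\<close>

definition indecomposable :: "'a::cstar_algebra \<Rightarrow> bool"
  where "indecomposable g \<longleftrightarrow> (\<forall>u\<in>unit_domain g. \<forall>v\<in>unit_domain g. star u = u \<longrightarrow> star v = v \<longrightarrow> u * v = 0 \<longrightarrow>
      u \<in> block_ideal \<or> v \<in> block_ideal)"

context
  assumes dd: "double_dagger TYPE('a::cstar_algebra)"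
begin

lemmas ideal_add = block_ideal_add[OF dd]
lemmas ideal_diff = block_ideal_diff[OF dd]
lemmas ideal_left = block_ideal_mult_left[OF dd]
lemmas ideal_right = block_ideal_mult_right[OF dd]
lemmas ideal_scaleR = block_ideal_scaleR[OF dd]
lemmas ideal_scaleC = block_ideal_scaleC[OF dd]
lemmas ideal_limit = block_ideal_limit[OF dd]

lemma ideal_congruent: "(x::'a) - y \<in> block_ideal \<Longrightarrow> x \<in> block_ideal \<longleftrightarrow> y \<in> block_ideal"
proof
  assume d: "x - y \<in> block_ideal"
  show "y \<in> block_ideal" if "x \<in> block_ideal" using ideal_diff[OF that d] by simp
  show "x \<in> block_ideal" if "y \<in> block_ideal" using ideal_add[OF d that] by simp
qed

lemma plateau_outside_ideal:
  assumes k: "star k = (k::'a)" "k \<notin> block_ideal"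
  shows "\<exists>\<delta>>0. norm (fc k (plateau \<delta>)) = 1 \<and> fc k (soft \<delta>) \<in> unit_domain (fc k (plateau \<delta>))
    \<and> fc k (soft \<delta>) \<notin> block_ideal"
proof -
  have "\<exists>\<delta>>0. fc k (soft \<delta>) \<notin> block_ideal"
  proof (rule ccontr)
    assume none: "\<not> ?thesis"
    have "k \<in> block_ideal"
    proof (rule ideal_limit)
      fix e :: real assume e: "e > 0"
      have "k - fc k (soft e) = fc k (\<lambda>t. t - soft e t)"
        using fc_diff[OF k(1) cont0_simps(1) cont0_soft_plateau(1)[OF e]] fc_id[OF k(1)] by simp
      moreover have "norm (fc k (\<lambda>t. t - soft e t)) \<le> e"
        by (rule norm_fc_le[OF k(1) cont0_simps(3)[OF cont0_simps(1) cont0_soft_plateau(1)[OF e]]])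
           (use e in \<open>auto simp: soft_def\<close>)
      ultimately show "\<exists>y\<in>block_ideal. norm (k - y) \<le> e" using none e by metis
    qed
    with k(2) show False ..
  qed
  then obtain \<delta> where \<delta>: "\<delta> > 0" "fc k (soft \<delta>) \<notin> block_ideal" by blast
  note c = cont0_soft_plateau(1,2)[OF \<delta>(1)]
  define g f where "g = fc k (plateau \<delta>)" and "f = fc k (soft \<delta>)"
  have sp: "(\<lambda>t. plateau \<delta> t * soft \<delta> t) = soft \<delta>" "(\<lambda>t. soft \<delta> t * plateau \<delta> t) = soft \<delta>"
    using cont0_soft_plateau(3)[OF \<delta>(1)] by (auto simp: mult.commute)
  have gf: "g * f = f" "f * g = f"
    unfolding g_def f_def fc_mult[OF k(1) c(2,1), symmetric] fc_mult[OF k(1) c, symmetric] sp by simp_all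
  have "norm g \<le> 1"
    unfolding g_def by (rule norm_fc_le[OF k(1) c(2)]) (use \<delta>(1) in \<open>auto simp: plateau_def min_def\<close>)
  moreover have "f \<noteq> 0" using \<delta>(2) block_ideal_0[OF dd] by (auto simp: f_def)
  then have "1 \<le> norm g" using norm_mult_ineq[of g f] gf(1) by simp
  ultimately have "norm g = 1" by simp
  with \<delta> gf show ?thesis by (intro exI[of _ \<delta>]) (auto simp: unit_domain_def g_def f_def)
qed

text \<open>
  If every unit domain outside the ideal contained two orthogonal self-adjoint elements outside the
  ideal, their plateau functions would be two orthogonal local units of the same kind, and iterating
  this would produce a dyadic tree.
\<close>

lemma indecomposable_unit_domain:
  assumes h: "star h = (h::'a)" "h \<notin> block_ideal"
  shows "\<exists>g::'a. star g = g \<and> (\<exists>x\<in>unit_domain g. star x = x \<and> x \<notin> block_ideal) \<and> indecomposable g"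
proof (rule ccontr)
  assume none: "\<not> ?thesis"
  define node :: "'a \<Rightarrow> bool" where "node g \<longleftrightarrow> star g = g \<and> norm g = 1 \<and> (\<exists>x\<in>unit_domain g. star x = x \<and> x \<notin> block_ideal)" for g
  have node_fc: "\<exists>\<delta>>0. node (fc k (plateau \<delta>))" if k: "star k = k" "k \<notin> block_ideal" for k :: 'a
  proof -
    obtain \<delta> where \<delta>: "\<delta> > 0" "norm (fc k (plateau \<delta>)) = 1" "fc k (soft \<delta>) \<in> unit_domain (fc k (plateau \<delta>))"
      "fc k (soft \<delta>) \<notin> block_ideal" using plateau_outside_ideal[OF k] by blast
    then show ?thesis
      unfolding node_def using star_fc[OF k(1)] cont0_soft_plateau(1,2)[OF \<delta>(1)] by blast
  qed
  have split: "\<exists>g0 g1. node g0 \<and> node g1 \<and> g * g0 = g0 \<and> g * g1 = g1 \<and> g1 * g0 = 0" if g: "node g" for g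
  proof -
    have "\<not> indecomposable g"
      using none g unfolding node_def by blast
    then obtain u v where uv: "u \<in> unit_domain g" "v \<in> unit_domain g" "star u = u" "star v = v"
      "u * v = 0" "u \<notin> block_ideal" "v \<notin> block_ideal"
      unfolding indecomposable_def by blast
    obtain \<delta> where \<delta>: "\<delta> > 0" "node (fc u (plateau \<delta>))" using node_fc[OF uv(3,6)] by blast
    obtain \<delta>' where \<delta>': "\<delta>' > 0" "node (fc v (plateau \<delta>'))" using node_fc[OF uv(4,7)] by blast
    note c = cont0_soft_plateau(2)[OF \<delta>(1)] cont0_soft_plateau(2)[OF \<delta>'(1)]
    have "fc u (plateau \<delta>) \<in> unit_domain g" "fc v (plateau \<delta>') \<in> unit_domain g"
      by (rule fc_unit_domain; fact uv c)+
    moreover have "fc u (plateau \<delta>) * fc v (plateau \<delta>') = 0"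
      by (rule fc_orthogonal[OF uv(3) c(1) uv(4) c(2) uv(5)])
    ultimately show ?thesis using \<delta>(2) \<delta>'(2) unfolding unit_domain_def by blast
  qed
  then obtain c0 c1 where c: "\<And>g. node g \<Longrightarrow> node (c0 g) \<and> node (c1 g) \<and> g * c0 g = c0 g \<and> g * c1 g = c1 g \<and> c1 g * c0 g = 0"
    by metis
  obtain \<delta> where root: "node (fc h (plateau \<delta>))" using node_fc[OF h] by blast
  define a where "a s = foldr (\<lambda>b g. if b then c1 g else c0 g) s (fc h (plateau \<delta>))" for s
  have a: "node (a s)" for s
    by (induction s) (simp_all add: a_def root c)
  show False
  proof (rule no_dyadic_tree[OF dd, of a])
    show "star (a s) = a s" "norm (a s) = 1" for s using a[of s] by (simp_all add: node_def)
    show "a s * a (b # s) = a (b # s)" for b s using c[OF a[of s]] by (simp add: a_def)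
    show "a (True # s) * a (False # s) = 0" for s using c[OF a[of s]] by (simp add: a_def)
  qed
qed

text \<open>
  Modulo the ideal, an element of an indecomposable unit domain has at most one spectral value other
  than 0. For u(x) with \<open>u \<ge> 0\<close> that value is the supremum l of the t for which the positive part of
  u - t, at x, is outside the ideal: the positive part of u - l gives an element of the ideal as a
  limit, and so does u times the positive part of l - u, because for t < t' the functions
  u max(0, t - u) and max(0, u - t') have disjoint supports.
\<close>

lemma ideal_one_point_spectrum:
  assumes g: "star g = (g::'a)"
    and indec: "indecomposable g"
    and x: "x \<in> unit_domain g" "star x = x" and u: "cont0 u" "\<And>t. 0 \<le> u t"
  shows "fc x u \<in> block_ideal \<or> (\<exists>l>0. fc x u * fc x u - l *\<^sub>R fc x u \<in> block_ideal)"
proof -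
  obtain K where K: "K > 0" "\<And>t. \<bar>t\<bar> \<le> norm x \<Longrightarrow> u t \<le> K"
  proof -
    obtain K where "K > 0" "\<forall>y\<in>u ` {- norm x..norm x}. norm y \<le> K"
      using cont0_bounded[OF u(1)] bounded_pos by blast
    then show thesis by (intro that[of K]) (auto simp: abs_le_iff)
  qed
  define up where "up t s = max 0 (u s - t)" for t s
  have up: "cont0 (up t)" if "0 \<le> t" for t
    using u(1) that unfolding up_def[abs_def] cont0_def by (auto intro!: continuous_intros)
  have up_close: "norm (fc x (up t) - fc x (up t')) \<le> e" if "0 \<le> t" "0 \<le> t'" "\<bar>t - t'\<bar> \<le> e" for t t' e
  proof -
    have "norm (fc x (\<lambda>s. up t s - up t' s)) \<le> e"
      by (rule norm_fc_le[OF x(2) cont0_simps(3)[OF up up]]) (use that in \<open>auto simp: up_def\<close>)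
    then show ?thesis using that by (simp add: fc_diff[OF x(2) up up])
  qed
  have up0: "up 0 = u" using u(2) by (auto simp: up_def)
  define T where "T = {t. t > 0 \<and> fc x (up t) \<notin> block_ideal}"
  show ?thesis
  proof (cases "T = {}")
    case True
    have "fc x (up 0) \<in> block_ideal"
    proof (rule ideal_limit)
      fix e :: real assume "e > 0"
      then show "\<exists>y\<in>block_ideal. norm (fc x (up 0) - y) \<le> e"
        using True up_close[of 0 e e] by (intro bexI[of _ "fc x (up e)"]) (auto simp: T_def)
    qed
    then show ?thesis by (simp add: up0)
  next
    case False
    have TK: "t \<le> K" if "t \<in> T" for t
    proof (rule ccontr)
      assume "\<not> t \<le> K"
      then have t: "K < t" "0 \<le> t" using K(1) by auto
      have "up t s = 0" if "\<bar>s\<bar> \<le> norm x" for s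
        using K(2)[OF that] t(1) by (simp add: up_def)
      then have "norm (fc x (up t)) \<le> 0"
        by (intro norm_fc_le[OF x(2) up[OF t(2)]]) simp_all
      then have "fc x (up t) = 0" by simp
      with that show False by (simp add: T_def block_ideal_0[OF dd])
    qed
    then have bdd: "bdd_above T" by (rule bdd_aboveI)
    define l where "l = Sup T"
    have l: "l > 0"
    proof -
      obtain t where "t \<in> T" using False by blast
      then show ?thesis using cSup_upper[OF _ bdd, of t] by (simp add: l_def T_def)
    qed
    have above: "fc x (up l) \<in> block_ideal"
    proof (rule ideal_limit)
      fix e :: real assume "e > 0"
      have "l + e \<notin> T" using cSup_upper[OF _ bdd, of "l + e"] \<open>e > 0\<close> by (auto simp: l_def)
      then have "fc x (up (l + e)) \<in> block_ideal" using l \<open>e > 0\<close> by (auto simp: T_def)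
      then show "\<exists>y\<in>block_ideal. norm (fc x (up l) - y) \<le> e"
        using up_close[of l "l + e" e] l \<open>e > 0\<close> by (intro bexI) auto
    qed
    define dn where "dn t s = u s * max 0 (t - u s)" for t s
    have dn: "cont0 (dn t)" for t
      using u(1) unfolding dn_def[abs_def] cont0_def by (auto intro!: continuous_intros)
    have dn_mem: "fc x (dn t) \<in> block_ideal" if t: "0 < t" "t < l" for t
    proof -
      obtain t' where t': "t' \<in> T" "t < t'"
        using less_cSup_iff[OF False bdd, of t] t by (auto simp: l_def)
      then have "0 \<le> t'" using t by simp
      have "(\<lambda>s. dn t s * up t' s) = (\<lambda>s. 0 * s)"
        using t'(2) by (auto simp: dn_def up_def max_def)
      then have "fc x (dn t) * fc x (up t') = 0"
        using fc_mult[OF x(2) dn up[OF \<open>0 \<le> t'\<close>], of t] fc_scaleR[OF x(2) cont0_simps(1), of 0] by simp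
      moreover have "fc x (dn t) \<in> unit_domain g" "fc x (up t') \<in> unit_domain g"
        by (rule fc_unit_domain[OF x(2) dn x(1)], rule fc_unit_domain[OF x(2) up[OF \<open>0 \<le> t'\<close>] x(1)])
      ultimately have "fc x (dn t) \<in> block_ideal \<or> fc x (up t') \<in> block_ideal"
        using indec star_fc[OF x(2) dn] star_fc[OF x(2) up[OF \<open>0 \<le> t'\<close>]]
        by (simp add: indecomposable_def)
      then show ?thesis using t'(1) by (simp add: T_def)
    qed
    have below: "fc x (dn l) \<in> block_ideal"
    proof (rule ideal_limit)
      fix e :: real assume e: "e > 0"
      define t where "t = max (l / 2) (l - e / K)"
      have "0 < e / K" using e K(1) by simp
      then have t: "0 < t" "t < l" "l - t \<le> e / K" using l by (auto simp: t_def)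
      have "norm (fc x (\<lambda>s. dn l s - dn t s)) \<le> e"
      proof (rule norm_fc_le[OF x(2) cont0_simps(3)[OF dn dn]])
        fix s assume s: "\<bar>s\<bar> \<le> norm x"
        have "\<bar>dn l s - dn t s\<bar> = u s * \<bar>max 0 (l - u s) - max 0 (t - u s)\<bar>"
          using u(2)[of s] by (simp add: dn_def right_diff_distrib[symmetric] abs_mult)
        also have "\<dots> \<le> K * (e / K)"
          by (intro mult_mono K(2)[OF s]) (use t K(1) in auto)
        finally show "\<bar>dn l s - dn t s\<bar> \<le> e" using K(1) by simp
      qed (use e in simp)
      then show "\<exists>y\<in>block_ideal. norm (fc x (dn l) - y) \<le> e"
        using dn_mem[OF t(1,2)] by (intro bexI[of _ "fc x (dn t)"]) (simp_all add: fc_diff[OF x(2) dn dn])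
    qed
    have upl: "cont0 (up l)" using up l by simp
    have "(\<lambda>s. u s * u s - l * u s) = (\<lambda>s. u s * up l s - dn l s)"
      by (auto simp: up_def dn_def max_def algebra_simps)
    then have "fc x (\<lambda>s. u s * u s - l * u s) = fc x (\<lambda>s. u s * up l s - dn l s)" by simp
    then have "fc x u * fc x u - l *\<^sub>R fc x u = fc x u * fc x (up l) - fc x (dn l)"
      using u(1) upl dn[of l] by (simp add: fc_diff[OF x(2)] fc_mult[OF x(2)] fc_scaleR[OF x(2)])
    then show ?thesis using ideal_diff[OF ideal_left[OF above] below] l by metis
  qed
qed

lemma ideal_quadratic:
  assumes g: "star g = (g::'a)"
    and indec: "indecomposable g"
    and x: "x \<in> unit_domain g" "star x = x"
  shows "x \<in> block_ideal \<or> (\<exists>l. l \<noteq> 0 \<and> x * x - l *\<^sub>R x \<in> block_ideal)"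
proof -
  define a b where "a = fc x (\<lambda>t. max 0 t)" and "b = fc x (\<lambda>t. max 0 (- t))"
  have c: "cont0 (\<lambda>t. max 0 t)" "cont0 (\<lambda>t. max 0 (- t))"
    by (auto simp: cont0_def intro!: continuous_intros)
  have "(\<lambda>t. max 0 t - max 0 (- t)) = (\<lambda>t::real. t)" by auto
  then have xab: "x = a - b"
    unfolding a_def b_def fc_diff[OF x(2) c, symmetric] by (simp add: fc_id[OF x(2)])
  have "(\<lambda>t. max 0 t * max 0 (- t)) = (\<lambda>t::real. 0 * t)" "(\<lambda>t. max 0 (- t) * max 0 t) = (\<lambda>t::real. 0 * t)"
    by (auto simp: max_def)
  then have ab: "a * b = 0" "b * a = 0"
    unfolding a_def b_def fc_mult[OF x(2) c, symmetric] fc_mult[OF x(2) c(2,1), symmetric]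
    using fc_scaleR[OF x(2) cont0_simps(1), of 0] by simp_all
  have xx: "x * x = a * a + b * b" by (simp add: xab ab left_diff_distrib right_diff_distrib)
  have indec': "u \<in> block_ideal \<or> v \<in> block_ideal"
    if "u \<in> unit_domain g" "v \<in> unit_domain g" "star u = u" "star v = v" "u * v = 0" for u v
    using indec that by (simp add: indecomposable_def)
  have "a \<in> unit_domain g" "b \<in> unit_domain g" "star a = a" "star b = b"
    unfolding a_def b_def by (rule fc_unit_domain[OF x(2) _ x(1)] star_fc[OF x(2)], rule c)+
  from indec'[OF this ab(1)] show ?thesis
  proof
    assume b: "a \<in> block_ideal"
    consider "b \<in> block_ideal" | l where "l > 0" "b * b - l *\<^sub>R b \<in> block_ideal"
      using ideal_one_point_spectrum[OF g indec x c(2)] unfolding b_def by fastforce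
    then show ?thesis
    proof cases
      case 1
      then show ?thesis using ideal_diff[OF b] by (simp add: xab)
    next
      case 2
      have "x * x - (- l) *\<^sub>R x = (b * b - l *\<^sub>R b) + (a * a + l *\<^sub>R a)"
        unfolding xx by (subst xab) (simp add: algebra_simps)
      moreover have "\<dots> \<in> block_ideal"
        by (rule ideal_add[OF 2(2) ideal_add[OF ideal_left[OF b] ideal_scaleR[OF b]]])
      ultimately have "x * x - (- l) *\<^sub>R x \<in> block_ideal" by (simp only:)
      then show ?thesis using 2(1) by (intro disjI2 exI[of _ "- l"]) simp
    qed
  next
    assume b: "b \<in> block_ideal"
    consider "a \<in> block_ideal" | l where "l > 0" "a * a - l *\<^sub>R a \<in> block_ideal"
      using ideal_one_point_spectrum[OF g indec x c(1)] unfolding a_def by fastforce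
    then show ?thesis
    proof cases
      case 1
      then show ?thesis using ideal_diff[OF _ b] by (simp add: xab)
    next
      case 2
      have "x * x - l *\<^sub>R x = (a * a - l *\<^sub>R a) + (b * b + l *\<^sub>R b)"
        unfolding xx by (subst xab) (simp add: algebra_simps)
      moreover have "\<dots> \<in> block_ideal"
        by (rule ideal_add[OF 2(2) ideal_add[OF ideal_left[OF b] ideal_scaleR[OF b]]])
      ultimately have "x * x - l *\<^sub>R x \<in> block_ideal" by (simp only:)
      then show ?thesis using 2(1) by (intro disjI2 exI[of _ l]) simp
    qed
  qed
qed

text \<open>
  Let q and e be idempotent, and let q + e and q - e satisfy quadratic equations with coefficients
  \<open>\<alpha>\<close> and \<open>\<beta> \<noteq> 0\<close>, all modulo the ideal. Adding these equations gives
  (2 - \<open>\<alpha>\<close> - \<open>\<beta>\<close>) q + (2 - \<open>\<alpha>\<close> + \<open>\<beta>\<close>) e = 0 modulo the ideal, so e is a multiple of q.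
\<close>

lemma ideal_multiple_of_idempotent:
  assumes g: "star g = (g::'a)" "indecomposable g"
    and q: "q \<in> unit_domain g" "star q = q" "q * q - q \<in> block_ideal" "q \<notin> block_ideal"
    and x: "x \<in> unit_domain g" "star x = x"
  shows "\<exists>c. x - c *\<^sub>R q \<in> block_ideal"
proof -
  note quad = ideal_quadratic[OF g]
  from quad[OF x] show ?thesis
  proof
    assume "x \<in> block_ideal"
    then show ?thesis by (intro exI[of _ 0]) simp
  next
    assume "\<exists>l. l \<noteq> 0 \<and> x * x - l *\<^sub>R x \<in> block_ideal"
    then obtain l where l: "l \<noteq> 0" "x * x - l *\<^sub>R x \<in> block_ideal" by blast
    define e where "e = (1 / l) *\<^sub>R x"
    have xe: "x = l *\<^sub>R e" using l(1) by (simp add: e_def)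
    have e: "e \<in> unit_domain g" "star e = e"
      unfolding e_def using x by (auto simp: unit_domain_algebra star_scaleR)
    have "e * e - e = (1 / (l * l)) *\<^sub>R (x * x - l *\<^sub>R x)"
      using l(1) by (simp add: e_def scaleR_diff_right)
    then have ee: "e * e - e \<in> block_ideal" using ideal_scaleR[OF l(2)] by simp
    have "\<exists>c. e - c *\<^sub>R q \<in> block_ideal"
    proof (cases "q - e \<in> block_ideal")
      case True
      then show ?thesis using ideal_scaleR[OF True, of "-1"] by (intro exI[of _ 1]) simp
    next
      case False
      have qe: "q + e \<in> unit_domain g" "q - e \<in> unit_domain g" "star (q + e) = q + e" "star (q - e) = q - e"
        using q e by (auto simp: unit_domain_algebra unit_domain_diff star_add star_diff)
      obtain \<beta> where \<beta>: "\<beta> \<noteq> 0" "(q - e) * (q - e) - \<beta> *\<^sub>R (q - e) \<in> block_ideal"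
        using quad[OF qe(2,4)] False by blast
      have "q + e \<notin> block_ideal"
      proof
        assume s: "q + e \<in> block_ideal"
        have "q - e = (q + e) * q - e * (q + e) - (q * q - q) + (e * e - e)"
          by (simp add: algebra_simps)
        also have "\<dots> \<in> block_ideal"
          by (intro ideal_add ideal_diff ideal_left[OF s] ideal_right[OF s] q(3) ee)
        finally show False using False by simp
      qed
      then obtain \<alpha> where \<alpha>: "(q + e) * (q + e) - \<alpha> *\<^sub>R (q + e) \<in> block_ideal"
        using quad[OF qe(1,3)] by blast
      define A where "A = 2 - \<alpha> - \<beta>"
      define B where "B = 2 - \<alpha> + \<beta>"
      have "A *\<^sub>R q + B *\<^sub>R e = ((q + e) * (q + e) - \<alpha> *\<^sub>R (q + e)) + ((q - e) * (q - e) - \<beta> *\<^sub>R (q - e))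
          - 2 *\<^sub>R (q * q - q) - 2 *\<^sub>R (e * e - e)"
        by (simp add: A_def B_def algebra_simps scaleR_2)
      also have "\<dots> \<in> block_ideal"
        by (intro ideal_add ideal_diff ideal_scaleR \<alpha> \<beta>(2) q(3) ee)
      finally have AB: "A *\<^sub>R q + B *\<^sub>R e \<in> block_ideal" .
      have "B \<noteq> 0"
      proof
        assume "B = 0"
        then have "A \<noteq> 0" using \<beta>(1) by (simp add: A_def B_def)
        then have "q = (1 / A) *\<^sub>R (A *\<^sub>R q + B *\<^sub>R e)" using \<open>B = 0\<close> by simp
        then show False using ideal_scaleR[OF AB, of "1 / A"] q(4) by simp
      qed
      then have "e - (- A / B) *\<^sub>R q = (1 / B) *\<^sub>R (A *\<^sub>R q + B *\<^sub>R e)"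
        by (simp add: scaleR_add_right)
      then show ?thesis using ideal_scaleR[OF AB, of "1 / B"] by metis
    qed
    then obtain c where "e - c *\<^sub>R q \<in> block_ideal" by blast
    then have "l *\<^sub>R (e - c *\<^sub>R q) \<in> block_ideal" by (rule ideal_scaleR)
    then show ?thesis by (intro exI[of _ "l * c"]) (simp add: xe scaleR_diff_right)
  qed
qed

lemma minimal_modulo_ideal:
  assumes h: "star h = (h::'a)" "h \<notin> block_ideal"
  shows "\<exists>q::'a. star q = q \<and> q * q - q \<in> block_ideal \<and> q \<notin> block_ideal \<and>
    (\<forall>x. \<exists>c. q * x * q - c *\<^sub>C q \<in> block_ideal)"
proof -
  obtain g x0 :: 'a where g: "star g = g" "indecomposable g"
    and x0: "x0 \<in> unit_domain g" "star x0 = x0" "x0 \<notin> block_ideal"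
    using indecomposable_unit_domain[OF h] by blast
  obtain l where l: "l \<noteq> 0" "x0 * x0 - l *\<^sub>R x0 \<in> block_ideal"
    using ideal_quadratic[OF g x0(1,2)] x0(3) by blast
  define q where "q = (1 / l) *\<^sub>R x0"
  have q: "q \<in> unit_domain g" "star q = q"
    unfolding q_def using x0 by (auto simp: unit_domain_algebra star_scaleR)
  have "q * q - q = (1 / (l * l)) *\<^sub>R (x0 * x0 - l *\<^sub>R x0)"
    using l(1) by (simp add: q_def scaleR_diff_right)
  then have qq: "q * q - q \<in> block_ideal" using ideal_scaleR[OF l(2)] by simp
  have qn: "q \<notin> block_ideal"
  proof
    assume "q \<in> block_ideal"
    then have "l *\<^sub>R q \<in> block_ideal" by (rule ideal_scaleR)
    then show False using x0(3) l(1) by (simp add: q_def)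
  qed
  note mult = ideal_multiple_of_idempotent[OF g q qq qn]
  have "\<exists>c. q * x * q - c *\<^sub>C q \<in> block_ideal" for x
  proof -
    define y where "y = q * x * q"
    have "g * y = y" "y * g = y"
      using q(1) by (auto simp: y_def unit_domain_def mult.assoc) (simp add: mult.assoc[symmetric])
    then have y: "y \<in> unit_domain g" by (simp add: unit_domain_def)
    have sy: "star y \<in> unit_domain g" by (rule unit_domain_star[OF g(1) y])
    have re: "y + star y \<in> unit_domain g" "star (y + star y) = y + star y"
      using y sy by (simp_all add: unit_domain_algebra star_add star_star add.commute)
    have im: "\<i> *\<^sub>C (y - star y) \<in> unit_domain g" "star (\<i> *\<^sub>C (y - star y)) = \<i> *\<^sub>C (y - star y)"
      using y sy by (simp_all add: unit_domain_algebra unit_domain_diff star_scaleC star_diff star_star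
          complex_vector.scale_right_diff_distrib)
    obtain r where r: "(y + star y) - r *\<^sub>R q \<in> block_ideal" using mult[OF re] by blast
    obtain s where s: "\<i> *\<^sub>C (y - star y) - s *\<^sub>R q \<in> block_ideal" using mult[OF im] by blast
    define c where "c = (of_real r - \<i> * of_real s) / 2"
    have "y - c *\<^sub>C q = (1/2) *\<^sub>C ((y + star y) - r *\<^sub>R q) + (- \<i> / 2) *\<^sub>C (\<i> *\<^sub>C (y - star y) - s *\<^sub>R q)"
    proof -
      have half: "(1/2) *\<^sub>C u + (1/2) *\<^sub>C u = u" for u :: 'a
        by (simp add: scaleC_add_left[symmetric] scaleC_one)
      have "(1/2) *\<^sub>C ((y + star y) - r *\<^sub>R q) + (- \<i> / 2) *\<^sub>C (\<i> *\<^sub>C (y - star y) - s *\<^sub>R q)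
        = ((1/2) *\<^sub>C y + (1/2) *\<^sub>C y) - ((1/2) *\<^sub>C of_real r *\<^sub>C q + (- \<i> / 2) *\<^sub>C of_real s *\<^sub>C q)"
        by (simp add: scaleR_scaleC complex_vector.scale_right_diff_distrib scaleC_add_right scaleC_scaleC algebra_simps)
      also have "(1/2) *\<^sub>C of_real r *\<^sub>C q + (- \<i> / 2) *\<^sub>C of_real s *\<^sub>C q = c *\<^sub>C q"
      proof -
        have "c = 1/2 * of_real r + (- \<i> / 2) * of_real s" by (simp add: c_def diff_divide_distrib)
        then show ?thesis by (simp only: scaleC_scaleC scaleC_add_left)
      qed
      finally show ?thesis by (simp add: half)
    qed
    also have "\<dots> \<in> block_ideal" by (intro ideal_add ideal_scaleC r s)
    finally show ?thesis unfolding y_def by blast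
  qed
  with q qq qn show ?thesis by blast
qed

text \<open>
  An idempotent q modulo the ideal is cut down by finitely many blocks until q^2 - q has small norm;
  then the spectrum of q is close to 0 and 1, and a function of q is a projection.
\<close>

lemma minimal_projection_modulo_ideal:
  assumes h: "star h = (h::'a)" "h \<notin> block_ideal"
  shows "\<exists>e::'a. star e = e \<and> e * e = e \<and> e \<notin> block_ideal \<and> (\<forall>x. \<exists>c. e * x * e - c *\<^sub>C e \<in> block_ideal)"
proof -
  obtain q0 :: 'a where q0: "star q0 = q0" "q0 * q0 - q0 \<in> block_ideal" "q0 \<notin> block_ideal"
    "\<And>x. \<exists>c. q0 * x * q0 - c *\<^sub>C q0 \<in> block_ideal"
    using minimal_modulo_ideal[OF h] by blast
  \<comment> \<open>On the interval from 1/4 to 3/4 one has t - t^2 \<ge> 3/16, so this bound leaves a spectral gap there.\<close>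
  have "(3::real) / 16 > 0" by simp
  with q0(2) obtain F where F: "finite F" "F \<subseteq> blocks"
    and small: "norm ((q0 * q0 - q0) - (q0 * q0 - q0) * \<Sum>F) < 3 / 16"
    unfolding block_ideal_def by blast
  define z where "z = \<Sum>F"
  have z: "z * x = x * z" "star z = z" "z * z = z" for x
    unfolding z_def
    by (rule block_sum_props(1)[OF dd F], rule block_sum_props(2)[OF dd F], rule block_sum_props(4)[OF dd F F order.refl])
  define q where "q = q0 - q0 * z"
  have sq: "star q = q" by (simp add: q_def star_diff star_mult z(2) z(1)[of q0] q0(1))
  have qq: "q * q - q = (q0 * q0 - q0) - (q0 * q0 - q0) * z"
  proof -
    have "q0 * z * (q0 * z) = q0 * q0 * z" "q0 * z * q0 = q0 * q0 * z"
      by (metis mult.assoc z(1) z(3)) (metis mult.assoc z(1))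
    then show ?thesis by (simp add: q_def left_diff_distrib right_diff_distrib mult.assoc[symmetric])
  qed
  have qqI: "q * q - q \<in> block_ideal"
    unfolding qq by (intro ideal_diff ideal_right q0(2))
  have q0q: "q0 - q \<in> block_ideal"
    unfolding q_def z_def using mult_block_sum_in_ideal[OF dd F, of q0] by simp
  have qn: "q \<notin> block_ideal" using ideal_congruent[OF q0q] q0(3) by blast
  have cq: "\<exists>c. q * x * q - c *\<^sub>C q \<in> block_ideal" for x
  proof -
    obtain c where c: "q0 * x * q0 - c *\<^sub>C q0 \<in> block_ideal" using q0(4) by blast
    have "q * x * q - c *\<^sub>C q = (q0 * x * q0 - c *\<^sub>C q0) - (q0 - q) * (x * q0) - q * x * (q0 - q) + c *\<^sub>C (q0 - q)"
      by (simp add: algebra_simps mult.assoc complex_vector.scale_right_diff_distrib)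
    also have "\<dots> \<in> block_ideal"
      by (intro ideal_add ideal_diff ideal_left ideal_right ideal_scaleC c q0q)
    finally show ?thesis by blast
  qed
  define cut where "cut t = max 0 (min 1 (2 * t - 1/2))" for t :: real
  \<comment> \<open>The maximum and the minimum in the denominators act only where the numerators vanish; thus m = cut t / t and (t^2 - t) (v t - 1) = t - t cut t.\<close>
  define m where "m t = cut t / max t (1/4)" for t :: real
  define v where "v t = (1 - cut t) / (min t (3/4) - 1) + 1" for t :: real
  have ne: "max t (1/4) \<noteq> 0" "min t (3/4) - 1 \<noteq> 0" for t :: real
    by (auto simp: max_def min_def)
  have cut: "cont0 cut" unfolding cut_def[abs_def] cont0_def by (auto intro!: continuous_intros)
  have m: "cont0 m" using cut unfolding m_def[abs_def] cont0_def by (auto intro!: continuous_intros simp: ne)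
  have v: "cont0 v" using cut unfolding v_def[abs_def] cont0_def by (auto intro!: continuous_intros simp: ne)
  have id: "cont0 (\<lambda>t. t)" by simp
  note fc = fc_mult[OF sq] fc_diff[OF sq] fc_id[OF sq]
  have sqf: "fc q (\<lambda>t. t * t - t) = q * q - q"
    by (simp add: fc)
  define e b where "e = fc q cut" and "b = fc q m"
  have "fc q (\<lambda>t. cut t * cut t - cut t) = 0"
  proof (rule fc_eq_0_of_gap[OF sq, of "\<lambda>t. t * t - t" _ "3/16"])
    show "norm (fc q (\<lambda>t. t * t - t)) < 3 / 16" unfolding sqf qq using small by (simp add: z_def)
    fix t :: real assume t: "\<bar>t * t - t\<bar> < 3 / 16"
    have "t \<le> 1/4 \<or> 3/4 \<le> t"
    proof (rule ccontr)
      assume "\<not> ?thesis"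
      then have "0 < (t - 1/4) * (3/4 - t)" by simp
      also have "\<dots> = t - t * t - 3/16" by (simp add: field_simps)
      finally have "3/16 < t - t * t" by simp
      with t show False by linarith
    qed
    then have "cut t = 0 \<or> cut t = 1" by (auto simp: cut_def)
    then show "cut t * cut t - cut t = 0" by auto
  qed (use cut in simp_all)
  then have ee: "e * e = e" by (simp add: fc cut e_def)
  have se: "star e = e" unfolding e_def by (rule star_fc[OF sq cut])
  have "(\<lambda>t. t * m t) = cut" "(\<lambda>t. m t * t) = cut" by (auto simp: m_def cut_def max_def min_def)
  then have qb: "q * b = e" "b * q = e"
    unfolding b_def e_def using fc_mult[OF sq id m] fc_mult[OF sq m id] fc_id[OF sq] by simp_all
  have en: "e \<notin> block_ideal"
  proof
    assume "e \<in> block_ideal"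
    have "(\<lambda>t. t - t * cut t) = (\<lambda>t. (t * t - t) * v t - (t * t - t))"
    proof
      fix t :: real
      have "(t * t - t) * (v t - 1) = t - t * cut t"
      proof (cases "t \<ge> 3/4")
        case True
        then show ?thesis by (simp add: v_def cut_def)
      next
        case False
        then have "v t - 1 = (1 - cut t) / (t - 1)" "t - 1 \<noteq> 0" by (simp_all add: v_def min_def)
        moreover have "t * t - t = t * (t - 1)" by (simp add: algebra_simps)
        ultimately have "(t * t - t) * (v t - 1) = t * (1 - cut t)" by simp
        then show ?thesis by (simp add: right_diff_distrib)
      qed
      then show "t - t * cut t = (t * t - t) * v t - (t * t - t)" by (simp add: algebra_simps)
    qed
    then have "q - q * e = (q * q - q) * fc q v - (q * q - q)"
      using fc_diff[OF sq id cont0_simps(5)[OF id cut]] fc_mult[OF sq id cut]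
        fc_diff[OF sq cont0_simps(5)[OF cont0_simps(3)[OF cont0_simps(5)[OF id id] id] v] cont0_simps(3)[OF cont0_simps(5)[OF id id] id]]
        fc_mult[OF sq cont0_simps(3)[OF cont0_simps(5)[OF id id] id] v]
      by (simp add: sqf e_def fc_id[OF sq])
    also have "\<dots> \<in> block_ideal" by (intro ideal_diff ideal_right qqI)
    finally have "q - q * e \<in> block_ideal" .
    moreover have "q * e \<in> block_ideal" by (rule ideal_left[OF \<open>e \<in> block_ideal\<close>])
    ultimately have "(q - q * e) + q * e \<in> block_ideal" by (rule ideal_add)
    then show False using qn by simp
  qed
  have "\<exists>c. e * x * e - c *\<^sub>C e \<in> block_ideal" for x
  proof -
    obtain c where c: "q * x * q - c *\<^sub>C q \<in> block_ideal" using cq by blast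
    have exe: "e * x * e = b * (q * x * q) * b" by (metis qb mult.assoc)
    have e': "e = b * (q * q) * b" using ee by (metis qb mult.assoc)
    have "e * x * e - c *\<^sub>C e = b * (q * x * q - c *\<^sub>C q) * b - c *\<^sub>C (b * (q * q - q) * b)"
      by (subst (3) e') (simp add: exe left_diff_distrib right_diff_distrib mult_scaleC_left mult_scaleC_right
          complex_vector.scale_right_diff_distrib)
    also have "\<dots> \<in> block_ideal"
      by (intro ideal_diff ideal_scaleC ideal_right ideal_left c qqI)
    finally show ?thesis by blast
  qed
  with se ee en show ?thesis by blast
qed

end

definition block_proj :: "'a::cstar_algebra \<Rightarrow> 'a"
  where "block_proj z = (SOME p. min_proj p \<and> central_support p = z)"

lemma block_proj:
  assumes "z \<in> blocks"
  shows "min_proj (block_proj z)" "central_support (block_proj z) = z"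
proof -
  have "\<exists>p. min_proj p \<and> central_support p = z" using assms by (auto simp: blocks_def)
  from someI_ex[OF this] show "min_proj (block_proj z)" "central_support (block_proj z) = z"
    by (simp_all add: block_proj_def)
qed

text \<open>
  If the ideal were proper there would be a projection e outside it with e x e = \<open>\<phi>\<close>(x) e modulo the
  ideal. Infinitely many blocks meet e, since otherwise removing them from e would leave a minimal
  projection outside the ideal. Unit vectors \<open>\<xi>\<close>(n) = e \<open>\<xi>\<close>(n) in distinct blocks define vector
  functionals that attain norm one at e, are separated by the blocks, and converge to \<open>\<phi>\<close> because
  they tend to 0 on the ideal. But \<open>\<phi>\<close> attains the norm one.
\<close>

theorem block_ideal_eq_UNIV:
  assumes dd: "double_dagger TYPE('a::cstar_algebra)"
  shows "(block_ideal :: 'a set) = UNIV"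
proof (rule ccontr)
  assume "(block_ideal :: 'a set) \<noteq> UNIV"
  then obtain x0 :: 'a where x0: "x0 \<notin> block_ideal" by blast
  have "\<exists>h::'a. star h = h \<and> h \<notin> block_ideal"
  proof (rule ccontr)
    assume none: "\<not> ?thesis"
    have re: "x0 + star x0 \<in> block_ideal" using none by (metis star_add star_star add.commute)
    have "star (\<i> *\<^sub>C (x0 - star x0)) = \<i> *\<^sub>C (x0 - star x0)"
      by (simp add: star_scaleC star_diff star_star complex_vector.scale_right_diff_distrib)
    then have im: "\<i> *\<^sub>C (x0 - star x0) \<in> block_ideal" using none by blast
    have "(1/2) *\<^sub>C ((x0 + star x0) + (- \<i>) *\<^sub>C \<i> *\<^sub>C (x0 - star x0)) = (1/2) *\<^sub>C 2 *\<^sub>C x0"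
      by (simp add: scaleC_scaleC scaleC_one scaleC_add_left[of 1 1, simplified])
    also have "\<dots> = x0" by (simp add: scaleC_scaleC scaleC_one)
    finally have "x0 \<in> block_ideal"
      using block_ideal_scaleC[OF dd block_ideal_add[OF dd re block_ideal_scaleC[OF dd im, of "- \<i>"]], of "1/2"] by simp
    with x0 show False ..
  qed
  then obtain e :: 'a where e: "star e = e" "e * e = e" "e \<notin> block_ideal"
    and corner: "\<And>x. \<exists>c. e * x * e - c *\<^sub>C e \<in> block_ideal"
    using minimal_projection_modulo_ideal[OF dd] by metis
  have cut_norm: "norm (e - e * \<Sum>F) = 1" and cut_proj: "star (e - e * \<Sum>F) = e - e * \<Sum>F"
    "(e - e * \<Sum>F) * (e - e * \<Sum>F) = e - e * \<Sum>F" "e - e * \<Sum>F \<notin> block_ideal"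
    if F: "finite F" "F \<subseteq> blocks" for F
  proof -
    define z where "z = \<Sum>F"
    have z: "\<And>x. z * x = x * z" "star z = z" "z * z = z"
      unfolding z_def
      by (rule block_sum_props(1)[OF dd F], rule block_sum_props(2)[OF dd F], rule block_sum_props(4)[OF dd F F order.refl])
    show 1: "star (e - e * \<Sum>F) = e - e * \<Sum>F"
      unfolding z_def[symmetric] by (simp add: star_diff star_mult z(2) e(1) z(1)[of e])
    have "e * z * (e * z) = e * z" "e * z * e = e * z"
      by (metis mult.assoc z(1) z(3) e(2)) (metis mult.assoc z(1) e(2))
    then show 2: "(e - e * \<Sum>F) * (e - e * \<Sum>F) = e - e * \<Sum>F"
      unfolding z_def[symmetric] by (simp add: left_diff_distrib right_diff_distrib e(2) mult.assoc[symmetric])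
    show 3: "e - e * \<Sum>F \<notin> block_ideal"
      using ideal_congruent[OF dd, of e "e - e * \<Sum>F"] mult_block_sum_in_ideal[OF dd F, of e] e(3) by simp
    show "norm (e - e * \<Sum>F) = 1"
      by (rule norm_proj[OF 2 1]) (use 3 block_ideal_0[OF dd] in metis)
  qed
  have cut_commute: "\<Sum>F * x = x * \<Sum>F" if "finite F" "F \<subseteq> blocks" for F and x :: 'a
    by (rule block_sum_props(1)[OF dd that])
  define \<phi> where "\<phi> x = (SOME c. e * x * e - c *\<^sub>C e \<in> block_ideal)" for x
  have \<phi>: "e * x * e - \<phi> x *\<^sub>C e \<in> block_ideal" for x
    unfolding \<phi>_def by (rule someI_ex) (rule corner)
  have \<phi>_eqI: "\<phi> x = c" if c: "e * x * e - c *\<^sub>C e \<in> block_ideal" for x c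
  proof (rule ccontr)
    assume ne: "\<phi> x \<noteq> c"
    have "(\<phi> x - c) *\<^sub>C e = (e * x * e - c *\<^sub>C e) - (e * x * e - \<phi> x *\<^sub>C e)"
      by (simp add: complex_vector.scale_left_diff_distrib)
    also have "\<dots> \<in> block_ideal" by (rule block_ideal_diff[OF dd c \<phi>])
    finally have "(1 / (\<phi> x - c)) *\<^sub>C (\<phi> x - c) *\<^sub>C e \<in> block_ideal" by (rule block_ideal_scaleC[OF dd])
    with ne e(3) show False by (simp add: scaleC_scaleC scaleC_one)
  qed
  have \<phi>_linear: "clinear_functional \<phi>"
    unfolding clinear_functional_def
  proof (intro conjI allI \<phi>_eqI)
    fix x y
    have "e * (x + y) * e - (\<phi> x + \<phi> y) *\<^sub>C e = (e * x * e - \<phi> x *\<^sub>C e) + (e * y * e - \<phi> y *\<^sub>C e)"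
      by (simp add: distrib_left distrib_right scaleC_add_left)
    then show "e * (x + y) * e - (\<phi> x + \<phi> y) *\<^sub>C e \<in> block_ideal"
      using block_ideal_add[OF dd \<phi> \<phi>] by simp
  next
    fix c x
    have "e * (c *\<^sub>C x) * e - (c * \<phi> x) *\<^sub>C e = c *\<^sub>C (e * x * e - \<phi> x *\<^sub>C e)"
      by (simp add: mult_scaleC_left mult_scaleC_right complex_vector.scale_right_diff_distrib scaleC_scaleC)
    then show "e * (c *\<^sub>C x) * e - (c * \<phi> x) *\<^sub>C e \<in> block_ideal"
      using block_ideal_scaleC[OF dd \<phi>] by simp
  qed
  have norm_e: "norm e = 1" using cut_norm[of "{}"] by simp
  have \<phi>e: "\<phi> e = 1" by (rule \<phi>_eqI) (simp add: e(2) scaleC_one block_ideal_0[OF dd])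
  have \<phi>_le: "cmod (\<phi> x) \<le> norm x" for x
  proof (rule field_le_epsilon)
    fix \<delta> :: real assume "\<delta> > 0"
    define i where "i = e * x * e - \<phi> x *\<^sub>C e"
    obtain F where F: "finite F" "F \<subseteq> blocks" "norm (i - i * \<Sum>F) < \<delta>"
      using \<phi>[of x] \<open>\<delta> > 0\<close> unfolding i_def block_ideal_def by blast
    have "\<phi> x *\<^sub>C (e - e * \<Sum>F) = (e * x * e - e * x * e * \<Sum>F) - (i - i * \<Sum>F)"
      by (simp add: i_def complex_vector.scale_right_diff_distrib left_diff_distrib mult_scaleC_left)
    then have "norm (\<phi> x *\<^sub>C (e - e * \<Sum>F)) \<le> norm (e * x * e - e * x * e * \<Sum>F) + norm (i - i * \<Sum>F)"
      by (metis norm_triangle_ineq4)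
    moreover have "norm (\<phi> x *\<^sub>C (e - e * \<Sum>F)) = cmod (\<phi> x)" by (simp add: norm_scaleC cut_norm[OF F(1,2)])
    moreover have "norm (e * x * e - e * x * e * \<Sum>F) \<le> norm (e * x * e)" by (rule norm_cut_le[OF dd F(1,2)])
    moreover have "norm (e * x * e) \<le> norm x"
      using norm_mult_ineq[of "e * x" e] norm_mult_ineq[of e x] norm_e by simp
    ultimately show "cmod (\<phi> x) \<le> norm x + \<delta>" using F(3) by linarith
  qed
  have inf: "infinite {z \<in> blocks. z * e \<noteq> 0}"
  proof
    assume "finite {z \<in> blocks. z * e \<noteq> 0}"
    then obtain F where F: "finite F" "F \<subseteq> blocks" and Fe: "F = {z \<in> blocks. z * e \<noteq> 0}" by blast
    define f where "f = e - e * \<Sum>F"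
    have f: "star f = f" "f * f = f" "f \<notin> block_ideal" unfolding f_def by (rule cut_proj[OF F])+
    have zf: "z * f = 0" if "z \<in> blocks" for z
    proof (cases "z \<in> F")
      case True
      have "z * f = z * e - z * \<Sum>F * e" by (simp add: f_def right_diff_distrib mult.assoc cut_commute[OF F, of e])
      also have "z * \<Sum>F = z" using block_sum_props(3)[OF dd F that] True by simp
      finally show ?thesis by simp
    next
      case False
      then have "z * e = 0" using that Fe by blast
      then show ?thesis by (simp add: f_def right_diff_distrib mult.assoc[symmetric])
    qed
    have fef: "f * e = f" "e * f = f"
    proof -
      show ef: "e * f = f" by (simp add: f_def right_diff_distrib mult.assoc[symmetric] e(2))
      have "star (e * f) = star f" by (simp only: ef)
      then show "f * e = f" by (simp add: star_mult f(1) e(1))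
    qed
    have "\<exists>c. f * x * f = c *\<^sub>C f" for x
    proof -
      define i where "i = e * x * e - \<phi> x *\<^sub>C e"
      have i: "i \<in> block_ideal" unfolding i_def by (rule \<phi>)
      have "norm (f * i * f) \<le> \<delta>" if "\<delta> > 0" for \<delta>
      proof -
        obtain G where G: "finite G" "G \<subseteq> blocks" "norm (i - i * \<Sum>G) < \<delta>"
          using i \<open>\<delta> > 0\<close> unfolding block_ideal_def by blast
        have "\<Sum>G * f = 0" unfolding sum_distrib_right by (rule sum.neutral) (use zf G(2) in auto)
        then have "f * i * f = f * (i - i * \<Sum>G) * f" by (simp add: left_diff_distrib right_diff_distrib mult.assoc)
        moreover have "norm f = 1" unfolding f_def by (rule cut_norm[OF F])
        ultimately have "norm (f * i * f) \<le> norm (i - i * \<Sum>G)"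
          using norm_mult_ineq[of "f * (i - i * \<Sum>G)" f] norm_mult_ineq[of f "i - i * \<Sum>G"] by simp
        with G(3) show ?thesis by simp
      qed
      then have "norm (f * i * f) \<le> 0" by (rule field_le_epsilon[of _ 0, simplified])
      then have "f * i * f = 0" by simp
      moreover have "f * i * f = f * x * f - \<phi> x *\<^sub>C f"
      proof -
        have "f * (e * x * e) * f = f * x * f" by (metis fef mult.assoc)
        then show ?thesis by (simp add: i_def left_diff_distrib right_diff_distrib mult_scaleC_left mult_scaleC_right fef f(2))
      qed
      ultimately show ?thesis by (intro exI[of _ "\<phi> x"]) simp
    qed
    moreover have "f \<noteq> 0" using f(3) block_ideal_0[OF dd] by metis
    ultimately have "min_proj f" using f by (simp add: min_proj_def)
    with f(3) min_proj_in_ideal[OF dd] show False by blast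
  qed
  then obtain w :: "nat \<Rightarrow> 'a" where w: "inj w" "range w \<subseteq> {z \<in> blocks. z * e \<noteq> 0}"
    using infinite_countable_subset by blast
  have wb: "w n \<in> blocks" "w n * e \<noteq> 0" for n using w(2) by auto
  define p where "p n = block_proj (w n)" for n
  have p: "min_proj (p n)" "central_support (p n) = w n" for n
    unfolding p_def by (rule block_proj[OF wb(1)])+
  have "\<exists>\<xi>. \<xi> * p n = \<xi> \<and> e * \<xi> = \<xi> \<and> norm \<xi> = 1" for n
  proof -
    have "\<exists>f\<in>column_basis (p n). e * f \<noteq> 0"
    proof (rule ccontr)
      assume "\<not> ?thesis"
      then have "e * central_support (p n) = 0" by (simp add: mult_central_support[OF dd])
      then show False using wb(2)[of n] block_props(1)[OF dd wb(1), of n e] by (simp add: p(2))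
    qed
    then obtain f where f: "f \<in> column_basis (p n)" "e * f \<noteq> 0" by blast
    have "f * p n = f" by (rule orthonormalD(1)[OF p(1) column_basis(2)[OF dd p(1)] f(1)])
    then show ?thesis
      by (intro exI[of _ "(1 / norm (e * f)) *\<^sub>R (e * f)"]) (use f(2) in \<open>simp add: mult.assoc\<close>, simp add: mult.assoc[symmetric] e(2))
  qed
  then obtain \<xi> where \<xi>: "\<And>n. \<xi> n * p n = \<xi> n" "\<And>n. e * \<xi> n = \<xi> n" "\<And>n. norm (\<xi> n) = 1" by metis
  have w\<xi>: "w n * \<xi> n = \<xi> n" for n
    using column_basis(4)[OF dd p(1) \<xi>(1)] by (simp add: p(2))
  define g where "g n x = vstate (p n) (star (\<xi> n) * x * \<xi> n)" for n x
  have g1: "g n e = 1" for n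
    using vstate_column_square[OF p(1) \<xi>(1)] by (simp add: g_def mult.assoc \<xi>)
  have glin: "clinear_functional (g n)" for n
    unfolding clinear_functional_def g_def
    by (simp add: distrib_left distrib_right mult_scaleC_left mult_scaleC_right vstate_linear[OF p(1)])
  have gle: "cmod (g n x) \<le> norm x" for n x
  proof -
    have "cmod (g n x) \<le> norm (star (\<xi> n) * x * \<xi> n)" unfolding g_def by (rule cmod_vstate_le[OF p(1)])
    also have "\<dots> \<le> norm x"
      using norm_mult_ineq[of "star (\<xi> n) * x" "\<xi> n"] norm_mult_ineq[of "star (\<xi> n)" x] by (simp add: \<xi>(3))
    finally show ?thesis .
  qed
  have ge: "g n (e * x * e) = g n x" for n x
  proof -
    have "star (\<xi> n) * e = star (\<xi> n)" using arg_cong[OF \<xi>(2)[of n], of star] e(1) by (simp add: star_mult)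
    then show ?thesis unfolding g_def by (metis \<xi>(2) mult.assoc)
  qed
  have g_ideal: "(\<lambda>n. g n i) \<longlonglongrightarrow> 0" if i: "i \<in> block_ideal" for i
  proof (rule LIMSEQ_I)
    fix \<delta> :: real assume "\<delta> > 0"
    obtain F where F: "finite F" "F \<subseteq> blocks" "norm (i - i * \<Sum>F) < \<delta>"
      using i \<open>\<delta> > 0\<close> unfolding block_ideal_def by blast
    have "finite (w -` F)" using F(1) w(1) by (simp add: finite_vimageI)
    then obtain N where N: "w -` F \<subseteq> {..<N}" using finite_nat_bounded by blast
    have "norm (g n i - 0) < \<delta>" if "n \<ge> N" for n
    proof -
      have "w n \<notin> F" using N that by auto
      then have "w n * \<Sum>F = 0" using block_sum_props(3)[OF dd F(1,2) wb(1)] by simp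
      then have z: "\<Sum>F * w n = 0" by (simp only: cut_commute[OF F(1,2)])
      have "\<Sum>F * \<xi> n = \<Sum>F * w n * \<xi> n" by (simp only: mult.assoc w\<xi>)
      then have "\<Sum>F * \<xi> n = 0" by (simp only: z mult_zero_left)
      then have "g n (i * \<Sum>F) = 0"
        unfolding g_def mult.assoc by (simp add: vstate_linear(4)[OF p(1)])
      then have "g n i = g n (i - i * \<Sum>F)" unfolding clinear_functionalD(3)[OF glin] by simp
      then show ?thesis using gle[of n "i - i * \<Sum>F"] F(3) by simp
    qed
    then show "\<exists>N. \<forall>n\<ge>N. norm (g n i - 0) < \<delta>" by blast
  qed
  have "(1::real) \<le> 1 / 2"
  proof (rule double_dagger_sequence[OF dd glin gle, where l = \<phi> and N = 1 and u = e])
    show "\<exists>u. norm u \<le> 1 \<and> cmod (g n u) = 1" for n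
      by (rule exI[of _ e]) (simp add: norm_e g1)
    show "\<exists>x. norm x \<le> 1 \<and> cmod (g m x - g n x) \<ge> 1" if mn: "m \<noteq> n" for m n
    proof (intro exI conjI)
      show "norm (w m) \<le> 1" using block_props(5)[OF dd wb(1)] by simp
      have "w m * w n = 0" using blocks_orthogonal[OF dd wb(1) wb(1)] w(1) mn by (simp add: inj_eq)
      moreover have "w m * \<xi> n = w m * w n * \<xi> n" by (simp only: mult.assoc w\<xi>)
      ultimately have "w m * \<xi> n = 0" by (simp only: mult_zero_left)
      then have "g n (w m) = 0" unfolding g_def mult.assoc by (simp add: vstate_linear(4)[OF p(1)])
      moreover have "g m (w m) = 1"
        using vstate_column_square[OF p(1) \<xi>(1), of m] unfolding g_def mult.assoc w\<xi> by (simp add: \<xi>(3))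
      ultimately show "1 \<le> cmod (g m (w m) - g n (w m))" by simp
    qed
    show "(\<lambda>n. g n x) \<longlonglongrightarrow> \<phi> x" for x
    proof -
      have "g n x = \<phi> x + g n (e * x * e - \<phi> x *\<^sub>C e)" for n
        unfolding clinear_functionalD(2,3)[OF glin] ge g1 by simp
      then show ?thesis using tendsto_add[OF tendsto_const g_ideal[OF \<phi>[of x]], of "\<phi> x"] by simp
    qed
    show "cmod (\<phi> x) \<le> 1 * norm x" for x using \<phi>_le[of x] by simp
  qed (simp_all add: \<phi>_linear \<phi>e norm_e)
  then show False by simp
qed

section \<open>Coordinate spaces\<close>

definition cvec :: "nat \<Rightarrow> (nat \<Rightarrow> complex) set"
  where "cvec n = {f. \<forall>i\<ge>n. f i = 0}"

definition cvec_inner :: "nat \<Rightarrow> (nat \<Rightarrow> complex) \<Rightarrow> (nat \<Rightarrow> complex) \<Rightarrow> complex"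
  where "cvec_inner n f g = (\<Sum>i<n. f i * cnj (g i))"

definition unit_vec :: "nat \<Rightarrow> nat \<Rightarrow> complex"
  where "unit_vec i j = (if j = i then 1 else 0)"

lemma scaleC_fun_apply [simp]: "(c *\<^sub>C f) i = c *\<^sub>C f i"
  by (simp add: scaleC_fun_def)

lemma scaleC_complex [simp]: "c *\<^sub>C x = c * (x::complex)"
  by (simp add: scaleC_complex_def)

lemma cvec_closed:
  "0 \<in> cvec n" "f \<in> cvec n \<Longrightarrow> g \<in> cvec n \<Longrightarrow> f + g \<in> cvec n"
  "f \<in> cvec n \<Longrightarrow> c *\<^sub>C f \<in> cvec n"
  by (simp_all add: cvec_def)

lemma unit_vec_cvec: "i < n \<Longrightarrow> unit_vec i \<in> cvec n"
  by (simp add: cvec_def unit_vec_def)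

lemma subspace_cvec: "csubspace (cvec n)"
  by (simp add: complex_vector.subspace_def cvec_closed)

lemma sum_fun_apply: "(\<Sum>i\<in>F. f i) j = (\<Sum>i\<in>F. f i j)"
  for f :: "'i \<Rightarrow> 'j \<Rightarrow> 'b::comm_monoid_add"
  by (induction F rule: infinite_finite_induct) simp_all

lemma cvec_expand: "f \<in> cvec n \<Longrightarrow> f = (\<Sum>i<n. f i *\<^sub>C unit_vec i)"
proof
  fix j assume f: "f \<in> cvec n"
  have "(\<Sum>i<n. f i *\<^sub>C unit_vec i) j = (\<Sum>i<n. if i = j then f j else 0)"
    unfolding sum_fun_apply by (rule sum.cong) (auto simp: unit_vec_def)
  also have "\<dots> = f j" using f by (simp add: cvec_def)
  finally show "f j = (\<Sum>i<n. f i *\<^sub>C unit_vec i) j" by simp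
qed

lemma span_unit_vec: "cspan (unit_vec ` {..<n}) = cvec n"
proof
  show "cspan (unit_vec ` {..<n}) \<subseteq> cvec n"
    by (rule complex_vector.span_minimal) (auto simp: unit_vec_cvec subspace_cvec)
  show "cvec n \<subseteq> cspan (unit_vec ` {..<n})"
  proof
    fix f assume "f \<in> cvec n"
    then have "f = (\<Sum>i<n. f i *\<^sub>C unit_vec i)" by (rule cvec_expand)
    moreover have "(\<Sum>i<n. f i *\<^sub>C unit_vec i) \<in> cspan (unit_vec ` {..<n})"
      by (intro complex_vector.span_sum complex_vector.span_scale complex_vector.span_base) auto
    ultimately show "f \<in> cspan (unit_vec ` {..<n})" by (simp only:)
  qed
qed

lemma cvec_inner_self: "cvec_inner n f f = of_real (\<Sum>i<n. (cmod (f i))\<^sup>2)"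
  by (simp add: cvec_inner_def complex_norm_square del: of_real_power)

lemma inner_norm_cvec: "inner_norm (cvec_inner n) f = sqrt (\<Sum>i<n. (cmod (f i))\<^sup>2)"
  by (simp add: inner_norm_def cvec_inner_self)

lemma cmod_le_inner_norm_cvec: "i < n \<Longrightarrow> cmod (f i) \<le> inner_norm (cvec_inner n) f"
  unfolding inner_norm_cvec by (rule real_le_rsqrt) (rule member_le_sum, auto)

lemma cvec_inner_unit_vec: "i < n \<Longrightarrow> cvec_inner n (unit_vec i) g = cnj (g i)"
proof -
  assume i: "i < n"
  have "cvec_inner n (unit_vec i) g = (\<Sum>j<n. if j = i then cnj (g i) else 0)"
    unfolding cvec_inner_def by (rule sum.cong) (auto simp: unit_vec_def)
  with i show ?thesis by simp
qed

text \<open>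
  Only completeness is not immediate: a Cauchy sequence converges in each of the n coordinates.
\<close>

lemma fd_hilbert_space_cvec: "fd_hilbert_space (cvec n) (cvec_inner n)"
proof
  show "csubspace (cvec n)" by (rule subspace_cvec)
  show "cvec_inner n (x + y) z = cvec_inner n x z + cvec_inner n y z" for x y z
    by (simp add: cvec_inner_def distrib_right sum.distrib)
  show "cvec_inner n (a *\<^sub>C x) z = a * cvec_inner n x z" for a x z
    by (simp add: cvec_inner_def sum_distrib_left mult.assoc)
  show "cvec_inner n y x = cnj (cvec_inner n x y)" for x y
    by (simp add: cvec_inner_def mult.commute)
  show "0 < Re (cvec_inner n x x)" if mem: "x \<in> cvec n" and nz: "x \<noteq> 0" for x
  proof -
    obtain i where i: "x i \<noteq> 0" using nz by (auto simp: fun_eq_iff)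
    then have "i < n" using mem by (auto simp: cvec_def not_less[symmetric])
    then have "0 < (\<Sum>i<n. (cmod (x i))\<^sup>2)" using i by (intro sum_pos2[of _ i]) auto
    then show ?thesis by (simp add: cvec_inner_self)
  qed
  show "\<exists>B. finite B \<and> cspan B = cvec n" using span_unit_vec by blast
  fix X :: "nat \<Rightarrow> nat \<Rightarrow> complex"
  assume X: "\<And>k. X k \<in> cvec n"
    and cau: "\<And>e. 0 < e \<Longrightarrow> \<exists>N. \<forall>k\<ge>N. \<forall>l\<ge>N. inner_norm (cvec_inner n) (X k - X l) < e"
  have "convergent (\<lambda>k. X k i)" for i
  proof (cases "i < n")
    case True
    have "Cauchy (\<lambda>k. X k i)"
    proof (rule metric_CauchyI)
      fix e :: real assume "e > 0"
      then obtain N where N: "\<And>k l. k \<ge> N \<Longrightarrow> l \<ge> N \<Longrightarrow> inner_norm (cvec_inner n) (X k - X l) < e"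
        using cau by blast
      have "dist (X k i) (X l i) < e" if "k \<ge> N" "l \<ge> N" for k l
        using cmod_le_inner_norm_cvec[OF True, of "X k - X l"] N[OF that] by (simp add: dist_norm)
      then show "\<exists>M. \<forall>k\<ge>M. \<forall>l\<ge>M. dist (X k i) (X l i) < e" by blast
    qed
    then show ?thesis by (rule Cauchy_convergent)
  next
    case False
    then have "X k i = 0" for k using X[of k] by (simp add: cvec_def)
    then show ?thesis by (simp add: convergent_const)
  qed
  then obtain x where x: "\<And>i. (\<lambda>k. X k i) \<longlonglongrightarrow> x i"
    unfolding convergent_def by metis
  have "x \<in> cvec n"
    unfolding cvec_def
  proof (intro CollectI allI impI)
    fix i assume "n \<le> i"
    then have "X k i = 0" for k using X[of k] by (simp add: cvec_def)
    then show "x i = 0" using x[of i] by (simp add: LIMSEQ_const_iff)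
  qed
  moreover have "(\<lambda>k. inner_norm (cvec_inner n) (X k - x)) \<longlonglongrightarrow> 0"
  proof -
    have "(\<lambda>k. \<Sum>i<n. (cmod (X k i - x i))\<^sup>2) \<longlonglongrightarrow> (\<Sum>i<n. 0)"
    proof (intro tendsto_sum)
      fix i
      have "(\<lambda>k. (cmod (X k i - x i))\<^sup>2) \<longlonglongrightarrow> (cmod (x i - x i))\<^sup>2"
        by (intro tendsto_intros x)
      then show "(\<lambda>k. (cmod (X k i - x i))\<^sup>2) \<longlonglongrightarrow> 0" by simp
    qed
    then have "(\<lambda>k. sqrt (\<Sum>i<n. (cmod (X k i - x i))\<^sup>2)) \<longlonglongrightarrow> sqrt 0"
      by (intro tendsto_real_sqrt) simp
    then show ?thesis by (simp add: inner_norm_cvec)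
  qed
  ultimately show "\<exists>x\<in>cvec n. (\<lambda>k. inner_norm (cvec_inner n) (X k - x)) \<longlonglongrightarrow> 0" by blast
qed

lemma cvec_inner_nondegenerate:
  assumes "f \<in> cvec n" "g \<in> cvec n" "\<And>h. h \<in> cvec n \<Longrightarrow> cvec_inner n h f = cvec_inner n h g"
  shows "f = g"
proof
  fix i
  show "f i = g i"
  proof (cases "i < n")
    case True
    then show ?thesis
      using assms(3)[OF unit_vec_cvec[OF True]] by (simp add: cvec_inner_unit_vec)
  next
    case False
    then show ?thesis using assms(1,2) by (simp add: cvec_def)
  qed
qed

section \<open>The representation of the algebra on a block\<close>

text \<open>
  An orthonormal basis b of the left ideal Ap of a minimal projection p, whose central support is z.
  The algebra acts on Ap by left multiplication.
\<close>

locale block_coordinates =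
  fixes p z :: "'a::cstar_algebra" and n :: nat and b :: "nat \<Rightarrow> 'a"
  assumes p: "min_proj p"
    and b_col: "i < n \<Longrightarrow> b i * p = b i"
    and b_orth: "i < n \<Longrightarrow> j < n \<Longrightarrow> star (b i) * b j = (if i = j then p else 0)"
    and z_eq: "z = (\<Sum>i<n. b i * star (b i))"
    and z_col: "\<xi> * p = \<xi> \<Longrightarrow> z * \<xi> = \<xi>"
    and z_central: "z * x = x * z"
begin

definition vec :: "(nat \<Rightarrow> complex) \<Rightarrow> 'a"
  where "vec f = (\<Sum>i<n. f i *\<^sub>C b i)"

definition coord :: "'a \<Rightarrow> nat \<Rightarrow> complex"
  where "coord \<xi> = (\<lambda>i. if i < n then vstate p (star (b i) * \<xi>) else 0)"

definition rep :: "'a \<Rightarrow> (nat \<Rightarrow> complex) \<Rightarrow> nat \<Rightarrow> complex"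
  where "rep a = (\<lambda>f\<in>cvec n. coord (a * vec f))"

lemmas vl = vstate_linear[OF p]

lemma norm_b: "i < n \<Longrightarrow> norm (b i) = 1"
  using cstar_identity[of "b i"] min_projD(4)[OF p] b_orth[of i i]
  by (simp add: power2_eq_1_iff) (smt (verit) norm_ge_zero)

lemma vec_col: "vec f * p = vec f"
  unfolding vec_def sum_distrib_right by (rule sum.cong) (simp_all add: mult_scaleC_left b_col)

lemma vec_add: "vec (f + g) = vec f + vec g"
  by (simp add: vec_def scaleC_add_left sum.distrib)

lemma vec_scaleC: "vec (c *\<^sub>C f) = c *\<^sub>C vec f"
  by (simp add: vec_def complex_vector.scale_sum_right scaleC_scaleC)

lemma coord_cvec: "coord \<xi> \<in> cvec n"
  by (simp add: coord_def cvec_def)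

lemma coord_add: "coord (\<xi> + \<eta>) = coord \<xi> + coord \<eta>"
  by (auto simp: coord_def fun_eq_iff distrib_left vl)

lemma coord_scaleC: "coord (c *\<^sub>C \<xi>) = c *\<^sub>C coord \<xi>"
  by (auto simp: coord_def fun_eq_iff mult_scaleC_right vl)

lemma coord_vec:
  assumes f: "f \<in> cvec n"
  shows "coord (vec f) = f"
proof
  fix i
  show "coord (vec f) i = f i"
  proof (cases "i < n")
    case True
    have "star (b i) * vec f = (\<Sum>j<n. if j = i then f i *\<^sub>C p else 0)"
      unfolding vec_def sum_distrib_left
      by (rule sum.cong) (use True b_orth in \<open>auto simp: mult_scaleC_right\<close>)
    also have "\<dots> = f i *\<^sub>C p" using True by simp
    finally show ?thesis using True by (simp add: coord_def vl vstate_self[OF p])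
  next
    case False
    then show ?thesis using f by (simp add: coord_def cvec_def)
  qed
qed

lemma vec_coord:
  assumes \<xi>: "\<xi> * p = \<xi>"
  shows "vec (coord \<xi>) = \<xi>"
proof -
  have "vstate p (star (b i) * \<xi>) *\<^sub>C b i = b i * star (b i) * \<xi>" if "i < n" for i
  proof -
    have "b i * star (b i) * \<xi> = b i * (vstate p (star (b i) * \<xi>) *\<^sub>C p)"
      unfolding mult.assoc using column_product[OF p \<xi> b_col[OF that]] by simp
    then show ?thesis by (simp add: mult_scaleC_right b_col[OF that])
  qed
  then have "vec (coord \<xi>) = (\<Sum>i<n. b i * star (b i) * \<xi>)"
    unfolding vec_def coord_def by (intro sum.cong) auto
  also have "\<dots> = z * \<xi>" by (simp add: z_eq sum_distrib_right)
  finally show ?thesis using z_col[OF \<xi>] by simp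
qed

lemma star_vec_vec: "star (vec g) * vec f = cvec_inner n f g *\<^sub>C p"
proof -
  have "star (vec g) * vec f = (\<Sum>i<n. \<Sum>j<n. (cnj (g i) *\<^sub>C star (b i)) * (f j *\<^sub>C b j))"
    by (simp add: vec_def star_sum star_scaleC sum_product)
  also have "\<dots> = (\<Sum>i<n. \<Sum>j<n. if j = i then (f i * cnj (g i)) *\<^sub>C p else 0)"
    by (intro sum.cong refl) (auto simp: mult_scaleC_left mult_scaleC_right scaleC_scaleC b_orth)
  also have "\<dots> = (\<Sum>i<n. (f i * cnj (g i)) *\<^sub>C p)" by (rule sum.cong) auto
  finally show ?thesis by (simp add: cvec_inner_def complex_vector.scale_sum_left)
qed

lemma norm_vec: "norm (vec f) = inner_norm (cvec_inner n) f"
proof -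
  have "(norm (vec f))\<^sup>2 = norm (cvec_inner n f f *\<^sub>C p)"
    by (simp add: cstar_identity[symmetric] star_vec_vec)
  also have "\<dots> = (\<Sum>i<n. (cmod (f i))\<^sup>2)"
    by (simp add: norm_scaleC cvec_inner_self min_projD[OF p] sum_nonneg del: of_real_sum of_real_power)
  finally show ?thesis
    unfolding inner_norm_cvec by (metis norm_ge_zero real_sqrt_unique)
qed

lemma rep_apply: "f \<in> cvec n \<Longrightarrow> rep a f = coord (a * vec f)"
  by (simp add: rep_def)

lemma mult_vec_col: "a * vec f * p = a * vec f"
  by (simp add: mult.assoc vec_col)

lemma vec_rep: "f \<in> cvec n \<Longrightarrow> vec (rep a f) = a * vec f"
  by (simp add: rep_apply vec_coord mult_vec_col)

lemma inner_norm_rep: "f \<in> cvec n \<Longrightarrow> inner_norm (cvec_inner n) (rep a f) = norm (a * vec f)"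
  by (simp add: norm_vec[symmetric] vec_rep)

lemma rep_bounded_ops: "rep a \<in> bounded_ops (cvec n) (cvec_inner n)"
  unfolding bounded_ops_def
proof (intro CollectI conjI)
  show "rep a \<in> cvec n \<rightarrow>\<^sub>E cvec n" by (simp add: rep_def coord_cvec)
  show "\<forall>x\<in>cvec n. \<forall>y\<in>cvec n. rep a (x + y) = rep a x + rep a y"
    by (simp add: rep_apply cvec_closed vec_add distrib_left coord_add)
  show "\<forall>c. \<forall>x\<in>cvec n. rep a (c *\<^sub>C x) = c *\<^sub>C rep a x"
    by (simp add: rep_apply cvec_closed vec_scaleC mult_scaleC_right coord_scaleC)
  show "\<exists>K. \<forall>x\<in>cvec n. inner_norm (cvec_inner n) (rep a x) \<le> K * inner_norm (cvec_inner n) x"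
    by (intro exI[of _ "norm a"] ballI) (simp only: norm_vec[symmetric] vec_rep norm_mult_ineq)
qed

lemma rep_star:
  assumes "f \<in> cvec n" "g \<in> cvec n"
  shows "cvec_inner n (rep a f) g = cvec_inner n f (rep (star a) g)"
proof -
  have "cvec_inner n (rep a f) g *\<^sub>C p = star (vec g) * (a * vec f)"
    by (simp add: star_vec_vec[symmetric] vec_rep assms)
  also have "\<dots> = star (vec (rep (star a) g)) * vec f"
    by (simp add: vec_rep assms star_mult star_star mult.assoc)
  also have "\<dots> = cvec_inner n f (rep (star a) g) *\<^sub>C p" by (rule star_vec_vec)
  finally show ?thesis using min_projD(1)[OF p] by simp
qed

lemma adjoint_rep: "sa_star (op_algebra (cvec n) (cvec_inner n)) (rep a) = rep (star a)"
  unfolding op_algebra_def star_algebra.simps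
proof (rule the_equality)
  show "rep (star a) \<in> bounded_ops (cvec n) (cvec_inner n) \<and>
      (\<forall>x\<in>cvec n. \<forall>y\<in>cvec n. cvec_inner n (rep a x) y = cvec_inner n x (rep (star a) y))"
    using rep_bounded_ops rep_star by blast
  fix S assume S: "S \<in> bounded_ops (cvec n) (cvec_inner n) \<and>
      (\<forall>x\<in>cvec n. \<forall>y\<in>cvec n. cvec_inner n (rep a x) y = cvec_inner n x (S y))"
  then have SE: "S \<in> cvec n \<rightarrow>\<^sub>E cvec n" by (simp add: bounded_ops_def)
  show "S = rep (star a)"
  proof (rule PiE_ext[OF SE])
    show RE: "rep (star a) \<in> cvec n \<rightarrow>\<^sub>E cvec n" using rep_bounded_ops by (simp add: bounded_ops_def)
    fix y assume y: "y \<in> cvec n"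
    show "S y = rep (star a) y"
    proof (rule cvec_inner_nondegenerate)
      show "S y \<in> cvec n" "rep (star a) y \<in> cvec n" using SE RE y by auto
      fix h assume "h \<in> cvec n"
      then show "cvec_inner n h (S y) = cvec_inner n h (rep (star a) y)"
        using S y rep_star by metis
    qed
  qed
qed

text \<open>
  On the block, the norm of the algebra is at most n times the operator norm on Ap. Applied to the
  iterated squares of a self-adjoint element, this shows that the factor n can be omitted.
\<close>

lemma norm_block_le_selfadjoint:
  assumes h: "star h = h" and M: "0 \<le> M" and le: "\<And>\<xi>. \<xi> * p = \<xi> \<Longrightarrow> norm (h * \<xi>) \<le> M * norm \<xi>"
    and hz: "h * z = h"
  shows "norm h \<le> M"
proof -
  have col: "norm (iter_square k h * \<xi>) \<le> M ^ 2 ^ k * norm \<xi>" if "\<xi> * p = \<xi>" for k \<xi>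
    using that
  proof (induction k arbitrary: \<xi>)
    case (Suc k)
    have "norm (iter_square (Suc k) h * \<xi>) = norm (iter_square k h * (iter_square k h * \<xi>))"
      by (simp add: mult.assoc)
    also have "\<dots> \<le> M ^ 2 ^ k * norm (iter_square k h * \<xi>)"
      by (rule Suc.IH) (simp add: mult.assoc Suc.prems)
    also have "\<dots> \<le> M ^ 2 ^ k * (M ^ 2 ^ k * norm \<xi>)"
      by (intro mult_left_mono Suc.IH Suc.prems) (use M in simp)
    also have "\<dots> = M ^ 2 ^ Suc k * norm \<xi>" by (simp add: mult_2 power_add)
    finally show ?case .
  qed (use le in simp)
  have sq_z: "iter_square k h * z = iter_square k h" for k
    by (induction k) (simp_all add: hz mult.assoc)
  show ?thesis
  proof (rule le_of_power_le_mult[OF M])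
    fix k
    have "iter_square k h = (\<Sum>i<n. iter_square k h * b i * star (b i))"
      by (subst sq_z[symmetric]) (simp add: z_eq sum_distrib_left mult.assoc)
    then have "norm h ^ 2 ^ k \<le> (\<Sum>i<n. norm (iter_square k h * b i * star (b i)))"
      unfolding norm_iter_square[OF h, symmetric] by (metis norm_sum)
    also have "\<dots> \<le> (\<Sum>i<n. M ^ 2 ^ k)"
    proof (rule sum_mono)
      fix i assume "i \<in> {..<n}"
      then have i: "i < n" by simp
      have "norm (iter_square k h * b i * star (b i)) \<le> norm (iter_square k h * b i)"
        using norm_mult_ineq[of "iter_square k h * b i" "star (b i)"] by (simp add: norm_b[OF i])
      also have "\<dots> \<le> M ^ 2 ^ k" using col[OF b_col[OF i]] by (simp add: norm_b[OF i])
      finally show "norm (iter_square k h * b i * star (b i)) \<le> M ^ 2 ^ k" .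
    qed
    finally show "norm h ^ 2 ^ k \<le> real n * M ^ 2 ^ k" by simp
  qed
qed

lemma z_idem: "z * z = z"
proof -
  have "z * (b i * star (b i)) = b i * star (b i)" if "i < n" for i
    using z_col[OF b_col[OF that]] by (simp add: mult.assoc[symmetric])
  then show ?thesis by (subst (2) z_eq) (simp add: sum_distrib_left, simp add: z_eq)
qed

lemma norm_block_le:
  assumes M: "0 \<le> M" and le: "\<And>\<xi>. \<xi> * p = \<xi> \<Longrightarrow> norm (a * \<xi>) \<le> M * norm \<xi>"
  shows "norm (a * z) \<le> M"
proof -
  define y where "y = a * z"
  have yz: "y * z = y" by (simp add: y_def mult.assoc z_idem)
  have y: "norm (y * \<xi>) \<le> M * norm \<xi>" if "\<xi> * p = \<xi>" for \<xi>
    using le[OF that] z_col[OF that] by (simp add: y_def mult.assoc)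
  have ys: "norm (star y * \<eta>) \<le> M * norm \<eta>" if \<eta>: "\<eta> * p = \<eta>" for \<eta>
  proof (cases "star y * \<eta> = 0")
    case False
    have "(norm (star y * \<eta>))\<^sup>2 = norm (star \<eta> * (y * (star y * \<eta>)))"
      by (simp add: cstar_identity[symmetric] star_mult star_star mult.assoc)
    also have "\<dots> \<le> norm \<eta> * (M * norm (star y * \<eta>))"
      by (rule order.trans[OF norm_mult_ineq])
         (simp add: mult_left_mono y mult.assoc \<eta>)
    finally have "norm (star y * \<eta>) * norm (star y * \<eta>) \<le> (M * norm \<eta>) * norm (star y * \<eta>)"
      by (simp add: power2_eq_square mult_ac)
    then show ?thesis by (rule mult_right_le_imp_le) (use False in simp)
  qed (use M in simp)
  have "norm (star y * y) \<le> M\<^sup>2"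
  proof (rule norm_block_le_selfadjoint)
    show "star (star y * y) = star y * y" by (simp add: star_mult star_star)
    show "star y * y * z = star y * y" by (simp add: mult.assoc yz)
    fix \<xi> assume \<xi>: "\<xi> * p = \<xi>"
    have "norm (star y * y * \<xi>) \<le> M * norm (y * \<xi>)"
      unfolding mult.assoc by (rule ys) (simp add: mult.assoc \<xi>)
    also have "\<dots> \<le> M * (M * norm \<xi>)" by (intro mult_left_mono y \<xi> M)
    finally show "norm (star y * y * \<xi>) \<le> M\<^sup>2 * norm \<xi>" by (simp add: power2_eq_square)
  qed simp
  then have "(norm y)\<^sup>2 \<le> M\<^sup>2" by (simp add: cstar_identity)
  then show ?thesis unfolding y_def[symmetric] by (rule power2_le_imp_le[OF _ M])
qed

lemma op_norm_rep: "sa_norm (op_algebra (cvec n) (cvec_inner n)) (rep a) = norm (a * z)"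
proof -
  define U where "U = {x \<in> cvec n. inner_norm (cvec_inner n) x \<le> 1}"
  have z: "z * vec f = vec f" for f by (rule z_col[OF vec_col])
  have le: "inner_norm (cvec_inner n) (rep a f) \<le> norm (a * z)" if "f \<in> U" for f
  proof -
    have "norm (a * vec f) = norm (a * z * vec f)" by (simp add: mult.assoc z)
    also have "\<dots> \<le> norm (a * z) * norm (vec f)" by (rule norm_mult_ineq)
    also have "\<dots> \<le> norm (a * z) * 1"
      by (intro mult_left_mono) (use that in \<open>simp_all add: norm_vec U_def\<close>)
    finally show ?thesis using that by (simp add: inner_norm_rep U_def)
  qed
  have bdd: "bdd_above ((\<lambda>f. inner_norm (cvec_inner n) (rep a f)) ` U)"
    by (rule bdd_aboveI2) (rule le)
  have "0 \<in> U" by (simp add: U_def cvec_closed inner_norm_cvec)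
  define S where "S = (SUP f\<in>U. inner_norm (cvec_inner n) (rep a f))"
  have upper: "inner_norm (cvec_inner n) (rep a f) \<le> S" if "f \<in> U" for f
    unfolding S_def by (rule cSUP_upper[OF that bdd])
  have "S \<le> norm (a * z)"
    unfolding S_def by (rule cSUP_least) (use \<open>0 \<in> U\<close> le in auto)
  moreover have "norm (a * z) \<le> S"
  proof (rule norm_block_le)
    have "0 \<le> inner_norm (cvec_inner n) (rep a 0)"
      by (simp only: norm_vec[symmetric] norm_ge_zero)
    with upper[OF \<open>0 \<in> U\<close>] show "0 \<le> S" by (rule order.trans[rotated])
    fix \<xi> assume \<xi>: "\<xi> * p = \<xi>"
    show "norm (a * \<xi>) \<le> S * norm \<xi>"
    proof (cases "\<xi> = 0")
      case False
      define \<eta> where "\<eta> = (1 / norm \<xi>) *\<^sub>R \<xi>"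
      have \<eta>: "\<eta> * p = \<eta>" by (simp add: \<eta>_def \<xi>)
      have "norm \<eta> = 1" using False by (simp add: \<eta>_def)
      then have "coord \<eta> \<in> U"
        by (simp add: U_def coord_cvec norm_vec[symmetric] vec_coord[OF \<eta>])
      then have "norm (a * \<eta>) \<le> S"
        using upper[of "coord \<eta>"] by (simp add: inner_norm_rep coord_cvec vec_coord[OF \<eta>])
      then show ?thesis using False by (simp add: \<eta>_def field_simps)
    qed simp
  qed
  ultimately have "S = norm (a * z)" by simp
  then show ?thesis by (simp add: op_algebra_def S_def U_def)
qed

text \<open>
  The element of the block that acts on Ap as T: the sum of the rank-one elements sending the basis
  vectors to their images.
\<close>

definition lift_op :: "((nat \<Rightarrow> complex) \<Rightarrow> nat \<Rightarrow> complex) \<Rightarrow> 'a"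
  where "lift_op T = (\<Sum>i<n. vec (T (unit_vec i)) * star (b i))"

lemma z_lift_op: "lift_op T * z = lift_op T" "z * lift_op T = lift_op T"
proof -
  have "z * (vec (T (unit_vec i)) * star (b i)) = vec (T (unit_vec i)) * star (b i)" for i
    using z_col[OF vec_col] by (simp add: mult.assoc[symmetric])
  then show *: "z * lift_op T = lift_op T" by (simp add: lift_op_def sum_distrib_left)
  then show "lift_op T * z = lift_op T" by (simp add: z_central)
qed

lemma rep_lift_op:
  assumes T: "T \<in> bounded_ops (cvec n) (cvec_inner n)"
  shows "rep (lift_op T) = T"
proof (rule PiE_ext)
  show "rep (lift_op T) \<in> cvec n \<rightarrow>\<^sub>E cvec n" using rep_bounded_ops by (simp add: bounded_ops_def)
  show TE: "T \<in> cvec n \<rightarrow>\<^sub>E cvec n" using T by (simp add: bounded_ops_def)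
  fix f assume f: "f \<in> cvec n"
  have T_add: "T (x + y) = T x + T y" if "x \<in> cvec n" "y \<in> cvec n" for x y
    using T that unfolding bounded_ops_def by blast
  have T_scale: "T (c *\<^sub>C x) = c *\<^sub>C T x" if "x \<in> cvec n" for c x
    using T that unfolding bounded_ops_def by blast
  have T0: "T 0 = 0"
    using T_scale[OF cvec_closed(1), of 0] by (simp only: complex_vector.scale_zero_left)
  have T_sum: "T (\<Sum>i\<in>F. c i *\<^sub>C unit_vec i) = (\<Sum>i\<in>F. c i *\<^sub>C T (unit_vec i)) \<and> (\<Sum>i\<in>F. c i *\<^sub>C unit_vec i) \<in> cvec n"
    if "finite F" "F \<subseteq> {..<n}" for F c
    using that
  proof (induction F rule: finite_induct)
    case empty
    show ?case by (simp only: sum.empty T0 cvec_closed)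
  next
    case (insert i F)
    then have i: "unit_vec i \<in> cvec n" by (simp add: unit_vec_cvec)
    have F: "T (\<Sum>i\<in>F. c i *\<^sub>C unit_vec i) = (\<Sum>i\<in>F. c i *\<^sub>C T (unit_vec i))" "(\<Sum>i\<in>F. c i *\<^sub>C unit_vec i) \<in> cvec n"
      using insert.IH insert.prems by blast+
    show ?case
      unfolding sum.insert[OF insert.hyps]
      by (simp only: T_add[OF cvec_closed(3)[OF i] F(2)] T_scale[OF i] F cvec_closed(2)[OF cvec_closed(3)[OF i] F(2)])
  qed
  have Tf: "T f = (\<Sum>i<n. f i *\<^sub>C T (unit_vec i))"
    using T_sum[of "{..<n}" f] by (simp only: cvec_expand[OF f, symmetric] finite_lessThan order.refl)
  have vec0: "vec 0 = 0"
    using vec_scaleC[of 0 0] by (simp only: complex_vector.scale_zero_left)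
  have vec_sum: "vec (\<Sum>i\<in>F. c i *\<^sub>C g i) = (\<Sum>i\<in>F. c i *\<^sub>C vec (g i))" for F :: "nat set" and c g
    by (induction F rule: infinite_finite_induct)
       (simp_all only: sum.infinite sum.empty vec0 sum.insert vec_add vec_scaleC not_False_eq_True)
  have "lift_op T * vec f = (\<Sum>i<n. vec (T (unit_vec i)) * (star (b i) * vec f))"
    by (simp add: lift_op_def sum_distrib_right mult.assoc)
  also have "\<dots> = (\<Sum>i<n. f i *\<^sub>C vec (T (unit_vec i)))"
  proof (rule sum.cong[OF refl])
    fix i assume "i \<in> {..<n}"
    then have i: "i < n" by simp
    have "star (b i) * vec f = f i *\<^sub>C p"
      using column_product[OF p vec_col b_col[OF i], of f] coord_vec[OF f] i
      by (metis coord_def)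
    then show "vec (T (unit_vec i)) * (star (b i) * vec f) = f i *\<^sub>C vec (T (unit_vec i))"
      by (simp add: mult_scaleC_right vec_col)
  qed
  also have "\<dots> = vec (T f)" by (simp only: Tf vec_sum)
  finally show "rep (lift_op T) f = T f"
    using coord_vec[OF PiE_mem[OF TE f]] by (simp only: rep_apply[OF f])
qed

lemma rep_mult_z: "rep (a * z) = rep a"
  unfolding rep_def by (simp add: mult.assoc z_col[OF vec_col] cong: restrict_cong)

end

section \<open>The isomorphism\<close>

definition block_dim :: "'a::cstar_algebra \<Rightarrow> nat"
  where "block_dim z = card (column_basis (block_proj z))"

definition block_basis :: "'a::cstar_algebra \<Rightarrow> nat \<Rightarrow> 'a"
  where "block_basis z = (SOME h. bij_betw h {0..<block_dim z} (column_basis (block_proj z)))"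

definition block_rep :: "'a::cstar_algebra \<Rightarrow> 'a \<Rightarrow> (nat \<Rightarrow> complex) \<Rightarrow> nat \<Rightarrow> complex"
  where "block_rep z = block_coordinates.rep (block_proj z) (block_dim z) (block_basis z)"

abbreviation block_ops :: "'a::cstar_algebra \<Rightarrow> ((nat \<Rightarrow> complex) \<Rightarrow> nat \<Rightarrow> complex) star_algebra"
  where "block_ops z \<equiv> op_algebra (cvec (block_dim z)) (cvec_inner (block_dim z))"

lemma block_coordinates_block:
  assumes dd: "double_dagger TYPE('a::cstar_algebra)" and z: "(z::'a) \<in> blocks"
  shows "block_coordinates (block_proj z) z (block_dim z) (block_basis z)"
proof -
  note p = block_proj[OF z]
  note B = column_basis[OF dd p(1)]
  have bij: "bij_betw (block_basis z) {0..<block_dim z} (column_basis (block_proj z))"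
    unfolding block_basis_def block_dim_def by (rule someI_ex[OF ex_bij_betw_nat_finite[OF B(1)]])
  have mem: "block_basis z i \<in> column_basis (block_proj z)" if "i < block_dim z" for i
    using bij_betw_apply[OF bij] that by simp
  note o = orthonormalD[OF p(1) B(2)]
  show ?thesis
  proof
    show "min_proj (block_proj z)" by (rule p(1))
    show "block_basis z i * block_proj z = block_basis z i" if "i < block_dim z" for i
      by (rule o(1)[OF mem[OF that]])
    show "star (block_basis z i) * block_basis z j = (if i = j then block_proj z else 0)"
      if "i < block_dim z" "j < block_dim z" for i j
    proof (cases "i = j")
      case True
      then show ?thesis using o(2)[OF mem[OF that(1)]] by simp
    next
      case False
      have "block_basis z i \<noteq> block_basis z j"
        using bij_betw_imp_inj_on[OF bij] False that by (auto dest: inj_onD)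
      then show ?thesis using o(3)[OF mem[OF that(1)] mem[OF that(2)]] False by simp
    qed
    have "z = (\<Sum>e\<in>column_basis (block_proj z). e * star e)"
      using p(2) by (simp add: central_support_def range_proj_def)
    also have "\<dots> = (\<Sum>i\<in>{0..<block_dim z}. block_basis z i * star (block_basis z i))"
      by (rule sum.reindex_bij_betw[OF bij, symmetric])
    finally show "z = (\<Sum>i<block_dim z. block_basis z i * star (block_basis z i))"
      by (simp add: atLeast0LessThan)
    show "z * \<xi> = \<xi>" if "\<xi> * block_proj z = \<xi>" for \<xi>
      using B(4)[OF that] by (simp add: p(2))
    show "z * x = x * z" for x by (rule block_props(1)[OF dd z])
  qed
qed

context
  assumes dd: "double_dagger TYPE('a::cstar_algebra)"
begin

lemma block_repD:
  assumes z: "(z::'a) \<in> blocks"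
  shows "block_rep z a \<in> bounded_ops (cvec (block_dim z)) (cvec_inner (block_dim z))"
    "sa_norm (block_ops z) (block_rep z a) = norm (a * z)"
    "sa_star (block_ops z) (block_rep z a) = block_rep z (star a)"
    "block_rep z (a * z) = block_rep z a"
    "block_rep z (a + c) = sa_add (block_ops z) (block_rep z a) (block_rep z c)"
    "block_rep z (k *\<^sub>C a) = sa_scale (block_ops z) k (block_rep z a)"
    "block_rep z (a * c) = sa_mult (block_ops z) (block_rep z a) (block_rep z c)"
    "T \<in> bounded_ops (cvec (block_dim z)) (cvec_inner (block_dim z)) \<Longrightarrow>
      \<exists>m. block_rep z m = T \<and> m * z = m \<and> z * m = m"
proof -
  interpret block_coordinates "block_proj z" z "block_dim z" "block_basis z"
    by (rule block_coordinates_block[OF dd z])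
  show "block_rep z a \<in> bounded_ops (cvec (block_dim z)) (cvec_inner (block_dim z))"
    unfolding block_rep_def by (rule rep_bounded_ops)
  show "sa_norm (block_ops z) (block_rep z a) = norm (a * z)"
    unfolding block_rep_def by (rule op_norm_rep)
  show "sa_star (block_ops z) (block_rep z a) = block_rep z (star a)"
    unfolding block_rep_def by (rule adjoint_rep)
  show "block_rep z (a * z) = block_rep z a"
    unfolding block_rep_def by (rule rep_mult_z)
  show "block_rep z (a + c) = sa_add (block_ops z) (block_rep z a) (block_rep z c)"
    unfolding block_rep_def op_algebra_def star_algebra.simps rep_def
    by (rule restrict_ext) (simp only: restrict_apply' distrib_right coord_add)
  show "block_rep z (k *\<^sub>C a) = sa_scale (block_ops z) k (block_rep z a)"
    unfolding block_rep_def op_algebra_def star_algebra.simps rep_def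
    by (rule restrict_ext) (simp only: restrict_apply' mult_scaleC_left coord_scaleC)
  show "block_rep z (a * c) = sa_mult (block_ops z) (block_rep z a) (block_rep z c)"
    unfolding block_rep_def op_algebra_def star_algebra.simps rep_def
    by (rule restrict_ext) (simp only: restrict_apply' coord_cvec vec_coord[OF mult_vec_col] mult.assoc)
  show "\<exists>m. block_rep z m = T \<and> m * z = m \<and> z * m = m"
    if "T \<in> bounded_ops (cvec (block_dim z)) (cvec_inner (block_dim z))"
    unfolding block_rep_def using rep_lift_op[OF that] z_lift_op by blast
qed

text \<open>
  Elements of distinct blocks are orthogonal on both sides.
\<close>

lemma norm_sum_blocks:
  fixes m :: "'a \<Rightarrow> 'a"
  assumes F: "finite F" "F \<subseteq> blocks" and M: "0 \<le> M"
    and m: "\<And>z. z \<in> F \<Longrightarrow> m z * z = m z" "\<And>z. z \<in> F \<Longrightarrow> norm (m z) \<le> M"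
  shows "norm (\<Sum>z\<in>F. m z) \<le> M"
proof (rule norm_sum_orthogonal[OF F(1) M])
  fix z w assume zw: "z \<in> F" "w \<in> F" "z \<noteq> w"
  then have b: "z \<in> blocks" "w \<in> blocks" using F(2) by auto
  have 0: "z * w = 0" by (rule blocks_orthogonal[OF dd b zw(3)])
  have zc: "z * x = x * z" and wc: "w * x = x * w" for x
    using block_props(1)[OF dd] b by blast+
  have sz: "star (m z) = z * star (m z)" and sw: "star (m w) = w * star (m w)"
    using m(1) zw block_props(2)[OF dd] b by (metis star_mult)+
  have "star (m z) * m w = z * star (m z) * (m w * w)" using sz m(1)[OF zw(2)] by simp
  also have "\<dots> = star (m z) * (z * m w) * w" by (simp only: zc mult.assoc)
  also have "\<dots> = star (m z) * m w * (z * w)" by (simp only: zc mult.assoc)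
  finally show "star (m z) * m w = 0" by (simp add: 0)
  have "m z * star (m w) = m z * z * (w * star (m w))" using sw m(1)[OF zw(1)] by simp
  also have "\<dots> = m z * (z * w) * star (m w)" by (simp only: mult.assoc)
  finally show "m z * star (m w) = 0" by (simp add: 0)
qed (use m in auto)

lemma norm_le_of_blocks:
  assumes M: "0 \<le> M" and le: "\<And>z. z \<in> blocks \<Longrightarrow> norm ((a::'a) * z) \<le> M"
  shows "norm a \<le> M"
proof (rule field_le_epsilon)
  fix \<delta> :: real assume "\<delta> > 0"
  moreover have "a \<in> block_ideal" by (simp add: block_ideal_eq_UNIV[OF dd])
  ultimately obtain F where F: "finite F" "F \<subseteq> blocks" "norm (a - a * \<Sum>F) < \<delta>"
    unfolding block_ideal_def by blast
  have "norm (\<Sum>z\<in>F. a * z) \<le> M"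
  proof (rule norm_sum_blocks[OF F(1,2) M])
    fix z assume "z \<in> F"
    then have "z \<in> blocks" using F(2) by auto
    then show "a * z * z = a * z" "norm (a * z) \<le> M"
      using block_props(3)[OF dd] le by (simp_all add: mult.assoc)
  qed
  then have "norm (a * \<Sum>F) \<le> M" by (simp add: sum_distrib_left)
  moreover have "norm a \<le> norm (a - a * \<Sum>F) + norm (a * \<Sum>F)"
    using norm_triangle_ineq[of "a - a * \<Sum>F" "a * \<Sum>F"] by simp
  ultimately show "norm a \<le> M + \<delta>" using F(3) by linarith
qed

lemma norm_mult_block_le: "z \<in> blocks \<Longrightarrow> norm ((a::'a) * z) \<le> norm a"
  using norm_mult_ineq[of a z] block_props(5)[OF dd, of z] by simp

lemma finite_blocks_norm_ge:
  assumes "\<delta> > 0"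
  shows "finite {z \<in> blocks. norm ((a::'a) * z) \<ge> \<delta>}"
proof -
  have "a \<in> block_ideal" by (simp add: block_ideal_eq_UNIV[OF dd])
  with assms obtain F where F: "finite F" "F \<subseteq> blocks" "norm (a - a * \<Sum>F) < \<delta>"
    unfolding block_ideal_def by blast
  have "{z \<in> blocks. norm (a * z) \<ge> \<delta>} \<subseteq> F"
  proof
    fix z assume "z \<in> {z \<in> blocks. norm (a * z) \<ge> \<delta>}"
    then have z: "z \<in> blocks" "norm (a * z) \<ge> \<delta>" by auto
    show "z \<in> F"
    proof (rule ccontr)
      assume "z \<notin> F"
      then have "\<Sum>F * z = 0"
        using block_sum_props(3)[OF dd F(1,2) z(1)] block_props(1)[OF dd z(1), of "\<Sum>F"] by simp
      then have "(a - a * \<Sum>F) * z = a * z" by (simp add: left_diff_distrib mult.assoc)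
      then show False using norm_mult_block_le[OF z(1), of "a - a * \<Sum>F"] F(3) z(2) by simp
    qed
  qed
  then show ?thesis using F(1) finite_subset by blast
qed

text \<open>
  Sum the given elements over the finitely many blocks where their norm is at least 1/(k + 1), and
  let k tend to infinity; the sums form a Cauchy sequence since distinct blocks are orthogonal.
\<close>

lemma block_family_realized:
  fixes m :: "'a \<Rightarrow> 'a"
  assumes m: "\<And>z. z \<in> blocks \<Longrightarrow> m z * z = m z" "\<And>z. z \<in> blocks \<Longrightarrow> z * m z = m z"
    and fin: "\<And>\<delta>. \<delta> > 0 \<Longrightarrow> finite {z \<in> blocks. norm (m z) \<ge> \<delta>}"
  shows "\<exists>a. \<forall>z\<in>blocks. a * z = m z"
proof -
  define F where "F k = {z \<in> blocks. norm (m z) \<ge> inverse (real (Suc k))}" for k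
  have F: "finite (F k)" "F k \<subseteq> blocks" for k
    by (auto simp: F_def intro!: fin)
  define A where "A k = (\<Sum>z\<in>F k. m z)" for k
  have mono: "F k \<subseteq> F l" if "k \<le> l" for k l
  proof -
    have "inverse (real (Suc l)) \<le> inverse (real (Suc k))" using that by (intro le_imp_inverse_le) auto
    from order.trans[OF this] show ?thesis unfolding F_def by blast
  qed
  have diff: "norm (A l - A k) \<le> inverse (real (Suc k))" if "k \<le> l" for k l
  proof -
    have "A l - A k = (\<Sum>z\<in>F l - F k. m z)"
      unfolding A_def using sum_diff[OF F(1) mono[OF that], of m] by simp
    also have "norm \<dots> \<le> inverse (real (Suc k))"
      by (rule norm_sum_blocks) (use F m in \<open>auto simp: F_def not_le\<close>)
    finally show ?thesis .
  qed
  have "Cauchy A"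
  proof (rule metric_CauchyI)
    fix e :: real assume e: "e > 0"
    have "\<forall>\<^sub>F k in sequentially. inverse (real (Suc k)) < e / 2"
      by (rule order_tendstoD(2)[OF LIMSEQ_inverse_real_of_nat]) (use e in simp)
    then obtain N where N: "inverse (real (Suc N)) < e / 2" by (auto simp: eventually_sequentially)
    have "dist (A k) (A l) < e" if "k \<ge> N" "l \<ge> N" for k l
    proof -
      have "dist (A k) (A l) \<le> norm (A k - A N) + norm (A l - A N)"
        using dist_triangle2[of "A k" "A l" "A N"] by (simp add: dist_norm)
      then show ?thesis using diff[OF that(1)] diff[OF that(2)] N by simp
    qed
    then show "\<exists>M. \<forall>k\<ge>M. \<forall>l\<ge>M. dist (A k) (A l) < e" by blast
  qed
  then obtain a where a: "A \<longlonglongrightarrow> a" using Cauchy_convergent convergent_def by blast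
  have "a * z = m z" if z: "z \<in> blocks" for z
  proof (rule LIMSEQ_unique)
    show "(\<lambda>k. A k * z) \<longlonglongrightarrow> a * z" by (intro tendsto_intros a)
    have Az: "A k * z = (if z \<in> F k then m z else 0)" for k
    proof -
      have "m w * z = 0" if "w \<in> F k" "w \<noteq> z" for w
      proof -
        have w: "w \<in> blocks" using that F by auto
        have "m w * z = m w * (w * z)" using m(1)[OF w] by (simp add: mult.assoc[symmetric])
        then show ?thesis using blocks_orthogonal[OF dd w z that(2)] by simp
      qed
      then have "A k * z = (\<Sum>w\<in>F k. if w = z then m z else 0)"
        unfolding A_def sum_distrib_right by (intro sum.cong) (auto simp: m(1)[OF z])
      then show ?thesis using F(1) by simp
    qed
    have "norm (A k * z - m z) \<le> inverse (real (Suc k))" for k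
      using z by (auto simp: Az F_def)
    then have "(\<lambda>k. A k * z - m z) \<longlonglongrightarrow> 0"
      by (intro tendsto_norm_zero_cancel[OF tendsto_sandwich[OF _ _ tendsto_const LIMSEQ_inverse_real_of_nat]] always_eventually)
         auto
    then show "(\<lambda>k. A k * z) \<longlonglongrightarrow> m z" by (simp add: LIM_zero_iff)
  qed
  then show ?thesis by blast
qed

lemma isometric_star_iso_blocks:
  "isometric_star_iso (\<lambda>a. \<lambda>z\<in>blocks. block_rep z (a::'a)) (c0_sum blocks block_ops)"
proof -
  define \<Psi> :: "'a \<Rightarrow> 'a \<Rightarrow> (nat \<Rightarrow> complex) \<Rightarrow> nat \<Rightarrow> complex" where "\<Psi> a = (\<lambda>z\<in>blocks. block_rep z a)" for a
  note rep = block_repD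
  have car: "sa_carrier (block_ops z) = bounded_ops (cvec (block_dim z)) (cvec_inner (block_dim z))" for z :: 'a
    by (simp add: op_algebra_def)
  have norm: "sa_norm (c0_sum blocks block_ops) (\<Psi> a) = norm a" for a
  proof -
    have "sa_norm (c0_sum blocks block_ops) (\<Psi> a) = Sup (insert 0 ((\<lambda>z. norm (a * z)) ` blocks))"
      by (simp add: c0_sum_def \<Psi>_def rep(2) cong: image_cong)
    also have "\<dots> = norm a"
    proof (rule antisym)
      show "Sup (insert 0 ((\<lambda>z. norm (a * z)) ` blocks)) \<le> norm a"
        by (rule cSup_least) (use norm_mult_block_le in auto)
      have bdd: "bdd_above (insert 0 ((\<lambda>z. norm (a * z)) ` blocks))"
        by (rule bdd_aboveI[of _ "norm a"]) (use norm_mult_block_le in auto)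
      show "norm a \<le> Sup (insert 0 ((\<lambda>z. norm (a * z)) ` blocks))"
        by (rule norm_le_of_blocks) (auto intro!: cSup_upper bdd)
    qed
    finally show ?thesis .
  qed
  have inj: "inj \<Psi>"
  proof (rule injI)
    fix x y assume eq: "\<Psi> x = \<Psi> y"
    have "norm ((x - y) * z) \<le> 0" if z: "z \<in> blocks" for z
    proof -
      have xy: "block_rep z x = block_rep z y" using fun_cong[OF eq, of z] z by (simp add: \<Psi>_def)
      have "block_rep z (x - y) = block_rep z (x + (- 1) *\<^sub>C y)"
        by (simp add: complex_vector.scale_minus_left scaleC_one)
      also have "\<dots> = block_rep z (y + (- 1) *\<^sub>C y)" by (simp only: rep(5,6)[OF z] xy)
      also have "\<dots> = block_rep z 0" by (simp add: complex_vector.scale_minus_left scaleC_one)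
      finally show ?thesis using rep(2)[OF z, of "x - y"] rep(2)[OF z, of 0] by simp
    qed
    then have "norm (x - y) \<le> 0" by (rule norm_le_of_blocks[OF order.refl])
    then show "x = y" by simp
  qed
  have into: "\<Psi> a \<in> sa_carrier (c0_sum blocks block_ops)" for a
  proof -
    have "{z \<in> blocks. \<delta> \<le> sa_norm (block_ops z) (\<Psi> a z)} = {z \<in> blocks. norm (a * z) \<ge> \<delta>}" for \<delta>
      by (auto simp: \<Psi>_def rep(2))
    then show ?thesis
      using finite_blocks_norm_ge by (simp add: c0_sum_def car) (simp add: \<Psi>_def rep(1))
  qed
  have onto: "T \<in> range \<Psi>" if T: "T \<in> sa_carrier (c0_sum blocks block_ops)" for T
  proof -
    have TE: "T \<in> (\<Pi>\<^sub>E z\<in>blocks. bounded_ops (cvec (block_dim z)) (cvec_inner (block_dim z)))"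
      and fin: "\<And>\<delta>. \<delta> > 0 \<Longrightarrow> finite {z \<in> blocks. sa_norm (block_ops z) (T z) \<ge> \<delta>}"
      using T by (simp_all add: c0_sum_def car)
    have "\<forall>z\<in>blocks. \<exists>m. block_rep z m = T z \<and> m * z = m \<and> z * m = m"
      using rep(8) PiE_mem[OF TE] by blast
    from bchoice[OF this] obtain m where m: "\<And>z. z \<in> blocks \<Longrightarrow> block_rep z (m z) = T z"
      "\<And>z. z \<in> blocks \<Longrightarrow> m z * z = m z" "\<And>z. z \<in> blocks \<Longrightarrow> z * m z = m z" by blast
    have nm: "sa_norm (block_ops z) (T z) = norm (m z)" if "z \<in> blocks" for z
      using rep(2)[OF that, of "m z"] by (simp add: m that)
    have "finite {z \<in> blocks. norm (m z) \<ge> \<delta>}" if "\<delta> > 0" for \<delta>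
    proof -
      have "{z \<in> blocks. norm (m z) \<ge> \<delta>} = {z \<in> blocks. sa_norm (block_ops z) (T z) \<ge> \<delta>}"
        by (auto simp: nm)
      then show ?thesis using fin[OF that] by simp
    qed
    from block_family_realized[OF m(2,3) this] obtain a where a: "\<And>z. z \<in> blocks \<Longrightarrow> a * z = m z" by blast
    have "\<Psi> a = T"
    proof
      fix z
      show "\<Psi> a z = T z"
      proof (cases "z \<in> blocks")
        case True
        have "block_rep z a = block_rep z (a * z)" by (rule rep(4)[OF True, symmetric])
        also have "\<dots> = T z" by (simp only: a[OF True] m(1)[OF True])
        finally show ?thesis using True by (simp add: \<Psi>_def)
      next
        case False
        then show ?thesis using PiE_arb[OF TE False] by (simp add: \<Psi>_def)
      qed
    qed
    then show ?thesis by blast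
  qed
  have "isometric_star_iso \<Psi> (c0_sum blocks block_ops)"
    unfolding isometric_star_iso_def
  proof (intro conjI allI)
    show "bij_betw \<Psi> UNIV (sa_carrier (c0_sum blocks block_ops))"
      unfolding bij_betw_def using inj into onto by blast
    show "\<Psi> (x + y) = sa_add (c0_sum blocks block_ops) (\<Psi> x) (\<Psi> y)" for x y
      unfolding \<Psi>_def c0_sum_def star_algebra.simps by (rule restrict_ext) (simp only: restrict_apply' rep(5))
    show "\<Psi> (c *\<^sub>C x) = sa_scale (c0_sum blocks block_ops) c (\<Psi> x)" for c x
      unfolding \<Psi>_def c0_sum_def star_algebra.simps by (rule restrict_ext) (simp only: restrict_apply' rep(6))
    show "\<Psi> (x * y) = sa_mult (c0_sum blocks block_ops) (\<Psi> x) (\<Psi> y)" for x y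
      unfolding \<Psi>_def c0_sum_def star_algebra.simps by (rule restrict_ext) (simp only: restrict_apply' rep(7))
    show "\<Psi> (star x) = sa_star (c0_sum blocks block_ops) (\<Psi> x)" for x
      unfolding \<Psi>_def c0_sum_def star_algebra.simps by (rule restrict_ext) (simp only: restrict_apply' rep(3))
    show "sa_norm (c0_sum blocks block_ops) (\<Psi> x) = norm x" for x by (rule norm)
  qed
  then show ?thesis unfolding \<Psi>_def .
qed

end

(* An existential over types is not available, so the index set lives in the type of the algebra
   (the central supports of the nonzero summands are distinct elements of it) and the Hilbert
   spaces live in nat => complex, which contains a copy of every finite-dimensional space. *)
theorem theorem7:
  assumes "double_dagger TYPE('a::cstar_algebra)"
  shows "\<exists>(J :: 'a set) (H :: 'a \<Rightarrow> (nat \<Rightarrow> complex) set)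
      (ip :: 'a \<Rightarrow> (nat \<Rightarrow> complex) \<Rightarrow> (nat \<Rightarrow> complex) \<Rightarrow> complex)
      (\<Psi> :: 'a \<Rightarrow> 'a \<Rightarrow> (nat \<Rightarrow> complex) \<Rightarrow> (nat \<Rightarrow> complex)).
    (\<forall>\<alpha>\<in>J. fd_hilbert_space (H \<alpha>) (ip \<alpha>)) \<and>
    isometric_star_iso \<Psi> (c0_sum J (\<lambda>\<alpha>. op_algebra (H \<alpha>) (ip \<alpha>)))"
proof (rule exI[of _ blocks], rule exI[of _ "\<lambda>z. cvec (block_dim z)"],
    rule exI[of _ "\<lambda>z. cvec_inner (block_dim z)"],
    rule exI[of _ "\<lambda>a. \<lambda>z\<in>blocks. block_rep z a"], intro conjI ballI)
  show "fd_hilbert_space (cvec (block_dim z)) (cvec_inner (block_dim z))" for z :: 'a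
    by (rule fd_hilbert_space_cvec)
  show "isometric_star_iso (\<lambda>a. \<lambda>z\<in>blocks. block_rep z (a::'a)) (c0_sum blocks block_ops)"
    by (rule isometric_star_iso_blocks[OF assms])
qed

end
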